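(* Assume $b$ satisfies Assumption 1 (with $\rho\in(1,2)$ as defined there). Suppose either that there are $\alpha>0$, $\kappa\in\mathbb{R}$ with $\mathrm{Tr}(A^{-\alpha})<\infty$, $A^\kappa Q\in\mathcal{B}(H)$, $\alpha-\frac1\rho<\kappa\le\alpha$, and $\nu=\frac1\rho-\alpha+\kappa$; or that $\|A^{(\nu-\frac1\rho)/2}Q^{1/2}\|_{\mathcal{L}_2(H)}<\infty$ for some $\nu\ge0$. If $\mathbb{E}\|u_0\|_\nu^2<\infty$, then there is $C>0$ such that $\mathbb{E}\|u(t)\|_\nu^2\le C$ for all $t\ge0$.
   Context: $H$ real separable Hilbert space with inner product $(\cdot,\cdot)$ and norm $\|\cdot\|$; $A$ densely defined, positive, self-adjoint, unbounded, with compact inverse, orthonormal eigenbasis $\{e_k\}$, eigenvalues $0<\lambda_1\le\lambda_2\le\dots\to\infty$; $\|v\|_s=\|A^{s/2}v\|$. $\mathcal{L}_2(H)$ denotes the Hilbert–Schmidt operators on $H$. Assumption 1: $0\ne b\in L^1_{loc}(\mathbb{R}_+)$ real valued, $b$ and $-\dot b$ nonnegative, nonincreasing and convex, $\lim_{t\to\infty}b(t)=0$, and $\rho:=1+\frac2\pi\sup\{|\arg\widehat b(\lambda)|:\mathrm{Re}\,\lambda>0\}\in(1,2)$, $\widehat b$ the Laplace transform. Resolvent family: $s_k$ solves $\dot s_k(t)+\lambda_k\int_0^tb(t-s)s_k(s)ds=0$, $s_k(0)=1$; $S(t)v=\sum_ks_k(t)(v,e_k)e_k$. $Q$ self-adjoint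 nonnegative bounded on $H$, $W^Q$ a $Q$-Wiener process, $u_0$ an $H$-valued random variable independent of $W^Q$; $u(t)=S(t)u_0+\int_0^tS(t-s)dW^Q(s)$. *)

theory Defs
  imports "HOL-Probability.Probability"
begin

definition laplace :: "(real \<Rightarrow> real) \<Rightarrow> complex \<Rightarrow> complex" where
  "laplace b z = (LINT t:{0<..}|lborel. exp (- z * complex_of_real t) * complex_of_real (b t))"

definition rho_index :: "(real \<Rightarrow> real) \<Rightarrow> real" where
  "rho_index b = 1 + (2 / pi) * (SUP z\<in>{z. 0 < Re z}. \<bar>Arg (laplace b z)\<bar>)"

definition assumption1 :: "(real \<Rightarrow> real) \<Rightarrow> bool" where
  "assumption1 b \<longleftrightarrow>
     (\<forall>T>0. set_integrable lborel {0<..T} b) \<and>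
     (\<exists>t>0. b t \<noteq> 0) \<and>
     (\<forall>t>0. b differentiable (at t)) \<and>
     (\<forall>t>0. 0 \<le> b t) \<and>
     (\<forall>x y. 0 < x \<longrightarrow> x \<le> y \<longrightarrow> b y \<le> b x) \<and>
     convex_on {0<..} b \<and>
     (\<forall>t>0. 0 \<le> - deriv b t) \<and>
     (\<forall>x y. 0 < x \<longrightarrow> x \<le> y \<longrightarrow> - deriv b y \<le> - deriv b x) \<and>
     convex_on {0<..} (\<lambda>t. - deriv b t) \<and>
     (b \<longlongrightarrow> 0) at_top \<and>
     1 < rho_index b \<and> rho_index b < 2"

section \<open>The operator A, given by its orthonormal eigenbasis e and eigenvalues lam\<close>

definition eigen_system :: "(nat \<Rightarrow> 'h::{real_inner,complete_space}) \<Rightarrow> (nat \<Rightarrow> real) \<Rightarrow> bool" where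
  "eigen_system e lam \<longleftrightarrow>
     (\<forall>i j. e i \<bullet> e j = (if i = j then 1 else 0)) \<and>
     closure (span (range e)) = UNIV \<and>
     0 < lam 0 \<and> mono lam \<and> filterlim lam at_top sequentially"

text \<open>Squared norm of the element with coefficients c (w.r.t. e) in the space with norm
  \<open>\<parallel>v\<parallel>_nu = \<parallel>A^(nu/2) v\<parallel>\<close>; value infinity if not in the domain.\<close>
definition nu_norm_sq :: "(nat \<Rightarrow> real) \<Rightarrow> real \<Rightarrow> (nat \<Rightarrow> real) \<Rightarrow> ennreal" where
  "nu_norm_sq lam \<nu> c = (\<Sum>k. ennreal (lam k powr \<nu> * (c k)\<^sup>2))"

definition trace_Apow_finite :: "(nat \<Rightarrow> real) \<Rightarrow> real \<Rightarrow> bool" where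
  "trace_Apow_finite lam \<alpha> \<longleftrightarrow> summable (\<lambda>k. lam k powr (- \<alpha>))"

definition Apow_comp_bounded ::
  "(nat \<Rightarrow> 'h::{real_inner,complete_space}) \<Rightarrow> (nat \<Rightarrow> real) \<Rightarrow> real \<Rightarrow> ('h \<Rightarrow> 'h) \<Rightarrow> bool" where
  "Apow_comp_bounded e lam \<kappa> Q \<longleftrightarrow>
     (\<exists>C. \<forall>v. summable (\<lambda>k. (lam k powr \<kappa> * (Q v \<bullet> e k))\<^sup>2) \<and>
              (\<Sum>k. (lam k powr \<kappa> * (Q v \<bullet> e k))\<^sup>2) \<le> C\<^sup>2 * (norm v)\<^sup>2)"

definition bounded_sa_nonneg :: "('h::{real_inner,complete_space} \<Rightarrow> 'h) \<Rightarrow> bool" where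
  "bounded_sa_nonneg Q \<longleftrightarrow> bounded_linear Q \<and> (\<forall>x y. Q x \<bullet> y = x \<bullet> Q y) \<and> (\<forall>x. 0 \<le> Q x \<bullet> x)"

definition op_sqrt :: "('h::{real_inner,complete_space} \<Rightarrow> 'h) \<Rightarrow> ('h \<Rightarrow> 'h)" where
  "op_sqrt Q = (THE R. bounded_sa_nonneg R \<and> R \<circ> R = Q)"

definition HS_norm_sq_Apow ::
  "(nat \<Rightarrow> 'h::{real_inner,complete_space}) \<Rightarrow> (nat \<Rightarrow> real) \<Rightarrow> real \<Rightarrow> ('h \<Rightarrow> 'h) \<Rightarrow> ennreal" where
  "HS_norm_sq_Apow e lam \<beta> R = (\<Sum>j. \<Sum>k. ennreal ((lam k powr \<beta> * (R (e j) \<bullet> e k))\<^sup>2))"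

definition resolvent_family :: "(real \<Rightarrow> real) \<Rightarrow> (nat \<Rightarrow> real) \<Rightarrow> (nat \<Rightarrow> real \<Rightarrow> real) \<Rightarrow> bool" where
  "resolvent_family b lam s \<longleftrightarrow>
     (\<forall>k. s k 0 = 1 \<and>
       (\<forall>t\<ge>0. (s k has_real_derivative (- lam k * (LBINT \<tau>=0..t. b (t - \<tau>) * s k \<tau>)))
                 (at t within {0..})))"

section \<open>Cylindrical Q-Wiener process (W t h = (W^Q(t), h))\<close>

definition cyl_Q_wiener :: "'a measure \<Rightarrow> ('h::{real_inner,complete_space} \<Rightarrow> 'h) \<Rightarrow> (real \<Rightarrow> 'h \<Rightarrow> 'a \<Rightarrow> real) \<Rightarrow> bool" where
  "cyl_Q_wiener M Q W \<longleftrightarrow>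
     (\<forall>t h. W t h \<in> borel_measurable M) \<and>
     (\<forall>(n::nat) (c::nat \<Rightarrow> real) (ts::nat \<Rightarrow> real) (hs::nat \<Rightarrow> 'h).
        (\<forall>i<n. 0 \<le> ts i) \<longrightarrow>
        (LINT \<omega>|M. cis (\<Sum>i<n. c i * W (ts i) (hs i) \<omega>)) =
          complex_of_real (exp (- (\<Sum>i<n. \<Sum>j<n. c i * c j * min (ts i) (ts j) * (Q (hs i) \<bullet> hs j)) / 2))) \<and>
     (\<forall>h. AE \<omega> in M. continuous_on {0..} (\<lambda>t. W t h \<omega>))"

definition indep_of_process :: "'a measure \<Rightarrow> ('a \<Rightarrow> 'h::topological_space) \<Rightarrow> (real \<Rightarrow> 'h \<Rightarrow> 'a \<Rightarrow> real) \<Rightarrow> bool" where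
  "indep_of_process M u0 W \<longleftrightarrow>
     prob_space.indep_set M
       (sigma_sets (space M) {u0 -` A \<inter> space M | A. A \<in> sets borel})
       (sigma_sets (space M) {W t h -` B \<inter> space M | t h B. B \<in> sets borel})"

text \<open>Coefficient (u(t), e_k) of the mild solution
  u(t) = S(t) u0 + int_0^t S(t-s) dW^Q(s).  The stochastic integral of the deterministic C^1
  integrand s_k(t - .) is the Paley--Wiener integral, written via integration by parts.\<close>
definition stoch_conv_coef ::
  "(nat \<Rightarrow> real \<Rightarrow> real) \<Rightarrow> (real \<Rightarrow> 'h \<Rightarrow> 'a \<Rightarrow> real) \<Rightarrow> (nat \<Rightarrow> 'h) \<Rightarrow> nat \<Rightarrow> real \<Rightarrow> 'a \<Rightarrow> real" where
  "stoch_conv_coef s W e k t \<omega> =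
     W t (e k) \<omega> + (LBINT \<tau>=0..t. W \<tau> (e k) \<omega> * deriv (s k) (t - \<tau>))"

definition sol_coef ::
  "(nat \<Rightarrow> real \<Rightarrow> real) \<Rightarrow> ('a \<Rightarrow> 'h::real_inner) \<Rightarrow> (real \<Rightarrow> 'h \<Rightarrow> 'a \<Rightarrow> real) \<Rightarrow> (nat \<Rightarrow> 'h) \<Rightarrow> real \<Rightarrow> 'a \<Rightarrow> nat \<Rightarrow> real" where
  "sol_coef s u0 W e t \<omega> k = s k t * (u0 \<omega> \<bullet> e k) + stoch_conv_coef s W e k t \<omega>"

end

theory Submission
  imports Defs "HOL-Complex_Analysis.Complex_Analysis"
begin

text \<open>
  In the eigenbasis the solution decouples: the \<open>k\<close>-th coefficient is \<open>s\<^sub>k(t) (u\<^sub>0, e\<^sub>k)\<close> plus a Gaussian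
  variable of variance \<open>(Q e\<^sub>k, e\<^sub>k) \<integral>\<^sub>0\<^sup>t s\<^sub>k\<^sup>2\<close>. Hence two bounds on the scalar resolvents suffice:
  \<open>\<bar>s\<^sub>k\<bar> \<le> 1\<close> and \<open>\<integral>\<^sub>0\<^sup>\<infinity> s\<^sub>k\<^sup>2 \<le> C \<lambda>\<^sub>k powr (-1/\<rho>)\<close>; either hypothesis on \<open>A\<close> and \<open>Q\<close> then makes the sum
  over \<open>k\<close> of \<open>\<lambda>\<^sub>k powr (\<nu> - 1/\<rho>) (Q e\<^sub>k, e\<^sub>k)\<close> finite.

  The first bound is the energy identity together with \<open>Re B \<ge> 0\<close> in the right half-plane, where \<open>B\<close> is
  the Laplace transform of \<open>b\<close>.
  For the second, Plancherel reduces to integrating \<open>1 / \<bar>z + \<lambda> B(z)\<bar>\<^sup>2\<close> over a vertical line. By the sector condition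
  \<open>\<bar>z + \<lambda> B(z)\<bar>\<close> is comparable to \<open>\<bar>z\<bar> + \<lambda> \<bar>B(z)\<bar>\<close>, and \<open>\<bar>B(\<sigma> + i w)\<bar> \<ge> c w powr (1 - \<rho>)\<close> for \<open>w \<ge> 1\<close>:
  convexity of \<open>b\<close> bounds \<open>\<bar>B(\<sigma> + i w)\<bar>\<close> below by \<open>B(w)\<close>, and the Schwarz lemma controls the decay of
  \<open>B\<close> on the positive axis. Splitting the integral at \<open>\<bar>w\<bar> = \<lambda> powr (1/\<rho>)\<close> gives the exponent.
\<close>

section \<open>The operator square root\<close>

text \<open>Neither \<open>b\<close> nor a resolvent is assumed integrable on the half-line, and the
  sector condition concerns the open half-plane only. So every transform is taken of a function
  damped by exp(-\<sigma> t), with estimates uniform for 0 < \<sigma> \<le> 1. The damping is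
  removed at the end: by \<sigma> \<longrightarrow> 0 in the pointwise bound, and by \<sigma> =
  1/(1+T), at the price of a factor \<open>exp 2\<close>, in the square integral up to T. The
  hypotheses on \<open>b\<close> state no decay rate for B. The rate comes from the angle alone:
  \<rho> - 1 = 2 \<theta> / \<pi> is the reciprocal of the power that opens a sector of half-angle
  \<theta> to a half-plane. The splitting point is where w and \<lambda> w^(1-\<rho>) balance, and
  both ranges then contribute the order \<lambda>^(-1/\<rho>). The square root is constructed by
  hand because \<open>op_sqrt\<close> is a definite description, which carries information only
  after existence and uniqueness are proved. The stochastic integral is defined pathwise by parts.
  Only an upper bound on its second moment is wanted, so Fatou's lemma replaces the
  isometry.\<close>

lemma summable_norm_complete:
  fixes f :: "nat \<Rightarrow> 'h::{real_normed_vector,complete_space}"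
  assumes "summable (\<lambda>n. norm (f n))"
  shows "summable f"
proof -
  have "Cauchy (\<lambda>n. sum f {..<n})"
  proof (rule CauchyI')
    fix \<epsilon> :: real assume "\<epsilon> > 0"
    then obtain N where N: "\<And>m n. m \<ge> N \<Longrightarrow> norm (\<Sum>i=m..<n. norm (f i)) < \<epsilon>"
      using assms unfolding summable_Cauchy by meson
    have "dist (sum f {..<m}) (sum f {..<n}) < \<epsilon>" if "m \<ge> N" "n > m" for m n
    proof -
      have "sum f {..<n} - sum f {..<m} = sum f {m..<n}"
        using that by (simp add: lessThan_atLeast0 sum_diff_nat_ivl)
      then have "dist (sum f {..<m}) (sum f {..<n}) = norm (sum f {m..<n})"
        by (metis dist_commute dist_norm)
      also have "\<dots> \<le> (\<Sum>i=m..<n. norm (f i))" by (rule norm_sum)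
      also have "\<dots> < \<epsilon>" using N[OF that(1), of n] by simp
      finally show ?thesis .
    qed
    then show "\<exists>M. \<forall>m\<ge>M. \<forall>n>m. dist (sum f {..<m}) (sum f {..<n}) < \<epsilon>" by blast
  qed
  then show ?thesis
    by (simp add: Cauchy_convergent summable_iff_convergent)
qed

text \<open>The Taylor coefficients of sqrt(1 - x) at 0.\<close>

definition sqrt_coeff :: "nat \<Rightarrow> real" where
  "sqrt_coeff n = (1/2 gchoose n) * (-1) ^ n"

lemma sqrt_coeff_0 [simp]: "sqrt_coeff 0 = 1"
  by (simp add: sqrt_coeff_def)

text \<open>The identity sqrt(1 - x)^2 = 1 - x, read coefficientwise: Vandermonde adds the two upper
  indices 1/2 to 1, and \<open>1 choose k\<close> vanishes for k > 1.\<close>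

lemma sqrt_coeff_convolution:
  "(\<Sum>i\<le>k. sqrt_coeff i * sqrt_coeff (k - i)) = (if k = 0 then 1 else if k = 1 then -1 else 0)"
proof -
  have "(\<Sum>i\<le>k. sqrt_coeff i * sqrt_coeff (k - i))
      = (\<Sum>i=0..k. (1/2 gchoose i) * (1/2 gchoose (k - i))) * (-1::real) ^ k"
    unfolding sum_distrib_right atMost_atLeast0
    by (intro sum.cong) (auto simp: sqrt_coeff_def simp flip: power_add)
  also have "\<dots> = (1 gchoose k) * (-1) ^ k"
    by (simp add: gbinomial_Vandermonde)
  also have "(1::real) gchoose k = real (1 choose k)"
    by (metis binomial_gbinomial of_nat_1)
  finally show ?thesis
    by (cases k) (auto simp: binomial_eq_0)
qed

text \<open>Absorbing the sign turns the coefficient into a Pochhammer product starting at -1/2, and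
  that first factor is the only negative one.\<close>

lemma sqrt_coeff_nonpos: "sqrt_coeff (Suc n) \<le> 0"
proof -
  have "pochhammer (1/2::real) n \<ge> 0" by (intro pochhammer_nonneg) auto
  then show ?thesis
    by (simp add: sqrt_coeff_def gbinomial_pochhammer pochhammer_rec mult.commute mult.left_commute
        flip: power_mult_distrib)
qed

text \<open>Partial sums are the coefficients of sqrt(1 - x) / (1 - x) = (1 - x)^(-1/2), which are
  positive.\<close>

lemma sum_sqrt_coeff_nonneg: "(\<Sum>k\<le>m. sqrt_coeff k) \<ge> 0"
proof -
  have "(\<Sum>k\<le>m. sqrt_coeff k) = (-1) ^ m * ((1/2 - 1) gchoose m)"
    unfolding sqrt_coeff_def by (rule gbinomial_sum_lower_neg)
  also have "\<dots> = pochhammer (1/2) m / fact m"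
    by (simp add: gbinomial_pochhammer flip: power_mult_distrib)
  also have "\<dots> \<ge> 0" by (intro divide_nonneg_nonneg pochhammer_nonneg) auto
  finally show ?thesis .
qed

lemma abs_sqrt_coeff: "\<bar>sqrt_coeff n\<bar> = (if n = 0 then 2 else 0) - sqrt_coeff n"
  using sqrt_coeff_nonpos by (cases n) auto

text \<open>All coefficients but the leading 1 are nonpositive, so the absolute values sum to 2
  minus an ordinary partial sum, which is nonnegative. Convergence at the endpoint |x| = 1 is
  essential, since \<open>B\<close> will only be a contraction.\<close>

lemma summable_abs_sqrt_coeff: "summable (\<lambda>n. \<bar>sqrt_coeff n\<bar>)"
proof (rule bounded_imp_summable)
  show "sum (\<lambda>n. \<bar>sqrt_coeff n\<bar>) {..n} \<le> 2" for n
    using sum_sqrt_coeff_nonneg[of n] by (simp add: abs_sqrt_coeff sum_subtractf)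
qed auto

locale sa_contraction =
  fixes B :: "'h::{real_inner,complete_space} \<Rightarrow> 'h"
  assumes lin: "linear B" and sa: "\<And>x y. B x \<bullet> y = x \<bullet> B y" and contr: "\<And>x. norm (B x) \<le> norm x"
begin

lemma lin_pow: "linear (B ^^ n)"
  proof (induction n)
  case (Suc n)
  show ?case using linear_compose[OF Suc lin] by (simp only: funpow.simps)
qed (simp add: linear_id[unfolded id_def] id_def)

lemma contr_pow: "norm ((B ^^ n) x) \<le> norm x"
proof (induction n)
  case (Suc n)
  then show ?case using contr[of "(B ^^ n) x"] by simp
qed simp

lemma sa_pow: "(B ^^ n) x \<bullet> y = x \<bullet> (B ^^ n) y"
  by (induction n arbitrary: x y) (simp_all add: sa funpow_swap1)

text \<open>The square root of \<open>id - B\<close> as a binomial series.\<close>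

definition root :: "'h \<Rightarrow> 'h" where
  "root x = (\<Sum>n. sqrt_coeff n *\<^sub>R (B ^^ n) x)"

lemma root_sums: "(\<lambda>n. sqrt_coeff n *\<^sub>R (B ^^ n) x) sums root x"
  unfolding root_def
proof (rule summable_sums[OF summable_norm_complete])
  show "summable (\<lambda>n. norm (sqrt_coeff n *\<^sub>R (B ^^ n) x))"
  proof (rule summable_comparison_test'[OF summable_mult2[OF summable_abs_sqrt_coeff, of "norm x"]])
    show "norm (norm (sqrt_coeff n *\<^sub>R (B ^^ n) x)) \<le> \<bar>sqrt_coeff n\<bar> * norm x" for n
      using mult_left_mono[OF contr_pow[of n x] abs_ge_zero[of "sqrt_coeff n"]] by simp
  qed
qed

lemma root_inner_sums: "(\<lambda>n. sqrt_coeff n * ((B ^^ n) x \<bullet> y)) sums (root x \<bullet> y)"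
  using bounded_linear.sums[OF bounded_linear_inner_left[of y] root_sums[of x]] by simp

lemma linear_root: "linear root"
proof
  fix x y :: 'h and r :: real
  show "root (x + y) = root x + root y"
    using sums_add[OF root_sums[of x] root_sums[of y]] sums_unique2[OF root_sums[of "x + y"]]
    by (simp add: linear_add[OF lin_pow] scaleR_right_distrib)
  show "root (r *\<^sub>R x) = r *\<^sub>R root x"
    using sums_scaleR_right[OF root_sums[of x], of r] sums_unique2[OF root_sums[of "r *\<^sub>R x"]]
    by (simp add: linear_scale[OF lin_pow] mult.commute)
qed

lemma norm_root_le: "norm (root x) \<le> (\<Sum>n. \<bar>sqrt_coeff n\<bar>) * norm x"
proof -
  have "norm (\<Sum>n<N. sqrt_coeff n *\<^sub>R (B ^^ n) x) \<le> (\<Sum>n. \<bar>sqrt_coeff n\<bar>) * norm x" for N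
  proof -
    have "norm (\<Sum>n<N. sqrt_coeff n *\<^sub>R (B ^^ n) x) \<le> (\<Sum>n<N. \<bar>sqrt_coeff n\<bar> * norm x)"
      by (rule order_trans[OF norm_sum]) (auto intro!: sum_mono mult_left_mono contr_pow)
    also have "\<dots> \<le> (\<Sum>n. \<bar>sqrt_coeff n\<bar>) * norm x"
      unfolding sum_distrib_right[symmetric]
      by (intro mult_right_mono sum_le_suminf summable_abs_sqrt_coeff) auto
    finally show ?thesis .
  qed
  then show ?thesis
    using tendsto_norm[OF root_sums[unfolded sums_def, of x]] by (intro Lim_bounded) auto
qed

lemma root_bounded_linear: "bounded_linear root"
  by (rule bounded_linear_intro[where K = "\<Sum>n. \<bar>sqrt_coeff n\<bar>"])
     (auto simp: linear_add[OF linear_root] linear_scale[OF linear_root] norm_root_le mult.commute[of _ "\<Sum>n. \<bar>sqrt_coeff n\<bar>"])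

lemma root_sa: "root x \<bullet> y = x \<bullet> root y"
proof -
  have "(\<lambda>n. sqrt_coeff n * ((B ^^ n) x \<bullet> y)) sums (root y \<bullet> x)"
    using root_inner_sums[of y x] by (simp add: sa_pow inner_commute[of x])
  then show ?thesis
    using sums_unique2[OF root_inner_sums[of x y]] by (simp add: inner_commute)
qed

text \<open>Every coefficient after the first is nonpositive, so replacing each (B^n x, x) by its
  upper bound (x, x) can only lower the partial sums. What remains is (x, x) times a nonnegative
  partial sum of coefficients.\<close>

lemma root_nonneg: "root x \<bullet> x \<ge> 0"
proof -
  have "(\<Sum>n\<le>N. sqrt_coeff n * ((B ^^ n) x \<bullet> x)) \<ge> 0" for N
  proof -
    have "(\<Sum>n\<le>N. sqrt_coeff n * (x \<bullet> x)) \<le> (\<Sum>n\<le>N. sqrt_coeff n * ((B ^^ n) x \<bullet> x))"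
    proof (rule sum_mono)
      fix n
      have "(B ^^ n) x \<bullet> x \<le> norm ((B ^^ n) x) * norm x" by (rule norm_cauchy_schwarz)
      also have "\<dots> \<le> x \<bullet> x"
        by (simp add: dot_square_norm power2_eq_square mult_right_mono contr_pow)
      finally show "sqrt_coeff n * (x \<bullet> x) \<le> sqrt_coeff n * ((B ^^ n) x \<bullet> x)"
        using sqrt_coeff_nonpos by (cases n) (auto intro: mult_left_mono_neg)
    qed
    moreover have "(\<Sum>n\<le>N. sqrt_coeff n * (x \<bullet> x)) \<ge> 0"
      unfolding sum_distrib_right[symmetric] by (intro mult_nonneg_nonneg sum_sqrt_coeff_nonneg) auto
    ultimately show ?thesis by linarith
  qed
  then show ?thesis
    using root_inner_sums[of x x, unfolded sums_def_le] by (intro Lim_bounded2) auto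
qed

text \<open>A power series in \<open>B\<close> commutes with whatever commutes with
  \<open>B\<close>; the uniqueness of the square root rests on this.\<close>

lemma root_commute:
  assumes "bounded_linear T" "\<And>x. T (B x) = B (T x)"
  shows "T (root x) = root (T x)"
proof -
  have "T ((B ^^ n) x) = (B ^^ n) (T x)" for n by (induction n) (auto simp: assms(2))
  then have "(\<lambda>n. sqrt_coeff n *\<^sub>R (B ^^ n) (T x)) sums T (root x)"
    using bounded_linear.sums[OF assms(1) root_sums[of x]]
    by (simp add: linear_scale[OF bounded_linear.linear[OF assms(1)]])
  then show ?thesis using root_sums sums_unique2 by blast
qed

text \<open>A Mertens argument, tested against a vector \<open>y\<close> so that all products become
  scalars. The product of two partial sums runs over a square of indices and the Cauchy product over
  a triangle. The difference is dominated by the same difference for the absolute coefficients,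
  which tends to 0.\<close>

lemma root_root: "root (root x) = x - B x"
proof -
  have eq: "root (root x) \<bullet> y = (x - B x) \<bullet> y" for y
  proof -
    define \<beta> where "\<beta> k = (B ^^ k) x \<bullet> y" for k
    define S where "S N = (\<Sum>n<N. sqrt_coeff n *\<^sub>R (B ^^ n) x)" for N
    define S' where "S' N = (\<Sum>n<N. sqrt_coeff n *\<^sub>R (B ^^ n) y)" for N
    \<comment> \<open>The sum of the products of absolute coefficients over the square minus the
      triangle.\<close>
    define D where "D N = (\<Sum>n<N. \<bar>sqrt_coeff n\<bar>)^2 - (\<Sum>k<N. \<Sum>i\<le>k. \<bar>sqrt_coeff i\<bar> * \<bar>sqrt_coeff (k-i)\<bar>)" for N
    have 1: "(\<lambda>N. S N \<bullet> S' N) \<longlonglongrightarrow> root x \<bullet> root y"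
      unfolding S_def S'_def using root_sums[unfolded sums_def] by (intro tendsto_inner)
    have D0: "D \<longlonglongrightarrow> 0"
    proof -
      have "(\<lambda>k. \<Sum>i\<le>k. \<bar>sqrt_coeff i\<bar> * \<bar>sqrt_coeff (k-i)\<bar>) sums ((\<Sum>k. \<bar>sqrt_coeff k\<bar>) * (\<Sum>k. \<bar>sqrt_coeff k\<bar>))"
        by (rule Cauchy_product_sums) (auto simp: summable_abs_sqrt_coeff)
      then have "D \<longlonglongrightarrow> (\<Sum>k. \<bar>sqrt_coeff k\<bar>)^2 - ((\<Sum>k. \<bar>sqrt_coeff k\<bar>) * (\<Sum>k. \<bar>sqrt_coeff k\<bar>))"
        unfolding D_def sums_def
        by (intro tendsto_intros summable_LIMSEQ summable_abs_sqrt_coeff)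
      then show ?thesis by (simp add: power2_eq_square)
    qed
    have bound: "\<bar>S N \<bullet> S' N - (\<Sum>k<N. \<Sum>i\<le>k. sqrt_coeff i * sqrt_coeff (k-i) * \<beta> k)\<bar> \<le> D N * (norm x * norm y)" for N
    proof -
      let ?P = "{..<N} \<times> {..<N}" and ?T = "{(i,j). i + j < N}"
      have T: "?T \<subseteq> ?P" "finite ?P" by auto
      have "S N \<bullet> S' N = (\<Sum>(n,m)\<in>?P. sqrt_coeff n * sqrt_coeff m * \<beta> (n+m))"
      proof -
        have "(B ^^ n) x \<bullet> (B ^^ m) y = \<beta> (n + m)" for n m
          unfolding \<beta>_def add.commute[of n m] funpow_add by (simp add: sa_pow)
        then show ?thesis
          unfolding S_def S'_def inner_sum_left
          by (simp add: inner_sum_right sum.cartesian_product[symmetric] sum_distrib_left mult_ac)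
      qed
      moreover have "(\<Sum>k<N. \<Sum>i\<le>k. sqrt_coeff i * sqrt_coeff (k-i) * \<beta> k) = (\<Sum>(n,m)\<in>?T. sqrt_coeff n * sqrt_coeff m * \<beta> (n+m))"
        by (subst sum.triangle_reindex) simp
      ultimately have e: "S N \<bullet> S' N - (\<Sum>k<N. \<Sum>i\<le>k. sqrt_coeff i * sqrt_coeff (k-i) * \<beta> k)
          = (\<Sum>(n,m)\<in>?P-?T. sqrt_coeff n * sqrt_coeff m * \<beta> (n+m))"
        using sum_diff[OF T(2,1), of "\<lambda>(n,m). sqrt_coeff n * sqrt_coeff m * \<beta> (n+m)"] by simp
      have "(\<Sum>n<N. \<bar>sqrt_coeff n\<bar>)^2 = (\<Sum>(n,m)\<in>?P. \<bar>sqrt_coeff n\<bar> * \<bar>sqrt_coeff m\<bar>)"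
        by (simp add: power2_eq_square sum_product sum.cartesian_product)
      moreover have "(\<Sum>k<N. \<Sum>i\<le>k. \<bar>sqrt_coeff i\<bar> * \<bar>sqrt_coeff (k-i)\<bar>) = (\<Sum>(n,m)\<in>?T. \<bar>sqrt_coeff n\<bar> * \<bar>sqrt_coeff m\<bar>)"
        by (subst sum.triangle_reindex) simp
      ultimately have e2: "D N = (\<Sum>(n,m)\<in>?P-?T. \<bar>sqrt_coeff n\<bar> * \<bar>sqrt_coeff m\<bar>)"
        using sum_diff[OF T(2,1), of "\<lambda>(n,m). \<bar>sqrt_coeff n\<bar> * \<bar>sqrt_coeff m\<bar>"] by (simp add: D_def)
      have \<beta>: "\<bar>\<beta> k\<bar> \<le> norm x * norm y" for k
        unfolding \<beta>_def by (rule order_trans[OF Cauchy_Schwarz_ineq2]) (simp add: mult_right_mono contr_pow)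
      show ?thesis unfolding e e2 sum_distrib_right
        by (rule order_trans[OF sum_abs]) (auto intro!: sum_mono mult_left_mono \<beta> simp: abs_mult)
    qed
    have "(\<lambda>N. S N \<bullet> S' N - (\<Sum>k<N. \<Sum>i\<le>k. sqrt_coeff i * sqrt_coeff (k-i) * \<beta> k)) \<longlonglongrightarrow> 0"
    proof (rule Lim_null_comparison)
      show "(\<lambda>N. D N * (norm x * norm y)) \<longlonglongrightarrow> 0" using tendsto_mult_left_zero[OF D0] by simp
    qed (use bound in auto)
    moreover have "(\<lambda>N. \<Sum>k<N. \<Sum>i\<le>k. sqrt_coeff i * sqrt_coeff (k-i) * \<beta> k) \<longlonglongrightarrow> \<beta> 0 - \<beta> 1"
    proof (rule tendsto_eventually, rule eventually_sequentiallyI)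
      fix N :: nat assume N: "2 \<le> N"
      have "(\<Sum>k<N. \<Sum>i\<le>k. sqrt_coeff i * sqrt_coeff (k-i) * \<beta> k) = (\<Sum>k<N. (if k = 0 then 1 else if k = 1 then -1 else 0) * \<beta> k)"
        unfolding sum_distrib_right[symmetric] sqrt_coeff_convolution ..
      also have "\<dots> = (\<Sum>k\<in>{0,1}. (if k = 0 then 1 else if k = 1 then -1 else 0) * \<beta> k)"
        using N by (intro sum.mono_neutral_right) auto
      finally show "(\<Sum>k<N. \<Sum>i\<le>k. sqrt_coeff i * sqrt_coeff (k-i) * \<beta> k) = \<beta> 0 - \<beta> 1" by simp
    qed
    ultimately have "(\<lambda>N. S N \<bullet> S' N) \<longlonglongrightarrow> \<beta> 0 - \<beta> 1"
      using tendsto_add by fastforce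
    then have "root x \<bullet> root y = \<beta> 0 - \<beta> 1" using 1 LIMSEQ_unique by blast
    then show ?thesis by (simp add: \<beta>_def root_sa[symmetric] inner_diff_left)
  qed
  then have "(root (root x) - (x - B x)) \<bullet> (root (root x) - (x - B x)) = 0"
    by (simp add: inner_diff_left)
  then show ?thesis by simp
qed

end

section \<open>Existence and uniqueness of nonnegative square roots\<close>

lemma sa_nonneg_cauchy_schwarz:
  assumes "linear B" "\<And>x y. B x \<bullet> y = x \<bullet> B y" "\<And>x. 0 \<le> B x \<bullet> x"
  shows "(B x \<bullet> y)\<^sup>2 \<le> (B x \<bullet> x) * (B y \<bullet> y)"
proof -
  have q: "0 \<le> B x \<bullet> x + 2 * r * (B x \<bullet> y) + r\<^sup>2 * (B y \<bullet> y)" for r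
  proof -
    have "0 \<le> B (x + r *\<^sub>R y) \<bullet> (x + r *\<^sub>R y)" by (rule assms)
    also have "\<dots> = B x \<bullet> x + 2 * r * (B x \<bullet> y) + r\<^sup>2 * (B y \<bullet> y)"
      using assms(2)[of y x]
      by (simp add: linear_add[OF assms(1)] linear_scale[OF assms(1)] inner_add inner_commute
        power2_eq_square algebra_simps)
    finally show ?thesis .
  qed
  show ?thesis
  proof (cases "B y \<bullet> y = 0")
    case True
    have "B x \<bullet> y = 0"
    proof (rule ccontr)
      assume "B x \<bullet> y \<noteq> 0"
      \<comment> \<open>The quadratic is affine here; at this value of \<open>r\<close> it equals
        -1.\<close>
      then show False using q[of "- (B x \<bullet> x + 1) / (2 * (B x \<bullet> y))"] True
        by (simp add: field_simps)
    qed
    then show ?thesis using assms(3) True by simp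
  next
    case False
    then have p: "B y \<bullet> y > 0" using assms(3)[of y] by linarith
    \<comment> \<open>The chosen \<open>r\<close> is the minimiser of the quadratic.\<close>
    have "0 \<le> (B x \<bullet> x + 2 * (- (B x \<bullet> y) / (B y \<bullet> y)) * (B x \<bullet> y) + (- (B x \<bullet> y) / (B y \<bullet> y))\<^sup>2 * (B y \<bullet> y)) * (B y \<bullet> y)"
      using p by (intro mult_nonneg_nonneg q) auto
    also have "\<dots> = (B x \<bullet> x) * (B y \<bullet> y) - (B x \<bullet> y)\<^sup>2"
      using p by (simp add: field_simps power2_eq_square)
    finally show ?thesis by simp
  qed
qed

lemma nonneg_sqrt_exists:
  fixes Q :: "'h::{real_inner,complete_space} \<Rightarrow> 'h"
  assumes Q: "bounded_sa_nonneg Q"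
  obtains R where "bounded_sa_nonneg R" "\<And>x. R (R x) = Q x"
    "\<And>T x. bounded_linear T \<Longrightarrow> (\<And>x. T (Q x) = Q (T x)) \<Longrightarrow> T (R x) = R (T x)"
proof -
  have bl: "bounded_linear Q" and sa: "\<And>x y. Q x \<bullet> y = x \<bullet> Q y" and nn: "\<And>x. 0 \<le> Q x \<bullet> x"
    using Q by (auto simp: bounded_sa_nonneg_def)
  note lin = bounded_linear.linear[OF bl]
  obtain K where K: "K > 0" "\<And>x. norm (Q x) \<le> norm x * K" using bounded_linear.pos_bounded[OF bl] by auto
  \<comment> \<open>For 0 \<le> Q \<le> K this operator lies between 0 and 1, and Q / K = 1 - B has
    the binomial root.\<close>
  define B where "B x = x - (1/K) *\<^sub>R Q x" for x
  have linB: "linear B"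
    unfolding B_def by (auto intro!: linearI simp: linear_add[OF lin] linear_scale[OF lin] algebra_simps)
  have saB: "B x \<bullet> y = x \<bullet> B y" for x y by (simp add: B_def inner_diff_left inner_diff_right sa)
  have B1: "B x \<bullet> x \<le> x \<bullet> x" for x using nn[of x] K(1) by (simp add: B_def inner_diff_left)
  have B0: "0 \<le> B x \<bullet> x" for x
  proof -
    have "Q x \<bullet> x \<le> norm (Q x) * norm x" by (rule norm_cauchy_schwarz)
    also have "\<dots> \<le> (norm x * K) * norm x" by (intro mult_right_mono K) auto
    also have "\<dots> = K * (x \<bullet> x)" by (simp add: dot_square_norm power2_eq_square)
    finally show ?thesis using K(1) by (simp add: B_def inner_diff_left field_simps)
  qed
  have "norm (B x) \<le> norm x" for x
  proof -
    \<comment> \<open>Cauchy-Schwarz for the form of \<open>B\<close>, at \<open>x\<close> and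
      \<open>B x\<close>, turns the bound on the quadratic form into a bound on the norm.\<close>
    have "(B x \<bullet> B x)\<^sup>2 \<le> (B x \<bullet> x) * (B (B x) \<bullet> B x)"
      by (rule sa_nonneg_cauchy_schwarz[OF linB saB B0])
    also have "\<dots> \<le> (x \<bullet> x) * (B x \<bullet> B x)" by (intro mult_mono B1 B0) auto
    finally have "(B x \<bullet> B x) * (B x \<bullet> B x) \<le> (x \<bullet> x) * (B x \<bullet> B x)" by (simp add: power2_eq_square)
    then have "B x \<bullet> B x \<le> x \<bullet> x"
      by (metis inner_ge_zero less_eq_real_def mult_le_cancel_right_pos)
    then show ?thesis by (simp add: norm_le)
  qed
  then interpret sa_contraction B by (rule sa_contraction.intro[OF linB saB])
  define R where "R x = sqrt K *\<^sub>R root x" for x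
  show thesis
  proof
    show "bounded_sa_nonneg R"
      unfolding bounded_sa_nonneg_def R_def
      using root_nonneg K(1) by (auto intro: bounded_linear_scaleR_right[THEN bounded_linear_compose] root_bounded_linear simp: root_sa)
    show "R (R x) = Q x" for x
      using K(1) by (simp add: R_def linear_scale[OF linear_root] root_root B_def)
    show "T (R x) = R (T x)" if T: "bounded_linear T" "\<And>x. T (Q x) = Q (T x)" for T x
      using root_commute[OF T(1), of x] T(2)
      by (simp add: R_def linear_scale[OF bounded_linear.linear[OF T(1)]] B_def linear_diff[OF bounded_linear.linear[OF T(1)]])
  qed
qed

text \<open>Another root R' commutes with Q = R'^2, hence with the constructed R. For y = R x - R' x
  this gives (R + R') y = R^2 x - R'^2 x = 0, so both nonnegative forms vanish at y. Cauchy-Schwarz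
  then gives R y = R' y = 0, and (y, y) = (x, R y - R' y) = 0.\<close>

lemma op_sqrt:
  fixes Q :: "'h::{real_inner,complete_space} \<Rightarrow> 'h"
  assumes Q: "bounded_sa_nonneg Q"
  shows "bounded_sa_nonneg (op_sqrt Q)" "op_sqrt Q (op_sqrt Q x) = Q x"
proof -
  obtain R where R: "bounded_sa_nonneg R" "\<And>x. R (R x) = Q x"
    and comm: "\<And>T x. bounded_linear T \<Longrightarrow> (\<And>x. T (Q x) = Q (T x)) \<Longrightarrow> T (R x) = R (T x)"
    using nonneg_sqrt_exists[OF Q] by metis
  have uniq: "R' = R" if R': "bounded_sa_nonneg R'" "R' \<circ> R' = Q" for R'
  proof
    fix x
    have R'R': "R' (R' x) = Q x" for x using fun_cong[OF R'(2), of x] by simp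
    have blR: "bounded_linear R" "bounded_linear R'" using R R' by (auto simp: bounded_sa_nonneg_def)
    note lin = blR[THEN bounded_linear.linear]
    have c: "R' (R x) = R (R' x)" for x
      by (rule comm[OF blR(2)]) (simp flip: R'R')
    define y where "y = R x - R' x"
    have "R y + R' y = 0"
      by (simp add: y_def linear_diff[OF lin(1)] linear_diff[OF lin(2)] R R'R' c)
    then have "R y \<bullet> y + R' y \<bullet> y = 0" by (simp flip: inner_add_left)
    moreover have "R y \<bullet> y \<ge> 0" "R' y \<bullet> y \<ge> 0" using R R' by (auto simp: bounded_sa_nonneg_def)
    ultimately have z: "R y \<bullet> y = 0" "R' y \<bullet> y = 0" by linarith+
    have "T y = 0" if T: "bounded_sa_nonneg T" "T y \<bullet> y = 0" for T
    proof -
      have "(T y \<bullet> T y)\<^sup>2 \<le> (T y \<bullet> y) * (T (T y) \<bullet> T y)"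
        using T by (intro sa_nonneg_cauchy_schwarz) (auto simp: bounded_sa_nonneg_def bounded_linear.linear)
      then show ?thesis using T by simp
    qed
    then have Ty: "R y = 0" "R' y = 0" using R R' z by auto
    have saR: "R x \<bullet> y = x \<bullet> R y" "R' x \<bullet> y = x \<bullet> R' y" for y using R R' by (auto simp: bounded_sa_nonneg_def)
    have "y \<bullet> y = 0"
      using saR[of y] Ty by (subst (1) y_def) (simp add: inner_diff_left)
    then show "R' x = R x" by (simp add: y_def)
  qed
  have "op_sqrt Q = R"
    unfolding op_sqrt_def
  proof (rule the_equality)
    show "bounded_sa_nonneg R \<and> R \<circ> R = Q" using R by (simp add: fun_eq_iff)
    show "R' = R" if "bounded_sa_nonneg R' \<and> R' \<circ> R' = Q" for R' using uniq that by blast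
  qed
  then show "bounded_sa_nonneg (op_sqrt Q)" "op_sqrt Q (op_sqrt Q x) = Q x" using R by auto
qed

text \<open>The half of Parseval that uses density of the span. A vector w of the span close to v is
  no closer than the orthogonal projection p of v onto the basis vectors occurring in w, and the
  norm of p is bounded by the coefficients of v. Values in \<open>ennreal\<close> make the divergent
  case trivial.\<close>

lemma parseval_le:
  fixes e :: "nat \<Rightarrow> 'h::{real_inner,complete_space}"
  assumes on: "\<And>i j. e i \<bullet> e j = (if i = j then 1 else 0)" and cl: "closure (span (range e)) = UNIV"
  shows "ennreal ((norm v)\<^sup>2) \<le> (\<Sum>j. ennreal ((e j \<bullet> v)\<^sup>2))"
proof (cases "(\<Sum>j. ennreal ((e j \<bullet> v)\<^sup>2)) = \<infinity>")
  case False
  define c where "c j = e j \<bullet> v" for j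
  have sm: "summable (\<lambda>j. (c j)\<^sup>2)"
    using False by (intro summable_suminf_not_top) (auto simp: c_def)
  have key: "norm v \<le> sqrt (\<Sum>j. (c j)\<^sup>2) + \<delta>" if "\<delta> > 0" for \<delta>
  proof -
    have "v \<in> closure (span (range e))" using cl by simp
    then obtain w where w: "w \<in> span (range e)" "dist w v < \<delta>"
      using \<open>\<delta> > 0\<close> by (meson closure_approachable)
    then obtain S r where S: "finite S" "S \<subseteq> range e" "w = (\<Sum>a\<in>S. r a *\<^sub>R a)"
      unfolding span_explicit by auto
    then obtain J where J: "finite J" "S = e ` J" by (metis finite_subset_image)
    define p where "p = (\<Sum>j\<in>J. c j *\<^sub>R e j)"
    have pe: "(v - p) \<bullet> e i = 0" if "i \<in> J" for i
      using that J(1) by (simp add: p_def inner_diff_left inner_sum_left on c_def inner_commute[of v] if_distrib cong: if_cong)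
    have orth: "(v - p) \<bullet> (p - w) = 0"
    proof -
      have "(v - p) \<bullet> p = (\<Sum>j\<in>J. c j * ((v - p) \<bullet> e j))"
        by (subst (2) p_def) (simp add: inner_sum_right)
      moreover have "(v - p) \<bullet> w = (\<Sum>a\<in>S. r a * ((v - p) \<bullet> a))"
        by (simp add: S(3) inner_sum_right)
      ultimately show ?thesis
        using pe by (simp add: inner_diff_right J(2) sum.neutral)
    qed
    have "(norm (v - w))\<^sup>2 = (norm (v - p))\<^sup>2 + (norm (p - w))\<^sup>2"
      using orth by (simp add: power2_norm_eq_inner inner_diff_left inner_diff_right inner_commute)
    then have "(norm (v - p))\<^sup>2 \<le> (norm (v - w))\<^sup>2" by simp
    then have "norm (v - p) \<le> norm (v - w)" by (rule power2_le_imp_le) simp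
    then have vp: "norm (v - p) \<le> \<delta>" using w(2) by (simp add: dist_norm norm_minus_commute)
    have "p \<bullet> p = (\<Sum>j\<in>J. (c j)\<^sup>2)"
      using J(1) by (simp add: p_def inner_sum_left inner_sum_right on power2_eq_square if_distrib sum.delta cong: if_cong)
    also have "\<dots> \<le> (\<Sum>j. (c j)\<^sup>2)" by (intro sum_le_suminf sm J) auto
    finally have "norm p \<le> sqrt (\<Sum>j. (c j)\<^sup>2)" by (simp add: norm_eq_sqrt_inner)
    then show ?thesis using vp norm_triangle_sub[of v p] by linarith
  qed
  have "norm v \<le> sqrt (\<Sum>j. (c j)\<^sup>2)"
    by (rule field_le_epsilon) (use key in auto)
  then have "(norm v)\<^sup>2 \<le> (\<Sum>j. (c j)\<^sup>2)"
    using power_mono[of "norm v" "sqrt (\<Sum>j. (c j)\<^sup>2)" 2] by (simp add: suminf_nonneg[OF sm])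
  then show ?thesis
    by (simp add: suminf_ennreal2 sm ennreal_leI flip: c_def)
qed simp

section \<open>Fourier transforms of real functions\<close>

lemma integrable_pair_mult:
  fixes f :: "'a \<Rightarrow> 'c::{real_normed_field,banach,second_countable_topology}"
  assumes "pair_sigma_finite M1 M2" "integrable M1 f" "integrable M2 g"
  shows "integrable (M1 \<Otimes>\<^sub>M M2) (\<lambda>p. f (fst p) * g (snd p))"
proof -
  interpret pair_sigma_finite M1 M2 by fact
  have [measurable]: "f \<in> borel_measurable M1" "g \<in> borel_measurable M2" using assms by auto
  show ?thesis
  proof (rule Fubini_integrable)
    show "integrable M1 (\<lambda>x. LINT y|M2. norm (f (fst (x, y)) * g (snd (x, y))))"
      using assms by (simp add: norm_mult)
  qed (use assms in \<open>auto simp: case_prod_unfold\<close>)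
qed

definition fourier :: "(real \<Rightarrow> real) \<Rightarrow> real \<Rightarrow> complex" where
  "fourier h w = (LBINT t. complex_of_real (h t) * cis (- (w * t)))"

lemma integrable_mult_cis:
  assumes "integrable lborel h"
  shows "integrable lborel (\<lambda>t. complex_of_real (h t) * cis (w * t))"
proof (rule Bochner_Integration.integrable_bound[OF assms])
  have [measurable]: "h \<in> borel_measurable borel" using assms by auto
  show "(\<lambda>t. complex_of_real (h t) * cis (w * t)) \<in> borel_measurable lborel"
    unfolding cis_conv_exp by measurable
qed (simp add: norm_mult)

lemma fourier_measurable [measurable]:
  assumes "integrable lborel h"
  shows "fourier h \<in> borel_measurable borel"
proof -
  have [measurable]: "h \<in> borel_measurable borel" using assms by auto
  show ?thesis unfolding fourier_def cis_conv_exp by measurable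
qed

lemma norm_fourier_le:
  assumes "integrable lborel h"
  shows "norm (fourier h w) \<le> (LBINT t. \<bar>h t\<bar>)"
  unfolding fourier_def by (rule order_trans[OF integral_norm_bound]) (simp add: norm_mult)

text \<open>Positivity and Plancherel need only the real part. In this form w enters through a
  cosine alone, which a Gaussian average over w turns into a Gaussian in the difference of the two
  time variables.\<close>

lemma Re_fourier_mult_cnj:
  assumes g: "integrable lborel g" and f: "integrable lborel f"
  shows "Re (fourier g w * cnj (fourier f w))
    = (LINT p|(lborel \<Otimes>\<^sub>M lborel). g (fst p) * f (snd p) * cos (w * (fst p - snd p)))"
proof -
  let ?g = "\<lambda>t. complex_of_real (g t) * cis (- (w * t))" and ?f = "\<lambda>t. complex_of_real (f t) * cis (w * t)"
  have ig: "integrable lborel ?g" using integrable_mult_cis[OF g, of "-w"] by simp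
  have if': "integrable lborel ?f" using integrable_mult_cis[OF f, of "w"] by simp
  have i: "integrable (lborel \<Otimes>\<^sub>M lborel) (\<lambda>p. ?g (fst p) * ?f (snd p))"
    by (rule integrable_pair_mult[OF _ ig if']) standard
  have c: "cnj (fourier f w) = (LBINT t. ?f t)"
    unfolding fourier_def by (subst Bochner_Integration.integral_cnj[symmetric]) (simp add: cis_cnj)
  have "fourier g w * cnj (fourier f w) = (LBINT t. ?g t * (LBINT s. ?f s))"
    unfolding c by (simp add: fourier_def)
  also have "\<dots> = (LBINT t. (LBINT s. ?g (fst (t, s)) * ?f (snd (t, s))))" by simp
  also have "\<dots> = (LINT p|(lborel \<Otimes>\<^sub>M lborel). ?g (fst p) * ?f (snd p))"
    by (rule lborel_pair.integral_fst'[OF i])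
  finally have "Re (fourier g w * cnj (fourier f w)) = (LINT p|(lborel \<Otimes>\<^sub>M lborel). Re (?g (fst p) * ?f (snd p)))"
    by (simp only: integral_Re[OF i])
  also have "\<dots> = (LINT p|(lborel \<Otimes>\<^sub>M lborel). g (fst p) * f (snd p) * cos (w * (fst p - snd p)))"
    by (rule Bochner_Integration.integral_cong) (auto simp: cos_diff algebra_simps)
  finally show ?thesis .
qed

lemma integral_std_normal_cos:
  "(LINT y|std_normal_distribution. cos (c * y)) = exp (- c\<^sup>2 / 2)"
proof -
  interpret real_distribution std_normal_distribution by (rule real_dist_normal_dist)
  have "integrable std_normal_distribution (\<lambda>x. iexp (c * x))" by (rule integrable_iexp) auto
  then have "Re (char std_normal_distribution c) = (LINT y|std_normal_distribution. Re (iexp (c * y)))"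
    unfolding char_def by (simp only: integral_Re)
  moreover have "Re (iexp (c * y)) = cos (c * y)" for y :: real by (simp add: Re_exp)
  ultimately show ?thesis by (simp only: char_std_normal_distribution Re_complex_of_real)
qed

lemma integral_std_normal:
  fixes h :: "real \<Rightarrow> real"
  assumes [measurable]: "h \<in> borel_measurable borel"
  shows "(LINT x|std_normal_distribution. h x) = (LBINT x. exp (- x\<^sup>2 / 2) * h x) / sqrt (2 * pi)"
proof -
  have "(LINT x|std_normal_distribution. h x) = (LBINT x. std_normal_density x * h x)"
    by (subst integral_density) auto
  also have "\<dots> = (LBINT x. (exp (- x\<^sup>2 / 2) * h x) / sqrt (2 * pi))"
    by (simp add: std_normal_density_def)
  finally show ?thesis by simp
qed

text \<open>The Gaussian factor makes Fubini applicable although \<open>fourier f\<close> need not be integrable; letting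
  \<open>\<delta> \<longrightarrow> 0\<close> recovers the pairing of \<open>g\<close> and \<open>f\<close>.\<close>
lemma integral_gauss_fourier:
  assumes g: "integrable lborel g" and f: "integrable lborel f" and d: "\<delta> > 0"
  shows "(LINT y|std_normal_distribution. Re (fourier g (y / \<delta>) * cnj (fourier f (y / \<delta>))))
    = \<delta> * sqrt (2 * pi) * (LBINT t. g t * (LINT x|std_normal_distribution. f (t - \<delta> * x)))"
proof -
  let ?N = "std_normal_distribution"
  let ?F = "\<lambda>y p. g (fst p) * f (snd p) * cos (y / \<delta> * (fst p - snd p))"
  interpret N: real_distribution ?N by (rule real_dist_normal_dist)
  let ?P = "lborel \<Otimes>\<^sub>M lborel :: (real \<times> real) measure"
  interpret P: sigma_finite_measure ?P by (intro sigma_finite_pair_measure) standard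
  interpret NP: pair_sigma_finite ?N ?P by standard
  have [measurable]: "g \<in> borel_measurable borel" "f \<in> borel_measurable borel" using g f by auto
  let ?G = "\<lambda>p. g (fst p) * f (snd p)"
  have G: "integrable ?P ?G"
    by (rule integrable_pair_mult[OF _ g f]) standard
  have GK: "integrable ?P (\<lambda>p. ?G p * k p)" if "k \<in> borel_measurable ?P" "\<And>p. \<bar>k p\<bar> \<le> 1" for k
  proof (rule Bochner_Integration.integrable_bound[OF G])
    show "(\<lambda>p. ?G p * k p) \<in> borel_measurable ?P" using that(1) by measurable
    show "AE p in ?P. norm (?G p * k p) \<le> norm (?G p)"
      using that(2) by (auto simp: abs_mult mult_left_le)
  qed
  have int: "integrable (?N \<Otimes>\<^sub>M ?P) (\<lambda>(y, p). ?F y p)"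
  proof (rule NP.Fubini_integrable)
    show "(\<lambda>(y, p). ?F y p) \<in> borel_measurable (?N \<Otimes>\<^sub>M ?P)"
      by measurable
    show "AE y in ?N. integrable ?P (\<lambda>p. case (y, p) of (y, p) \<Rightarrow> ?F y p)"
      unfolding prod.case by (intro AE_I2 GK) auto
    show "integrable ?N (\<lambda>y. LINT p|?P. norm (case (y, p) of (y, p) \<Rightarrow> ?F y p))"
    proof (rule N.integrable_const_bound[where B = "LINT p|?P. \<bar>?G p\<bar>"])
      show "AE y in ?N. norm (LINT p|?P. norm (case (y, p) of (y, p) \<Rightarrow> ?F y p)) \<le> (LINT p|?P. \<bar>?G p\<bar>)"
      proof (rule AE_I2)
        fix y
        have "norm (LINT p|?P. norm (?F y p)) = (LINT p|?P. norm (?F y p))"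
          by simp
        also have "\<dots> \<le> (LINT p|?P. \<bar>?G p\<bar>)"
        proof (rule integral_mono)
          show "integrable ?P (\<lambda>p. norm (?F y p))"
            by (intro integrable_norm GK) auto
          show "integrable ?P (\<lambda>p. \<bar>?G p\<bar>)" using G by auto
        qed (simp add: abs_mult mult_left_le)
        finally show "norm (LINT p|?P. norm (case (y, p) of (y, p) \<Rightarrow> ?F y p)) \<le> (LINT p|?P. \<bar>?G p\<bar>)"
          by simp
      qed
    qed measurable
  qed
  have "(LINT y|?N. Re (fourier g (y / \<delta>) * cnj (fourier f (y / \<delta>))))
      = (LINT y|?N. LINT p|?P. ?F y p)"
    by (simp only: Re_fourier_mult_cnj[OF g f])
  also have "\<dots> = (LINT p|?P. LINT y|?N. ?F y p)"
    by (rule NP.Fubini_integral[symmetric, OF int])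
  also have "\<dots> = (LINT p|?P. ?G p * exp (- ((fst p - snd p) / \<delta>)\<^sup>2 / 2))"
  proof (rule Bochner_Integration.integral_cong)
    fix p :: "real \<times> real"
    have "(LINT y|?N. cos (y / \<delta> * (fst p - snd p))) = exp (- ((fst p - snd p) / \<delta>)\<^sup>2 / 2)"
      unfolding integral_std_normal_cos[symmetric] by (simp add: mult.commute)
    then show "(LINT y|?N. ?F y p) = ?G p * exp (- ((fst p - snd p) / \<delta>)\<^sup>2 / 2)"
      by simp
  qed simp
  also have "\<dots> = (LBINT t. LBINT s. g t * f s * exp (- ((t - s) / \<delta>)\<^sup>2 / 2))"
    by (subst lborel_pair.integral_fst'[symmetric]) (auto intro!: GK)
  also have "\<dots> = (LBINT t. \<delta> * sqrt (2 * pi) * (g t * (LINT x|?N. f (t - \<delta> * x))))"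
  proof (rule Bochner_Integration.integral_cong)
    fix t
    \<comment> \<open>Substituting s = t - \<delta> x makes the Gaussian standard; the Jacobian
      \<delta> and the normalisation \<open>sqrt (2 * pi)\<close> form the prefactor.\<close>
    have "(LBINT s. g t * f s * exp (- ((t - s) / \<delta>)\<^sup>2 / 2))
      = \<bar>-\<delta>\<bar> *\<^sub>R (LBINT x. g t * f (t + (-\<delta>) * x) * exp (- ((t - (t + (-\<delta>) * x)) / \<delta>)\<^sup>2 / 2))"
      using d by (intro lborel_integral_real_affine) auto
    also have "\<dots> = \<delta> * (LBINT x. g t * (exp (- x\<^sup>2 / 2) * f (t - \<delta> * x)))"
      using d by (simp add: mult_ac)
    also have "\<dots> = \<delta> * (g t * (LBINT x. exp (- x\<^sup>2 / 2) * f (t - \<delta> * x)))" by simp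
    also have "\<dots> = \<delta> * sqrt (2 * pi) * (g t * (LINT x|?N. f (t - \<delta> * x)))"
      by (subst integral_std_normal) auto
    finally show "(LBINT s. g t * f s * exp (- ((t - s) / \<delta>)\<^sup>2 / 2))
      = \<delta> * sqrt (2 * pi) * (g t * (LINT x|?N. f (t - \<delta> * x)))" .
  qed simp
  finally show ?thesis by simp
qed

text \<open>Dominated convergence twice: inside because \<open>f\<close> is bounded and continuous
  at t, outside with majorant K |g|. The exceptional set \<open>D\<close> admits the jumps that
  cutting off at 0 and at T creates.\<close>

lemma gauss_average_limit:
  fixes f :: "real \<Rightarrow> real"
  assumes g: "integrable lborel g" and f: "f \<in> borel_measurable borel" "\<And>t. \<bar>f t\<bar> \<le> K"
    and D: "finite D" "\<And>t. t \<notin> D \<Longrightarrow> isCont f t"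
  shows "(\<lambda>n. LBINT t. g t * (LINT x|std_normal_distribution. f (t - 1 / real (Suc n) * x))) \<longlonglongrightarrow> (LBINT t. g t * f t)"
proof -
  let ?A = "\<lambda>t n. LINT x|std_normal_distribution. f (t - 1 / real (Suc n) * x)"
  interpret N: real_distribution std_normal_distribution by (rule real_dist_normal_dist)
  have [measurable]: "g \<in> borel_measurable borel" "f \<in> borel_measurable borel" using g f by auto
  have lim: "(\<lambda>n. ?A t n) \<longlonglongrightarrow> f t" if "t \<notin> D" for t
  proof -
    have "(\<lambda>n. ?A t n) \<longlonglongrightarrow> (LINT x|std_normal_distribution. f t)"
    proof (rule integral_dominated_convergence[where w = "\<lambda>_. K"])
      show "AE x in std_normal_distribution. (\<lambda>n. f (t - 1 / real (Suc n) * x)) \<longlonglongrightarrow> f t"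
      proof (rule AE_I2)
        fix x
        have "(\<lambda>n. t - 1 / real (Suc n) * x) \<longlonglongrightarrow> t - 0 * x"
          by (intro tendsto_intros LIMSEQ_Suc[OF lim_1_over_n])
        then show "(\<lambda>n. f (t - 1 / real (Suc n) * x)) \<longlonglongrightarrow> f t"
          using isCont_tendsto_compose[OF D(2)[OF that]] by simp
      qed
    qed (use f in auto)
    then show ?thesis using N.prob_space by simp
  qed
  show ?thesis
  proof (rule integral_dominated_convergence[where w = "\<lambda>t. \<bar>g t\<bar> * K"])
    show "AE t in lborel. (\<lambda>n. g t * ?A t n) \<longlonglongrightarrow> g t * f t"
      by (rule AE_I'[where N = D]) (use D(1) lim in \<open>auto intro!: finite_imp_null_set_lborel tendsto_mult_left\<close>)
    have "\<bar>?A t n\<bar> \<le> K" for t n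
    proof -
      have "\<bar>?A t n\<bar> \<le> (LINT x|std_normal_distribution. K)"
        by (intro order_trans[OF integral_abs_bound] integral_mono)
          (use f in \<open>auto intro!: N.integrable_const_bound[where B = K]\<close>)
      then show ?thesis using N.prob_space by simp
    qed
    then show "AE t in lborel. norm (g t * ?A t n) \<le> \<bar>g t\<bar> * K" for n
      by (auto simp: abs_mult intro!: mult_left_mono)
  qed (use g in \<open>auto\<close>)
qed

text \<open>Intended for \<open>g\<close> the convolution of a kernel with \<open>f\<close>. Then
  \<open>pos\<close> says that the transform of the kernel has nonnegative real part, and the
  conclusion that the kernel is of positive type.\<close>

lemma fourier_positivity:
  assumes g: "integrable lborel g" and f: "integrable lborel f" "\<And>t. \<bar>f t\<bar> \<le> K"
    and D: "finite D" "\<And>t. t \<notin> D \<Longrightarrow> isCont f t"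
    and pos: "\<And>w. w \<noteq> 0 \<Longrightarrow> Re (fourier g w * cnj (fourier f w)) \<ge> 0"
  shows "(LBINT t. g t * f t) \<ge> 0"
proof (rule LIMSEQ_le_const[OF gauss_average_limit[OF g _ f(2) D]])
  \<comment> \<open>The sign is assumed off w = 0 only, and a single point is null for the
    Gaussian.\<close>
  have "AE y in std_normal_distribution. y \<noteq> 0"
    by (subst AE_density) (auto intro: AE_mp[OF AE_lborel_singleton])
  then have nn: "0 \<le> (LINT y|std_normal_distribution. Re (fourier g (y / (1 / real (Suc n))) * cnj (fourier f (y / (1 / real (Suc n))))))" for n
  proof (intro integral_nonneg_AE, eventually_elim)
    case (elim y)
    show ?case by (rule pos) (use elim in simp)
  qed
  have pos': "0 < 1 / real (Suc n)" for n by simp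
  have "0 \<le> 1 / real (Suc n) * sqrt (2 * pi) * (LBINT t. g t * (LINT x|std_normal_distribution. f (t - 1 / real (Suc n) * x)))" for n
    using nn[of n] unfolding integral_gauss_fourier[OF g f(1) pos'[of n]] .
  then have "0 \<le> (LBINT t. g t * (LINT x|std_normal_distribution. f (t - 1 / real (Suc n) * x)))" for n
    using mult_pos_neg[of "1 / real (Suc n) * sqrt (2 * pi)"] by (meson not_less mult_pos_pos pos' real_sqrt_gt_zero pi_gt_zero zero_less_numeral)
  then show "\<exists>N. \<forall>n\<ge>N. 0 \<le> (LBINT t. g t * (LINT x|std_normal_distribution. f (t - 1 / real (Suc n) * x)))"
    by blast
qed (use f in auto)

text \<open>The right side may be infinite a priori. For g = f the Gaussian-averaged pairing is an
  average of |fourier f|^2; bounding the density by its maximum and rescaling gives the inequality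
  for each \<delta>, and the left sides converge.\<close>

lemma plancherel_le:
  assumes f: "integrable lborel f" "\<And>t. \<bar>f t\<bar> \<le> K"
    and D: "finite D" "\<And>t. t \<notin> D \<Longrightarrow> isCont f t"
  shows "ennreal (LBINT t. (f t)\<^sup>2) \<le> ennreal (1 / (2 * pi)) * (\<integral>\<^sup>+ w. ennreal ((norm (fourier f w))\<^sup>2) \<partial>lborel)"
proof -
  interpret N: real_distribution std_normal_distribution by (rule real_dist_normal_dist)
  have [measurable]: "fourier f \<in> borel_measurable borel" by (rule fourier_measurable[OF f(1)])
  define a where "a n = (LBINT t. f t * (LINT x|std_normal_distribution. f (t - 1 / real (Suc n) * x)))" for n
  let ?I = "\<integral>\<^sup>+ w. ennreal ((norm (fourier f w))\<^sup>2) \<partial>lborel"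
  have lim: "a \<longlonglongrightarrow> (LBINT t. (f t)\<^sup>2)"
    unfolding a_def using gauss_average_limit[OF f(1) _ f(2) D] f(1) by (simp add: power2_eq_square)
  have "ennreal (a n) \<le> ennreal (1 / (2 * pi)) * ?I" for n
  proof -
    define d where "d = 1 / real (Suc n)"
    have d: "d > 0" by (simp add: d_def)
    have "d * sqrt (2 * pi) * a n = (LINT y|std_normal_distribution. (norm (fourier f (y / d)))\<^sup>2)"
      unfolding a_def d_def[symmetric] integral_gauss_fourier[OF f(1) f(1) d, symmetric]
      by (simp only: complex_norm_square[symmetric] Re_complex_of_real)
    then have "ennreal (d * sqrt (2 * pi) * a n) = ennreal (LINT y|std_normal_distribution. (norm (fourier f (y / d)))\<^sup>2)"
      by simp
    also have "\<dots> = (\<integral>\<^sup>+y. ennreal ((norm (fourier f (y / d)))\<^sup>2) \<partial>std_normal_distribution)"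
    proof (rule nn_integral_eq_integral[symmetric])
      show "integrable std_normal_distribution (\<lambda>y. (norm (fourier f (y / d)))\<^sup>2)"
        by (rule N.integrable_const_bound[where B = "(LBINT t. \<bar>f t\<bar>)\<^sup>2"])
           (auto intro!: power_mono norm_fourier_le f)
    qed auto
    also have "\<dots> = (\<integral>\<^sup>+y. ennreal (std_normal_density y) * ennreal ((norm (fourier f (y / d)))\<^sup>2) \<partial>lborel)"
      by (subst nn_integral_density) auto
    \<comment> \<open>The maximum of the density supplies one factor 1 / sqrt(2 pi); the prefactor
      of \<open>integral_gauss_fourier\<close> supplies the other.\<close>
    also have "\<dots> \<le> (\<integral>\<^sup>+y. ennreal (1 / sqrt (2 * pi)) * ennreal ((norm (fourier f (y / d)))\<^sup>2) \<partial>lborel)"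
      by (intro nn_integral_mono mult_right_mono ennreal_leI) (auto simp: std_normal_density_def field_simps)
    also have "\<dots> = ennreal (1 / sqrt (2 * pi)) * (\<integral>\<^sup>+y. ennreal ((norm (fourier f (y / d)))\<^sup>2) \<partial>lborel)"
      by (rule nn_integral_cmult) auto
    also have "(\<integral>\<^sup>+y. ennreal ((norm (fourier f (y / d)))\<^sup>2) \<partial>lborel) = ennreal d * ?I"
      using d by (subst nn_integral_real_affine[where c = d and t = 0]) auto
    finally have "ennreal (d * sqrt (2 * pi) * a n) \<le> ennreal (1 / sqrt (2 * pi)) * (ennreal d * ?I)" .
    then have "ennreal (1 / (d * sqrt (2 * pi))) * ennreal (d * sqrt (2 * pi) * a n)
        \<le> ennreal (1 / (d * sqrt (2 * pi))) * (ennreal (1 / sqrt (2 * pi)) * (ennreal d * ?I))"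
      by (rule mult_left_mono) auto
    also have "ennreal (1 / (d * sqrt (2 * pi))) * ennreal (d * sqrt (2 * pi) * a n) = ennreal (a n)"
      using d by (subst ennreal_mult'[symmetric]) auto
    also have "ennreal (1 / (d * sqrt (2 * pi))) * (ennreal (1 / sqrt (2 * pi)) * (ennreal d * ?I))
       = ennreal (1 / (d * sqrt (2 * pi)) * (1 / sqrt (2 * pi)) * d) * ?I"
      using d by (simp add: ennreal_mult'[symmetric] mult.assoc[symmetric])
    also have "1 / (d * sqrt (2 * pi)) * (1 / sqrt (2 * pi)) * d = 1 / (2 * pi)"
      using d by (simp add: field_simps)
    finally show ?thesis .
  qed
  then show ?thesis
    using lim by (intro Lim_bounded[OF tendsto_ennrealI]) auto
qed

section \<open>The damped kernel\<close>

lemma convolution_integral: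
  fixes F G :: "real \<Rightarrow> 'c::{real_normed_field,banach,second_countable_topology}"
  assumes F: "integrable lborel F" and G: "integrable lborel G"
  shows integrable_convolution: "integrable lborel (\<lambda>t. LBINT \<tau>. G (t - \<tau>) * F \<tau>)"
    and integral_convolution: "(LBINT t. LBINT \<tau>. G (t - \<tau>) * F \<tau>) = (LBINT t. G t) * (LBINT t. F t)"
proof -
  have [measurable]: "F \<in> borel_measurable borel" "G \<in> borel_measurable borel" using F G by auto
  have iG: "integrable lborel (\<lambda>t. G (t - \<tau>))" for \<tau>
    using lborel_integrable_real_affine[OF G, of 1 "-\<tau>"] by simp
  have eG: "(LBINT t. G (t - \<tau>)) = (LBINT t. G t)" for \<tau>
    using lborel_integral_real_affine[of 1 G "-\<tau>"] by simp
  have inG: "(LBINT t. norm (G (t - \<tau>))) = (LBINT t. norm (G t))" for \<tau>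
    using lborel_integral_real_affine[of 1 "\<lambda>t. norm (G t)" "-\<tau>"] by simp
  have int: "integrable (lborel \<Otimes>\<^sub>M lborel) (\<lambda>(\<tau>, t). G (t - \<tau>) * F \<tau>)"
  proof (rule lborel_pair.Fubini_integrable)
    show "integrable lborel (\<lambda>\<tau>. LBINT t. norm (case (\<tau>, t) of (\<tau>, t) \<Rightarrow> G (t - \<tau>) * F \<tau>))"
      using F by (simp add: norm_mult inG)
  qed (use iG in auto)
  show "integrable lborel (\<lambda>t. LBINT \<tau>. G (t - \<tau>) * F \<tau>)"
    by (rule lborel_pair.integrable_snd[OF int])
  have "(LBINT t. LBINT \<tau>. G (t - \<tau>) * F \<tau>) = (LBINT \<tau>. LBINT t. G (t - \<tau>) * F \<tau>)"
    by (rule lborel_pair.Fubini_integral[OF int])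
  also have "\<dots> = (LBINT t. G t) * (LBINT t. F t)"
    by (simp add: eG)
  finally show "(LBINT t. LBINT \<tau>. G (t - \<tau>) * F \<tau>) = (LBINT t. G t) * (LBINT t. F t)" .
qed

lemma fourier_convolution:
  assumes f: "integrable lborel f" and g: "integrable lborel g"
  shows "fourier (\<lambda>t. LBINT \<tau>. g (t - \<tau>) * f \<tau>) w = fourier g w * fourier f w"
proof -
  let ?F = "\<lambda>t. complex_of_real (f t) * cis (- w * t)" and ?G = "\<lambda>t. complex_of_real (g t) * cis (- w * t)"
  have i: "integrable lborel ?F" "integrable lborel ?G" by (intro integrable_mult_cis f g)+
  have "fourier (\<lambda>t. LBINT \<tau>. g (t - \<tau>) * f \<tau>) w = (LBINT t. LBINT \<tau>. ?G (t - \<tau>) * ?F \<tau>)"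
    unfolding fourier_def
  proof (rule Bochner_Integration.integral_cong)
    fix t
    have "(LBINT \<tau>. ?G (t - \<tau>) * ?F \<tau>) = (LBINT \<tau>. complex_of_real (g (t - \<tau>) * f \<tau>) * cis (- (w * t)))"
    proof (rule Bochner_Integration.integral_cong)
      fix \<tau>
      have "cis (- w * (t - \<tau>)) * cis (- w * \<tau>) = cis (- (w * t))"
        by (simp add: cis_mult algebra_simps)
      then show "?G (t - \<tau>) * ?F \<tau> = complex_of_real (g (t - \<tau>) * f \<tau>) * cis (- (w * t))"
        by (simp add: mult.assoc mult.left_commute)
    qed simp
    also have "\<dots> = complex_of_real (LBINT \<tau>. g (t - \<tau>) * f \<tau>) * cis (- (w * t))"
      by (simp flip: integral_complex_of_real)
    finally show "complex_of_real (LBINT \<tau>. g (t - \<tau>) * f \<tau>) * cis (- (w * t)) = (LBINT \<tau>. ?G (t - \<tau>) * ?F \<tau>)" ..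
  qed simp
  also have "\<dots> = fourier g w * fourier f w"
    unfolding integral_convolution[OF i] by (simp add: fourier_def)
  finally show ?thesis .
qed

text \<open>Extension by 0 makes the Laplace transform at \<sigma> + i w a Fourier transform on the
  whole line, and makes convolution on the line reduce to the Volterra integral from 0 to t.\<close>

definition damped :: "(real \<Rightarrow> real) \<Rightarrow> real \<Rightarrow> real \<Rightarrow> real" where
  "damped h \<sigma> t = (if t > 0 then exp (- \<sigma> * t) * h t else 0)"

lemma laplace_eq_fourier: "laplace b (Complex \<sigma> w) = fourier (damped b \<sigma>) w"
  unfolding laplace_def set_lebesgue_integral_def fourier_def
proof (rule Bochner_Integration.integral_cong)
  fix t
  have "exp (- Complex \<sigma> w * complex_of_real t) = complex_of_real (exp (- \<sigma> * t)) * cis (- (w * t))"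
    by (simp add: exp_eq_polar)
  then show "indicat_real {0<..} t *\<^sub>R (exp (- Complex \<sigma> w * complex_of_real t) * complex_of_real (b t)) =
      complex_of_real (damped b \<sigma> t) * cis (- (w * t))"
    by (simp add: damped_def)
qed simp

lemma integrable_exp_halfline:
  fixes \<sigma> :: real
  assumes "\<sigma> > 0"
  shows "integrable lborel (\<lambda>t. indicator {0..} t *\<^sub>R exp (- (t * \<sigma>)))"
proof -
  have "(\<lambda>t. exp (- (t * \<sigma>))) absolutely_integrable_on {0..}"
    using integrable_on_exp_minus_to_infinity[OF assms, of 0]
    by (intro nonnegative_absolutely_integrable_1) (auto simp: mult.commute)
  then show ?thesis
    unfolding set_integrable_def by (subst (asm) integrable_completion) auto
qed

locale kernel =
  fixes b :: "real \<Rightarrow> real"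
  assumes b: "assumption1 b"
begin

lemma b_nonneg: "t > 0 \<Longrightarrow> 0 \<le> b t"
  and b_antimono: "0 < x \<Longrightarrow> x \<le> y \<Longrightarrow> b y \<le> b x"
  and b_diff: "t > 0 \<Longrightarrow> b differentiable (at t)"
  and b_loc: "T > 0 \<Longrightarrow> set_integrable lborel {0<..T} b"
  and db_mono: "0 < x \<Longrightarrow> x \<le> y \<Longrightarrow> deriv b x \<le> deriv b y"
  using b unfolding assumption1_def by auto

lemma b_cont: "t > 0 \<Longrightarrow> isCont b t"
  using b_diff differentiable_imp_continuous_within by blast

lemma b_measurable: "(\<lambda>t::real. indicator {0<..} t * b t) \<in> borel_measurable borel"
  using borel_measurable_continuous_on_indicator[of "{0<..}" b] b_cont
  by (auto intro!: continuous_at_imp_continuous_on)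

lemma damped_measurable [measurable]: "damped b \<sigma> \<in> borel_measurable borel"
proof -
  note [measurable] = b_measurable
  have "damped b \<sigma> = (\<lambda>t. exp (- \<sigma> * t) * (indicator {0<..} t * b t))"
    by (auto simp: damped_def fun_eq_iff)
  then show ?thesis by simp
qed

lemma damped_nonneg: "0 \<le> damped b \<sigma> t"
  by (simp add: damped_def b_nonneg)

lemma integrable_damped:
  assumes "\<sigma> > 0"
  shows "integrable lborel (damped b \<sigma>)"
proof (rule Bochner_Integration.integrable_bound)
  note e = integrable_exp_halfline[OF assms]
  \<comment> \<open>A possible singularity at 0 is handled by local integrability; beyond 1
    monotonicity bounds \<open>b\<close> by \<open>b 1\<close>.\<close>
  let ?B = "\<lambda>t. indicator {0<..1} t *\<^sub>R b t + b 1 * (indicator {0..} t *\<^sub>R exp (- (t * \<sigma>)))"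
  show "integrable lborel (\<lambda>t. ?B t)"
    using b_loc[of 1] e by (intro Bochner_Integration.integrable_add integrable_mult_right) (auto simp: set_integrable_def)
  show "AE t in lborel. norm (damped b \<sigma> t) \<le> norm (?B t)"
  proof (rule AE_I2)
    fix t :: real
    consider "t \<le> 0" | "0 < t" "t \<le> 1" | "t > 1" by linarith
    then show "norm (damped b \<sigma> t) \<le> norm (?B t)"
    proof cases
      case 2
      have "exp (- \<sigma> * t) * b t \<le> 1 * b t" using 2 assms b_nonneg by (intro mult_right_mono) auto
      then show ?thesis using 2 b_nonneg[of t] b_nonneg[of 1] by (simp add: damped_def abs_mult add_increasing2)
    next
      case 3
      have "exp (- \<sigma> * t) * b t \<le> exp (- \<sigma> * t) * b 1" using 3 b_antimono[of 1 t] by (intro mult_left_mono) auto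
      then show ?thesis using 3 b_nonneg[of t] b_nonneg[of 1] by (simp add: damped_def abs_mult mult.commute)
    qed (simp add: damped_def)
  qed
qed simp

definition theta :: real where "theta = (SUP z\<in>{z. 0 < Re z}. \<bar>Arg (laplace b z)\<bar>)"

lemma rho_theta: "rho_index b = 1 + 2 / pi * theta"
  by (simp add: rho_index_def theta_def)

lemma theta_bounds: "0 < theta" "theta < pi / 2"
  using b pi_gt_zero unfolding assumption1_def rho_theta by (auto simp: zero_less_mult_iff field_simps)

lemma Arg_laplace: "Re z > 0 \<Longrightarrow> \<bar>Arg (laplace b z)\<bar> \<le> theta"
  unfolding theta_def
  by (rule cSUP_upper) (auto intro!: bdd_aboveI[of _ pi] simp: abs_le_iff Arg_le_pi less_imp_le[OF mpi_less_Arg] minus_le_iff)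

lemma laplace_sector:
  assumes "Re z > 0"
  shows "Re (laplace b z) \<ge> cos theta * norm (laplace b z)" "\<bar>Im (laplace b z)\<bar> \<le> sin theta * norm (laplace b z)"
proof -
  let ?L = "laplace b z"
  have e: "?L = of_real (norm ?L) * exp (\<i> * of_real (Arg ?L))"
    by (metis Arg_eq mult_zero_left norm_zero of_real_0)
  have re: "Re ?L = norm ?L * cos (Arg ?L)" and im: "Im ?L = norm ?L * sin (Arg ?L)"
    by (subst e, simp add: Re_exp Im_exp)+
  have c: "cos (Arg ?L) = cos \<bar>Arg ?L\<bar>" and s: "\<bar>sin (Arg ?L)\<bar> = sin \<bar>Arg ?L\<bar>"
    using Arg_le_pi[of ?L] mpi_less_Arg[of ?L] sin_ge_zero[of "Arg ?L"] sin_ge_zero[of "- Arg ?L"]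
    by (cases "Arg ?L \<ge> 0"; simp)+
  have "cos theta \<le> cos (Arg ?L)"
    unfolding c using Arg_laplace[OF assms] theta_bounds by (intro cos_monotone_0_pi_le) auto
  then show "Re ?L \<ge> cos theta * norm ?L" 
    using mult_right_mono[of "cos theta" "cos (Arg ?L)" "norm ?L"] re by (simp add: mult.commute)
  have "sin \<bar>Arg ?L\<bar> \<le> sin theta"
    using Arg_laplace[OF assms] theta_bounds by (intro sin_monotone_2pi_le) auto
  then show "\<bar>Im ?L\<bar> \<le> sin theta * norm ?L" 
    using mult_right_mono[of "sin \<bar>Arg ?L\<bar>" "sin theta" "norm ?L"] im by (simp add: s abs_mult mult.commute)
qed

end

section \<open>The scalar resolvent\<close>

locale resolvent = kernel +
  fixes s :: "real \<Rightarrow> real" and lam :: real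
  assumes lam_pos: "lam > 0" and s_0: "s 0 = 1"
    and s_deriv: "\<And>t. t \<ge> 0 \<Longrightarrow>
      (s has_real_derivative (- lam * (LBINT \<tau>=0..t. b (t - \<tau>) * s \<tau>))) (at t within {0..})"
begin

definition bs :: "real \<Rightarrow> real" where
  "bs t = (LBINT \<tau>=0..t. b (t - \<tau>) * s \<tau>)"

lemma s_cont: "continuous_on {0..} s"
  unfolding continuous_on_eq_continuous_within using DERIV_continuous[OF s_deriv] by simp

lemma s_cont_pos: "continuous_on {0<..} s"
  by (rule continuous_on_subset[OF s_cont]) auto

lemma s_isCont: "t > 0 \<Longrightarrow> isCont s t"
  using s_cont_pos by (simp add: continuous_on_eq_continuous_at)

lemma damped_s_measurable [measurable]: "damped s \<sigma> \<in> borel_measurable borel"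
proof -
  have [measurable]: "(\<lambda>t::real. indicator {0<..} t * s t) \<in> borel_measurable borel"
    using borel_measurable_continuous_on_indicator[of "{0<..}" s]
      s_cont_pos by simp
  have "damped s \<sigma> = (\<lambda>t. exp (- \<sigma> * t) * (indicator {0<..} t * s t))"
    by (auto simp: damped_def fun_eq_iff)
  then show ?thesis by simp
qed

text \<open>The weights multiply to exp(-\<sigma> t), and \<open>damped b\<close> vanishes at
  nonpositive arguments. Only values of \<open>f\<close> below t enter, so both the damped resolvent
  and its truncation at a later time are covered.\<close>

lemma convolution_damped:
  assumes t: "t > 0" and f: "\<And>\<tau>. \<tau> < t \<Longrightarrow> f \<tau> = damped s \<sigma> \<tau>"
  shows "(LBINT \<tau>. damped b \<sigma> (t - \<tau>) * f \<tau>) = exp (- \<sigma> * t) * bs t"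
proof -
  have "(LBINT \<tau>. damped b \<sigma> (t - \<tau>) * f \<tau>) = (LBINT \<tau>. exp (- \<sigma> * t) * (indicator {0<..<t} \<tau> *\<^sub>R (b (t - \<tau>) * s \<tau>)))"
  proof (rule Bochner_Integration.integral_cong)
    fix \<tau>
    show "damped b \<sigma> (t - \<tau>) * f \<tau> = exp (- \<sigma> * t) * (indicator {0<..<t} \<tau> *\<^sub>R (b (t - \<tau>) * s \<tau>))"
    proof (cases "\<tau> < t")
      case True
      have "exp (- \<sigma> * (t - \<tau>)) * exp (- \<sigma> * \<tau>) = exp (- \<sigma> * t)"
        by (simp add: algebra_simps flip: exp_add)
      then show ?thesis using True
        by (auto simp: f damped_def indicator_def mult_ac)
    qed (auto simp: damped_def)
  qed simp
  also have "\<dots> = exp (- \<sigma> * t) * bs t"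
    using t unfolding bs_def interval_lebesgue_integral_def set_lebesgue_integral_def
    by (simp add: zero_ereal_def)
  finally show ?thesis .
qed

lemma s_bounded_upto: obtains K where "K > 0" "\<And>t. 0 \<le> t \<Longrightarrow> t \<le> T \<Longrightarrow> \<bar>s t\<bar> \<le> K"
proof -
  have "compact (s ` {0..T})"
    by (intro compact_continuous_image continuous_on_subset[OF s_cont]) auto
  then have "bounded (s ` {0..T})" by (rule compact_imp_bounded)
  then obtain K where "K > 0" "\<forall>x\<in>s ` {0..T}. norm x \<le> K" using bounded_pos by metis
  then show thesis using that by auto
qed

text \<open>Integrating the derivative of exp(-2 \<sigma> t) s(t)^2 over [0, T] leaves two
  nonpositive contributions: the damping term, and -2 \<lambda> times the pairing of the damped s
  with its convolution with the damped b. That pairing is nonnegative because the Laplace transform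
  of \<open>b\<close> has nonnegative real part.\<close>

lemma weighted_energy:
  assumes T: "T > 0" and \<sigma>: "\<sigma> > 0"
  shows "exp (- 2 * \<sigma> * T) * (s T)\<^sup>2 \<le> 1"
proof -
  obtain K where K: "K > 0" "\<And>t. 0 \<le> t \<Longrightarrow> t \<le> T \<Longrightarrow> \<bar>s t\<bar> \<le> K" using s_bounded_upto by metis
  \<comment> \<open>The growth of \<open>s\<close> is still unknown here, so integrability comes
    from cutting off at \<open>T\<close>. By causality the convolution is unchanged up to
    \<open>T\<close>.\<close>
  define f where "f t = (if t \<le> T then damped s \<sigma> t else 0)" for t
  have fm[measurable]: "f \<in> borel_measurable borel" unfolding f_def by measurable
  have fK: "\<bar>f t\<bar> \<le> K * indicator {0..T} t" for t
  proof (cases "0 < t \<and> t \<le> T")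
    case True
    then have "exp (- \<sigma> * t) * \<bar>s t\<bar> \<le> 1 * K" using \<sigma> by (intro mult_mono K) auto
    then show ?thesis using True by (simp add: f_def damped_def abs_mult)
  qed (use K(1) in \<open>auto simp: f_def damped_def\<close>)
  have fK': "\<bar>f t\<bar> \<le> K" for t using fK[of t] K(1) by (cases "t \<in> {0..T}") auto
  have i0: "integrable lborel (indicat_real {0..T})" by (rule integrable_real_indicator) (auto simp: emeasure_lborel_Icc_eq)
  have fi: "integrable lborel f"
    by (rule Bochner_Integration.integrable_bound[where f = "\<lambda>t. K * indicator {0..T} t"])
      (use fK K(1) i0 in \<open>auto simp: abs_mult\<close>)
  have fc: "isCont f t" if ht: "t \<notin> {0, T}" for t
  proof -
    consider "t < 0" | "0 < t" "t < T" | "T < t" using ht by fastforce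
    then show ?thesis
    proof cases
      case 1
      then have "eventually (\<lambda>x. x \<in> {..<0}) (nhds t)" by (intro eventually_nhds_in_open) auto
      then have "eventually (\<lambda>x. f x = 0) (nhds t)" by eventually_elim (auto simp: f_def damped_def)
      then show ?thesis by (simp add: isCont_cong)
    next
      case 2
      then have "eventually (\<lambda>x. x \<in> {0<..<T}) (nhds t)" by (intro eventually_nhds_in_open) auto
      then have "eventually (\<lambda>x. f x = exp (- \<sigma> * x) * s x) (nhds t)"
        by eventually_elim (auto simp: f_def damped_def)
      moreover have "isCont (\<lambda>x. exp (- \<sigma> * x) * s x) t" using s_isCont[OF 2(1)] by (intro continuous_intros) auto
      ultimately show ?thesis by (simp add: isCont_cong)
    next
      case 3
      then have "eventually (\<lambda>x. x \<in> {T<..}) (nhds t)" by (intro eventually_nhds_in_open) auto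
      then have "eventually (\<lambda>x. f x = 0) (nhds t)" by eventually_elim (auto simp: f_def damped_def)
      then show ?thesis by (simp add: isCont_cong)
    qed
  qed
  define g where "g t = (LBINT \<tau>. damped b \<sigma> (t - \<tau>) * f \<tau>)" for t
  have gi: "integrable lborel g"
    unfolding g_def by (rule integrable_convolution[OF fi integrable_damped[OF \<sigma>]])
  have k0: "(LBINT t. g t * f t) \<ge> 0"
  proof (rule fourier_positivity[OF gi fi fK', of "{0, T}"])
    fix w :: real
    have "fourier g w * cnj (fourier f w) = laplace b (Complex \<sigma> w) * of_real ((norm (fourier f w))\<^sup>2)"
      unfolding g_def fourier_convolution[OF fi integrable_damped[OF \<sigma>]] laplace_eq_fourier complex_norm_square
      by (simp add: mult_ac)
    then have "Re (fourier g w * cnj (fourier f w)) = Re (laplace b (Complex \<sigma> w)) * (norm (fourier f w))\<^sup>2"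
      by simp
    moreover have "Re (laplace b (Complex \<sigma> w)) \<ge> 0"
    proof -
      have "0 \<le> cos theta * norm (laplace b (Complex \<sigma> w))"
        using theta_bounds by (intro mult_nonneg_nonneg cos_ge_zero) auto
      also have "\<dots> \<le> Re (laplace b (Complex \<sigma> w))" using \<sigma> by (intro laplace_sector) auto
      finally show ?thesis .
    qed
    ultimately show "Re (fourier g w * cnj (fourier f w)) \<ge> 0" by simp
  qed (use fc in auto)
  define k where "k t = g t * f t" for t
  have ki: "integrable lborel k"
    unfolding k_def
    by (rule Bochner_Integration.integrable_bound[where f = "\<lambda>t. g t * K"])
      (use gi in \<open>auto simp: abs_mult intro!: mult_left_mono order_trans[OF fK' abs_ge_self]\<close>)
  have ke: "k t = exp (- 2 * \<sigma> * t) * s t * bs t" if "0 < t" "t \<le> T" for t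
  proof -
    have "g t = exp (- \<sigma> * t) * bs t" unfolding g_def
      by (rule convolution_damped) (use that in \<open>auto simp: f_def\<close>)
    moreover have "exp (- \<sigma> * t) * exp (- \<sigma> * t) = exp (- 2 * \<sigma> * t)" by (simp flip: exp_add)
    ultimately show ?thesis using that by (simp add: k_def f_def damped_def mult_ac)
  qed
  have kz: "k t = 0" if "t \<notin> {0..T}" for t using that by (auto simp: k_def f_def damped_def)
  define w where "w t = exp (- 2 * \<sigma> * t) * (s t)\<^sup>2" for t
  let ?w' = "\<lambda>t. - 2 * \<sigma> * w t - 2 * lam * (exp (- 2 * \<sigma> * t) * s t * bs t)"
  have wc: "continuous_on {0..T} w"
    unfolding w_def by (intro continuous_intros continuous_on_subset[OF s_cont]) auto
  have w': "(w has_vector_derivative (?w' t)) (at t within {0..T})"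
    if "t \<in> {0..T}" for t
  proof -
    have d: "(s has_real_derivative (- lam * bs t)) (at t within {0..T})"
      using DERIV_subset[OF s_deriv[of t]] that by (auto simp: bs_def)
    have "(w has_real_derivative (?w' t)) (at t within {0..T})"
      unfolding w_def
      by (auto intro!: derivative_eq_intros d simp: algebra_simps power2_eq_square)
    then show ?thesis by (simp add: has_real_derivative_iff_has_vector_derivative)
  qed
  have I1: "((\<lambda>t. ?w' t) has_integral (w T - w 0)) {0..T}"
    by (rule fundamental_theorem_of_calculus[OF _ w']) (use T in auto)
  have "(k has_integral (LBINT t. k t)) UNIV" using ki by (rule has_integral_integral_lborel)
  then have "(k has_integral (LBINT t. k t)) {0..T}"
    using kz has_integral_on_superset[of k _ "{0..T}" UNIV] by (subst has_integral_restrict_UNIV[symmetric]) (auto intro: has_integral_eq[rotated])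
  moreover have "(w has_integral (integral {0..T} w)) {0..T}"
    by (rule integrable_integral[OF integrable_continuous_real[OF wc]])
  ultimately have "((\<lambda>t. (- 2 * \<sigma>) * w t - (2 * lam) * k t) has_integral ((- 2 * \<sigma>) * integral {0..T} w - (2 * lam) * (LBINT t. k t))) {0..T}"
    by (intro has_integral_diff has_integral_mult_right)
  then have "((\<lambda>t. ?w' t) has_integral ((- 2 * \<sigma>) * integral {0..T} w - (2 * lam) * (LBINT t. k t))) {0..T}"
    by (rule has_integral_spike_finite[where S = "{0}", rotated 2]) (auto simp: ke)
  then have "w T - w 0 = (- 2 * \<sigma>) * integral {0..T} w - (2 * lam) * (LBINT t. k t)"
    using I1 has_integral_unique by blast
  moreover have "integral {0..T} w \<ge> 0"
    by (rule integral_nonneg[OF integrable_continuous_real[OF wc]]) (simp add: w_def)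
  then have "\<sigma> * integral {0..T} w \<ge> 0" using \<sigma> by simp
  moreover have "lam * (LBINT t. k t) \<ge> 0" using k0 lam_pos by (simp add: k_def)
  ultimately have "w T \<le> w 0" by linarith
  then show ?thesis by (simp add: w_def s_0)
qed

text \<open>Let \<sigma> \<longrightarrow> 0 from the right in \<open>weighted_energy\<close>, since
  the sector condition is available for \<sigma> > 0 only.\<close>

lemma resolvent_bound:
  assumes "T \<ge> 0"
  shows "\<bar>s T\<bar> \<le> 1"
proof (cases "T = 0")
  case False
  have "(s T)\<^sup>2 \<le> 1"
  proof (rule tendsto_upperbound)
    show "((\<lambda>\<sigma>. exp (- 2 * \<sigma> * T) * (s T)\<^sup>2) \<longlongrightarrow> (s T)\<^sup>2) (at_right 0)"
      by (auto intro!: tendsto_eq_intros)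
    show "eventually (\<lambda>\<sigma>. exp (- 2 * \<sigma> * T) * (s T)\<^sup>2 \<le> 1) (at_right 0)"
      using weighted_energy[of T] assms False by (auto simp: eventually_at_filter intro!: always_eventually)
  qed simp
  then show ?thesis by (simp add: abs_square_le_1)
qed (simp add: s_0)

lemma integrable_damped_s:
  assumes \<sigma>: "\<sigma> > 0"
  shows "integrable lborel (damped s \<sigma>)"
proof (rule Bochner_Integration.integrable_bound[OF integrable_exp_halfline[OF \<sigma>]])
  show "AE t in lborel. norm (damped s \<sigma> t) \<le> norm (indicat_real {0..} t *\<^sub>R exp (- (t * \<sigma>)))"
    using resolvent_bound by (auto simp: damped_def abs_mult mult.commute mult_le_cancel_left2)
qed simp

text \<open>The transformed Volterra equation z F - 1 = -\<lambda> B F. It is obtained by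
  integrating the derivative of exp(-z t) s(t) up to n; the boundary term at n vanishes in the limit
  because |s| \<le> 1.\<close>

lemma laplace_resolvent:
  assumes \<sigma>: "\<sigma> > 0"
  shows "fourier (damped s \<sigma>) w * (Complex \<sigma> w + of_real lam * laplace b (Complex \<sigma> w)) = 1"
proof -
  define z where "z = Complex \<sigma> w"
  define f where "f = damped s \<sigma>"
  have fi: "integrable lborel f" unfolding f_def by (rule integrable_damped_s[OF \<sigma>])
  define H where "H t = (LBINT \<tau>. damped b \<sigma> (t - \<tau>) * f \<tau>)" for t
  have Hi: "integrable lborel H"
    unfolding H_def by (rule integrable_convolution[OF fi integrable_damped[OF \<sigma>]])
  \<comment> \<open>For t > 0 this is minus the derivative of exp(-z t) s(t), written through
    integrable functions on the whole line.\<close>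
  define q where "q t = z * (complex_of_real (f t) * cis (- (w * t))) + of_real lam * (complex_of_real (H t) * cis (- (w * t)))" for t
  have i1: "integrable lborel (\<lambda>t. complex_of_real (f t) * cis (- (w * t)))"
    using integrable_mult_cis[OF fi, of "-w"] by simp
  have i2: "integrable lborel (\<lambda>t. complex_of_real (H t) * cis (- (w * t)))"
    using integrable_mult_cis[OF Hi, of "-w"] by simp
  have qi: "integrable lborel q"
    unfolding q_def by (intro Bochner_Integration.integrable_add integrable_mult_right i1 i2)
  have [measurable]: "q \<in> borel_measurable borel" using qi by auto
  have qq: "(LBINT t. q t) = z * fourier f w + of_real lam * fourier H w"
    unfolding q_def fourier_def using i1 i2 by simp
  have f0: "f t = 0" "H t = 0" if "t \<le> 0" for t
  proof -
    show "f t = 0" using that by (simp add: f_def damped_def)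
    have "damped b \<sigma> (t - \<tau>) * f \<tau> = 0" for \<tau> using that by (auto simp: f_def damped_def)
    then show "H t = 0" unfolding H_def by (simp only: integral_zero)
  qed
  have q0: "q t = 0" if "t \<le> 0" for t using f0[OF that] by (simp add: q_def)
  define p where "p t = exp (- (z * of_real t)) * complex_of_real (s t)" for t
  let ?p' = "\<lambda>t. - z * p t - of_real lam * (exp (- (z * of_real t)) * of_real (bs t))"
  let ?Q = "\<lambda>T. LBINT t. indicator {..T} t *\<^sub>R q t"
  have ex: "exp (- (z * of_real t)) = of_real (exp (- \<sigma> * t)) * cis (- (w * t))" for t
    by (simp add: exp_eq_polar z_def)
  have Hbs: "H t = exp (- \<sigma> * t) * bs t" if "t > 0" for t
    unfolding H_def by (rule convolution_damped[OF that]) (simp add: f_def)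
  have qe: "q t = - (?p' t)" if "t > 0" for t
    using that by (simp add: q_def p_def Hbs ex f_def damped_def mult_ac)
  have main: "(?Q T) = 1 - p T" if T: "T \<ge> 0" for T
  proof -
    have p': "(p has_vector_derivative (?p' t)) (at t within {0..T})"
      if "t \<in> {0..T}" for t
    proof -
      have d: "(s has_real_derivative (- lam * bs t)) (at t within {0..T})"
        using DERIV_subset[OF s_deriv[of t]] that by (auto simp: bs_def)
      have d2: "((\<lambda>t. complex_of_real (s t)) has_vector_derivative (of_real (- lam * bs t))) (at t within {0..T})"
        by (rule has_vector_derivative_of_real[OF d])
      have "((\<lambda>z'. exp (- (z * z'))) has_field_derivative (- z * exp (- (z * of_real t)))) (at (of_real t))"
        by (auto intro!: derivative_eq_intros)
      then have d3: "((\<lambda>t. exp (- (z * of_real t))) has_vector_derivative (- z * exp (- (z * of_real t)))) (at t within {0..T})"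
        by (rule has_vector_derivative_real_field)
      show ?thesis
        unfolding p_def using has_vector_derivative_mult[OF d3 d2]
        by (simp add: algebra_simps)
    qed
    have I1: "((\<lambda>t. ?p' t) has_integral (p T - p 0)) {0..T}"
      by (rule fundamental_theorem_of_calculus[OF T p'])
    have "integrable lborel (\<lambda>t. indicator {..T} t *\<^sub>R q t)"
      by (rule integrable_mult_indicator[OF _ qi]) simp
    then have "((\<lambda>t. indicator {..T} t *\<^sub>R q t) has_integral (?Q T)) UNIV"
      by (rule has_integral_integral_lborel)
    then have "((\<lambda>t. if t \<in> {0..T} then q t else 0) has_integral (?Q T)) UNIV"
      by (rule has_integral_eq[rotated]) (auto simp: indicator_def q0)
    then have "(q has_integral (?Q T)) {0..T}"
      by (simp only: has_integral_restrict_UNIV)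
    then have "((\<lambda>t. - (?p' t)) has_integral (?Q T)) {0..T}"
      by (rule has_integral_spike_finite[where S = "{0}", rotated 2]) (auto simp: qe)
    moreover have "((\<lambda>t. - (?p' t)) has_integral (- (p T - p 0))) {0..T}"
      by (rule has_integral_neg[OF I1])
    ultimately have "(?Q T) = - (p T - p 0)" using has_integral_unique by blast
    then show ?thesis by (simp add: p_def s_0)
  qed
  have l1: "(\<lambda>n. LBINT t. indicator {..real n} t *\<^sub>R q t) \<longlonglongrightarrow> (LBINT t. q t)"
  proof (rule integral_dominated_convergence[where w = "\<lambda>t. norm (q t)"])
    show "AE t in lborel. (\<lambda>n. indicator {..real n} t *\<^sub>R q t) \<longlonglongrightarrow> q t"
    proof (rule AE_I2, rule tendsto_eventually)
      fix t :: real
      obtain N where "t \<le> real N" using real_arch_simple by blast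
      then show "eventually (\<lambda>n. indicator {..real n} t *\<^sub>R q t = q t) sequentially"
        by (intro eventually_sequentiallyI[of N]) (auto simp: indicator_def)
    qed
  qed (use qi in \<open>auto simp: indicator_def\<close>)
  have l2: "(\<lambda>n. 1 - p (real n)) \<longlonglongrightarrow> 1 - 0"
  proof (intro tendsto_diff tendsto_const)
    show "(\<lambda>n. p (real n)) \<longlonglongrightarrow> 0"
    proof (rule Lim_null_comparison)
      have "norm (p (real n)) \<le> exp (- \<sigma>) ^ n" for n
      proof -
        have "norm (p (real n)) = exp (- \<sigma> * real n) * \<bar>s (real n)\<bar>"
          by (simp add: p_def norm_mult) (simp add: z_def)
        also have "\<dots> \<le> exp (- \<sigma> * real n) * 1" by (intro mult_left_mono resolvent_bound) auto
        also have "\<dots> = exp (real n * (- \<sigma>))" by (simp add: mult.commute)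
        also have "\<dots> = exp (- \<sigma>) ^ n" by (rule exp_of_nat_mult)
        finally show ?thesis .
      qed
      then show "eventually (\<lambda>n. norm (p (real n)) \<le> exp (- \<sigma>) ^ n) sequentially" by simp
      show "(\<lambda>n. exp (- \<sigma>) ^ n) \<longlonglongrightarrow> 0" using \<sigma> by (intro LIMSEQ_realpow_zero) auto
    qed
  qed
  have "(LBINT t. q t) = 1"
    using LIMSEQ_unique[OF l1] l2 by (simp add: main)
  moreover have "fourier H w = laplace b z * fourier f w"
    unfolding H_def z_def laplace_eq_fourier by (rule fourier_convolution[OF fi integrable_damped[OF \<sigma>]])
  ultimately show ?thesis unfolding qq by (simp add: f_def z_def algebra_simps)
qed

end

section \<open>Lower bounds for the Laplace transform\<close>

text \<open>On each full period the integrand dominates \<open>m sin\<close>, where \<open>m\<close> is the value of the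
  monotone weight at the middle of the period.\<close>
lemma integral_antimono_sin_nonneg:
  fixes \<gamma> :: "real \<Rightarrow> real"
  assumes w: "w > 0" and i: "integrable lborel (\<lambda>t. indicator {a<..} t * \<gamma> t)"
    and anti: "\<And>x y. a < x \<Longrightarrow> x \<le> y \<Longrightarrow> \<gamma> y \<le> \<gamma> x"
  shows "(LBINT t. indicator {a<..} t * \<gamma> t * sin (w * (t - a))) \<ge> 0"
proof -
  define p where "p = pi / w"
  have p: "p > 0" "w * p = pi" using w by (auto simp: p_def)
  define q where "q t = indicator {a<..} t * \<gamma> t * sin (w * (t - a))" for t
  have [measurable]: "(\<lambda>t. indicator {a<..} t * \<gamma> t) \<in> borel_measurable borel" using i by auto
  have qi: "integrable lborel q"
    unfolding q_def by (rule Bochner_Integration.integrable_bound[OF i]) (auto simp: abs_mult mult_left_le)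
  \<comment> \<open>The starting points of the periods of the sine; passing from \<open>J n\<close>
    to \<open>J (Suc n)\<close> adds exactly one period.\<close>
  define c where "c n = a + 2 * p * real n" for n
  have ca: "c n \<ge> a" for n using p by (simp add: c_def)
  define J where "J n = (LBINT t. indicator {a<..c n} t *\<^sub>R q t)" for n
  have step: "J n \<le> J (Suc n)" for n
  proof -
    have cs: "c (Suc n) = c n + 2 * p" by (simp add: c_def algebra_simps)
    have ii: "integrable lborel (\<lambda>t. indicator {c n<..c (Suc n)} t *\<^sub>R q t)" "integrable lborel (\<lambda>t. indicator {a<..c n} t *\<^sub>R q t)"
      by (intro integrable_mult_indicator qi; simp)+
    have "J (Suc n) = (LBINT t. indicator {a<..c n} t *\<^sub>R q t + indicator {c n<..c (Suc n)} t *\<^sub>R q t)"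
      unfolding J_def by (rule Bochner_Integration.integral_cong) (use ca[of n] cs p in \<open>auto simp: indicator_def\<close>)
    also have "\<dots> = J n + (LBINT t. indicator {c n<..c (Suc n)} t *\<^sub>R q t)"
      unfolding J_def using ii by (simp del: scaleR_conv_of_real real_scaleR_def)
    finally have e: "J (Suc n) = J n + (LBINT t. indicator {c n<..c (Suc n)} t *\<^sub>R q t)" .
    define m where "m = \<gamma> (c n + p)"
    have sw: "sin (w * (t - a)) = sin (w * (t - c n))" for t
    proof -
      have "w * (t - a) = w * (t - c n) + 2 * real n * pi"
        unfolding c_def p(2)[symmetric] by (simp add: algebra_simps)
      then show ?thesis by (simp add: sin_add)
    qed
    have I: "((\<lambda>t. m * sin (w * (t - c n))) has_integral 0) {c n..c (Suc n)}"
    proof -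
      have "((\<lambda>t. m * sin (w * (t - c n))) has_integral (- m * cos (w * (c (Suc n) - c n)) / w - (- m * cos (w * (c n - c n)) / w))) {c n..c (Suc n)}"
      proof (rule fundamental_theorem_of_calculus)
        fix x
        have "((\<lambda>x. - m * cos (w * (x - c n)) / w) has_real_derivative (m * sin (w * (x - c n)))) (at x within {c n..c (Suc n)})"
          using w by (auto intro!: derivative_eq_intros)
        then show "((\<lambda>x. - m * cos (w * (x - c n)) / w) has_vector_derivative (m * sin (w * (x - c n)))) (at x within {c n..c (Suc n)})"
          by (simp add: has_real_derivative_iff_has_vector_derivative)
      qed (use cs p in auto)
      moreover have "w * (c (Suc n) - c n) = 2 * pi" using p(2) by (simp add: cs)
      ultimately show ?thesis by simp
    qed
    have si: "set_integrable lborel {c n..c (Suc n)} (\<lambda>t. m * sin (w * (t - c n)))"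
      by (intro borel_integrable_atLeastAtMost') (auto intro!: continuous_intros)
    have "(LBINT t:{c n..c (Suc n)}. m * sin (w * (t - c n))) = 0"
      using set_borel_integral_eq_integral(2)[OF si] unfolding integral_unique[OF I] .
    moreover have "(LBINT t:{c n..c (Suc n)}. m * sin (w * (t - c n))) \<le> (LBINT t. indicator {c n<..c (Suc n)} t *\<^sub>R q t)"
      unfolding set_lebesgue_integral_def
    proof (rule integral_mono_AE)
      show "AE t in lborel. indicator {c n..c (Suc n)} t *\<^sub>R (m * sin (w * (t - c n))) \<le> indicator {c n<..c (Suc n)} t *\<^sub>R q t"
      proof (rule AE_mp[OF AE_lborel_singleton[of "c n"]], rule AE_I2, rule impI)
        fix t :: real assume "t \<noteq> c n"
        show "indicator {c n..c (Suc n)} t *\<^sub>R (m * sin (w * (t - c n))) \<le> indicator {c n<..c (Suc n)} t *\<^sub>R q t"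
        proof (cases "t \<in> {c n<..c (Suc n)}")
          case True
          then have ta: "t > a" using ca[of n] by auto
          have "m * sin (w * (t - c n)) \<le> \<gamma> t * sin (w * (t - c n))"
          proof (cases "t \<le> c n + p")
            case True
            then have "m \<le> \<gamma> t" unfolding m_def using anti[of t] ta by auto
            moreover have "w * (t - c n) \<le> pi"
              unfolding p(2)[symmetric] using w True by (intro mult_left_mono) auto
            then have "sin (w * (t - c n)) \<ge> 0" using w \<open>t \<in> {c n<..c (Suc n)}\<close> by (intro sin_ge_zero) auto
            ultimately show ?thesis by (rule mult_right_mono)
          next
            case False
            have "c n + p > a" using ca[of n] p(1) by simp
            then have "\<gamma> t \<le> m" unfolding m_def using anti[of "c n + p" t] False by auto
            moreover have "sin (w * (t - c n)) \<le> 0"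
            proof -
              have "w * (t - c n - p) \<le> w * p" using w True cs by (intro mult_left_mono) auto
              then have "w * (t - c n - p) \<le> pi" using p by simp
              moreover have "0 \<le> w * (t - c n - p)" using w False by simp
              ultimately have "sin (w * (t - c n - p)) \<ge> 0" by (intro sin_ge_zero)
              moreover have "w * (t - c n) = w * (t - c n - p) + pi" unfolding p(2)[symmetric] by (simp add: algebra_simps)
              ultimately show ?thesis by simp
            qed
            ultimately show ?thesis by (rule mult_right_mono_neg)
          qed
          then show ?thesis using True ta by (simp add: q_def sw)
        qed (use \<open>t \<noteq> c n\<close> in auto)
      qed
    qed (use si ii in \<open>auto simp: set_integrable_def\<close>)
    ultimately show ?thesis using e by linarith
  qed
  have "J \<longlonglongrightarrow> (LBINT t. q t)"
    unfolding J_def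
  proof (rule integral_dominated_convergence[where w = "\<lambda>t. norm (q t)"])
    show "AE t in lborel. (\<lambda>n. indicator {a<..c n} t *\<^sub>R q t) \<longlonglongrightarrow> q t"
    proof (rule AE_I2, rule tendsto_eventually)
      fix t :: real
      obtain N where N: "(t - a) / (2 * p) \<le> real N" using real_arch_simple by blast
      show "eventually (\<lambda>n. indicator {a<..c n} t *\<^sub>R q t = q t) sequentially"
      proof (rule eventually_sequentiallyI[of N])
        fix n assume "N \<le> n"
        then have "(t - a) / (2 * p) \<le> real n" using N by linarith
        then have "t \<le> c n" using p by (simp add: c_def field_simps)
        then show "indicator {a<..c n} t *\<^sub>R q t = q t" by (auto simp: indicator_def q_def)
      qed
    qed
  qed (use qi in \<open>auto simp: indicator_def\<close>)
  moreover have "J 0 \<le> J n" for n using step by (rule lift_Suc_mono_le) simp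
  moreover have "J 0 = 0" by (simp add: J_def c_def)
  ultimately show ?thesis
    unfolding q_def[symmetric] by (intro LIMSEQ_le_const) auto
qed

section \<open>Lower bound on vertical lines by convexity\<close>

context kernel
begin

definition b_mass :: "real \<Rightarrow> real" where "b_mass h = (LBINT t. indicator {0<..h} t * b t)"

lemma b_integrable_upto: "integrable lborel (\<lambda>t. indicator {0<..h} t * b t)"
proof (cases "h > 0")
  case True
  then show ?thesis using b_loc[of h] by (simp add: set_integrable_def)
next
  case False
  then have "(\<lambda>t. indicator {0<..h} t * b t) = (\<lambda>t. 0)" by (auto simp: fun_eq_iff)
  then show ?thesis by simp
qed

text \<open>The derivative of b(t) - b(t + p) is b'(t) - b'(t + p), which is nonpositive because b'
  increases. This is how convexity enters the estimate on vertical lines.\<close>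

lemma b_diff_antimono:
  assumes "0 < x" "x \<le> y" "p \<ge> 0"
  shows "b y - b (y + p) \<le> b x - b (x + p)"
proof (rule DERIV_nonpos_imp_nonincreasing[OF assms(2)])
  fix t assume t: "x \<le> t" "t \<le> y"
  have d: "(b has_real_derivative deriv b u) (at u)" if "u > 0" for u
    using b_diff[OF that] by (simp add: DERIV_deriv_iff_real_differentiable)
  have d2: "((\<lambda>u. b (u + p)) has_real_derivative deriv b (t + p)) (at t)"
    using d[of "t + p"] t assms by (simp add: DERIV_shift)
  have "((\<lambda>u. b u - b (u + p)) has_real_derivative (deriv b t - deriv b (t + p))) (at t)"
    using t assms d[of t] by (intro DERIV_diff d2) auto
  moreover have "deriv b t - deriv b (t + p) \<le> 0" using db_mono[of t "t + p"] t assms by auto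
  ultimately show "\<exists>y. ((\<lambda>u. b u - b (u + p)) has_real_derivative y) (at t) \<and> y \<le> 0" by blast
qed

lemma damped_antimono:
  assumes "0 < x" "x \<le> y" "\<sigma> \<ge> 0"
  shows "damped b \<sigma> y \<le> damped b \<sigma> x"
  using assms b_nonneg[of y] b_antimono[of x y] by (auto simp: damped_def intro!: mult_mono)

lemma damped_diff_antimono:
  assumes "0 < x" "x \<le> y" "p \<ge> 0" "\<sigma> \<ge> 0"
  shows "damped b \<sigma> y - damped b \<sigma> (y + p) \<le> damped b \<sigma> x - damped b \<sigma> (x + p)"
proof -
  \<comment> \<open>The increment is an exponential times a sum of two nonnegative terms, and all
    three decrease in t.\<close>
  have e: "damped b \<sigma> t - damped b \<sigma> (t + p) = exp (- \<sigma> * t) * ((b t - b (t + p)) + (1 - exp (- \<sigma> * p)) * b (t + p))"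
    if "t > 0" for t using that assms by (simp add: damped_def algebra_simps flip: exp_add)
  have ep: "1 - exp (- \<sigma> * p) \<ge> 0" using assms by simp
  have "exp (- \<sigma> * y) * ((b y - b (y + p)) + (1 - exp (- \<sigma> * p)) * b (y + p))
     \<le> exp (- \<sigma> * x) * ((b x - b (x + p)) + (1 - exp (- \<sigma> * p)) * b (x + p))"
    using assms ep b_nonneg[of "y + p"] b_antimono[of y "y + p"]
    by (intro mult_mono add_mono b_diff_antimono b_antimono add_nonneg_nonneg mult_nonneg_nonneg) (auto intro: mult_left_mono)
  then show ?thesis using e assms by simp
qed

lemma integrable_damped_mult:
  assumes "\<sigma> > 0" "k \<in> borel_measurable borel" "\<And>t. \<bar>k t\<bar> \<le> 1"
  shows "integrable lborel (\<lambda>t. damped b \<sigma> t * k t)"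
  by (rule Bochner_Integration.integrable_bound[OF integrable_damped[OF assms(1)]])
    (use assms in \<open>auto simp: abs_mult mult_left_le\<close>)

text \<open>With half period \<open>p\<close>, sine transform \<open>G\<close> and cosine transform \<open>R\<close>: shifting by \<open>p\<close> and convexity give
  \<open>2 G \<ge> P\<close>, where \<open>P\<close> is the part of \<open>G\<close> over the first half period, and the negative part of \<open>R\<close> is at
  most \<open>2 P\<close>, so that \<open>R + 4 G\<close> dominates the part of \<open>R\<close> over the first quarter period.\<close>
lemma damped_fourier_lower:
  assumes \<sigma>: "\<sigma> > 0" and w: "w > 0"
  shows "(LBINT t. indicator {0<..1/w} t * damped b \<sigma> t) \<le> 10 * norm (fourier (damped b \<sigma>) w)"
proof -
  let ?\<beta> = "damped b \<sigma>"
  note \<beta>i = integrable_damped[OF \<sigma>]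
  define p where "p = pi / w"
  let ?c = "\<lambda>t. indicator {p/2<..3*p/2} t * (?\<beta> t * cos (w * t))"
  have p: "p > 0" "w * p = pi" using w by (auto simp: p_def)
  have [measurable]: "?\<beta> \<in> borel_measurable borel" by (rule damped_measurable)
  have ii: "integrable lborel (\<lambda>t. indicator A t * (?\<beta> t * k t))" if "A \<in> sets borel" "k \<in> borel_measurable borel" "\<And>t. \<bar>k t\<bar> \<le> 1" for A k
    using integrable_mult_indicator[OF _ integrable_damped_mult[OF \<sigma> that(2,3)], of A] that(1) by simp
  have iA: "integrable lborel (\<lambda>t. indicator A t * ?\<beta> t)" if "A \<in> sets borel" for A
    using ii[OF that, of "\<lambda>_. 1"] by simp
  have splitI: "(LBINT t. indicator {a<..} t * (?\<beta> t * k t)) = (LBINT t. indicator {a<..c} t * (?\<beta> t * k t)) + (LBINT t. indicator {c<..} t * (?\<beta> t * k t))"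
    if "a \<le> c" "k \<in> borel_measurable borel" "\<And>t. \<bar>k t\<bar> \<le> 1" for a c k
  proof -
    have "(LBINT t. indicator {a<..} t * (?\<beta> t * k t)) = (LBINT t. indicator {a<..c} t * (?\<beta> t * k t) + indicator {c<..} t * (?\<beta> t * k t))"
      by (rule Bochner_Integration.integral_cong) (use that in \<open>auto simp: indicator_def\<close>)
    then show ?thesis using ii[of "{a<..c}" k] ii[of "{c<..}" k] that by simp
  qed
  define G where "G = (LBINT t. indicator {0<..} t * (?\<beta> t * sin (w * t)))"
  define P where "P = (LBINT t. indicator {0<..p} t * (?\<beta> t * sin (w * t)))"
  define R where "R = (LBINT t. indicator {0<..} t * (?\<beta> t * cos (w * t)))"
  define C where "C = (LBINT t. indicator {0<..p/2} t * (?\<beta> t * cos (w * t)))"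
  have Re: "Re (fourier ?\<beta> w) = R" and Im: "Im (fourier ?\<beta> w) = - G"
  proof -
    have i: "integrable lborel (\<lambda>t. complex_of_real (?\<beta> t) * cis (- (w * t)))"
      using integrable_mult_cis[OF \<beta>i, of "-w"] by simp
    show "Re (fourier ?\<beta> w) = R" unfolding fourier_def R_def integral_Re[OF i, symmetric]
      by (rule Bochner_Integration.integral_cong) (auto simp: damped_def)
    have "Im (fourier ?\<beta> w) = (LBINT t. - (indicator {0<..} t * (?\<beta> t * sin (w * t))))"
      unfolding fourier_def integral_Im[OF i, symmetric]
      by (rule Bochner_Integration.integral_cong) (auto simp: damped_def)
    then show "Im (fourier ?\<beta> w) = - G" by (simp add: G_def)
  qed
  have sp: "G = P + (LBINT t. indicator {p<..} t * (?\<beta> t * sin (w * t)))"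
    unfolding G_def P_def using p(1) by (intro splitI) auto
  have tail: "(LBINT t. indicator {p<..} t * (?\<beta> t * sin (w * t))) = - (LBINT t. indicator {0<..} t * (?\<beta> (t + p) * sin (w * t)))"
  proof -
    have "(LBINT t. indicator {p<..} t * (?\<beta> t * sin (w * t))) = (LBINT t. indicator {p<..} (p + 1 * t) * (?\<beta> (p + 1 * t) * sin (w * (p + 1 * t))))"
      by (subst lborel_integral_real_affine[where c = 1 and t = p]) auto
    also have "\<dots> = (LBINT t. - (indicator {0<..} t * (?\<beta> (t + p) * sin (w * t))))"
      by (rule Bochner_Integration.integral_cong) (auto simp: indicator_def distrib_left p(2) add.commute)
    finally show ?thesis by simp
  qed
  have shift: "integrable lborel (\<lambda>t. ?\<beta> (t + p))"
    using lborel_integrable_real_affine[OF \<beta>i, of 1 p] by (simp add: add.commute)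
  have i1: "integrable lborel (\<lambda>t. indicator {0<..} t * ?\<beta> t)" by (rule iA) auto
  have i2: "integrable lborel (\<lambda>t. indicator {0<..} t * ?\<beta> (t + p))"
    using integrable_mult_indicator[OF _ shift, of "{0<..}"] by simp
  have i3: "integrable lborel (\<lambda>t. indicator {0<..} t * (?\<beta> (t + p) * sin (w * t)))"
    by (rule Bochner_Integration.integrable_bound[OF i2]) (auto simp: abs_mult mult_left_le indicator_def)
  \<comment> \<open>Since sin(w (t + p)) = - sin(w t), this integral is \<open>G\<close> plus the
    part of \<open>G\<close> beyond \<open>p\<close>, that is 2 G - P.\<close>
  have "0 \<le> (LBINT t. indicator {0<..} t * (?\<beta> t - ?\<beta> (t + p)) * sin (w * (t - 0)))"
  proof (rule integral_antimono_sin_nonneg[OF w])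
    show "integrable lborel (\<lambda>t. indicator {0<..} t * (?\<beta> t - ?\<beta> (t + p)))"
      using Bochner_Integration.integrable_diff[OF i1 i2] by (simp add: right_diff_distrib)
    show "?\<beta> y - ?\<beta> (y + p) \<le> ?\<beta> x - ?\<beta> (x + p)" if "0 < x" "x \<le> y" for x y
      using damped_diff_antimono[OF that, of p \<sigma>] p \<sigma> by simp
  qed
  also have "\<dots> = (LBINT t. indicator {0<..} t * (?\<beta> t * sin (w * t)) - indicator {0<..} t * (?\<beta> (t + p) * sin (w * t)))"
    by (rule Bochner_Integration.integral_cong) (auto simp: algebra_simps)
  also have "\<dots> = G - (LBINT t. indicator {0<..} t * (?\<beta> (t + p) * sin (w * t)))"
    unfolding G_def using i3 ii[of "{0<..}" "\<lambda>t. sin (w * t)"] by (intro Bochner_Integration.integral_diff) auto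
  finally have GP: "2 * G \<ge> P" using sp tail by linarith
  have ph: "p / 2 > 0" "p / 2 \<le> p" "w * (p / 2) = pi / 2" using p by auto
  \<comment> \<open>From 3p/2 on, the cosine is a sine started at a zero, so
    \<open>integral_antimono_sin_nonneg\<close> also bounds the tail of \<open>R\<close>.\<close>
  have sq: "sin (w * (t - p / 2)) = - cos (w * t)" "sin (w * (t - 3 * p / 2)) = cos (w * t)" for t
  proof -
    have e: "w * (t - p / 2) = w * t - pi / 2" "w * (t - 3 * p / 2) = w * t - 3 / 2 * pi" using p(2) by (simp_all add: algebra_simps)
    show "sin (w * (t - p / 2)) = - cos (w * t)" unfolding e by (simp add: sin_diff)
    have "cos (3 / 2 * pi) = 0" "sin (3 / 2 * pi) = -1"
      using cos_3over2_pi sin_3over2_pi by (simp_all add: mult.commute)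
    then show "sin (w * (t - 3 * p / 2)) = cos (w * t)" unfolding e by (simp add: sin_diff)
  qed
  have R1: "R = C + (LBINT t. indicator {p/2<..} t * (?\<beta> t * cos (w * t)))"
    unfolding R_def C_def using ph by (intro splitI) auto
  also have "(LBINT t. indicator {p/2<..} t * (?\<beta> t * cos (w * t)))
     = (LBINT t. ?c t) + (LBINT t. indicator {3*p/2<..} t * (?\<beta> t * cos (w * t)))"
    using p by (intro splitI) auto
  finally have R2: "R = C + (LBINT t. ?c t) + (LBINT t. indicator {3*p/2<..} t * (?\<beta> t * cos (w * t)))"
    by simp
  have "0 \<le> (LBINT t. indicator {3*p/2<..} t * ?\<beta> t * sin (w * (t - 3*p/2)))"
    by (rule integral_antimono_sin_nonneg[OF w]) (use iA \<sigma> p in \<open>auto intro!: damped_antimono\<close>)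
  then have R3: "0 \<le> (LBINT t. indicator {3*p/2<..} t * (?\<beta> t * cos (w * t)))" by (simp only: sq mult.assoc)
  have cosI: "((\<lambda>t. cos (w * t)) has_integral (sin (w * y) / w - sin (w * x) / w)) {x..y}" if "x \<le> y" for x y
  proof (rule fundamental_theorem_of_calculus[OF that])
    fix z
    have "((\<lambda>x. sin (w * x) / w) has_real_derivative cos (w * z)) (at z within {x..y})"
      using w by (auto intro!: derivative_eq_intros)
    then show "((\<lambda>x. sin (w * x) / w) has_vector_derivative cos (w * z)) (at z within {x..y})"
      by (simp add: has_real_derivative_iff_has_vector_derivative)
  qed
  have sinI: "((\<lambda>t. sin (w * t)) has_integral (- cos (w * y) / w - (- cos (w * x) / w))) {x..y}" if "x \<le> y" for x y
  proof (rule fundamental_theorem_of_calculus[OF that])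
    fix z
    have "((\<lambda>x. - cos (w * x) / w) has_real_derivative sin (w * z)) (at z within {x..y})"
      using w by (auto intro!: derivative_eq_intros)
    then show "((\<lambda>x. - cos (w * x) / w) has_vector_derivative sin (w * z)) (at z within {x..y})"
      by (simp add: has_real_derivative_iff_has_vector_derivative)
  qed
  \<comment> \<open>The damped kernel is at least \<open>m\<close> before p/2 and at most
    \<open>m\<close> after it. This links the two estimates: the negative lobe of the cosine costs
    at most 2 m / w, while the sine over the first quarter period already gives P \<ge> m /
    w.\<close>
  define m where "m = ?\<beta> (p / 2)"
  have m0: "m \<ge> 0" by (simp add: m_def damped_nonneg)
  have R4: "- (2 * m / w) \<le> (LBINT t. ?c t)"
  proof -
    have si: "set_integrable lborel {p/2..3*p/2} (\<lambda>t. m * cos (w * t))"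
      by (intro borel_integrable_atLeastAtMost') (auto intro!: continuous_intros)
    have "w * (3 * p / 2) = 3 / 2 * pi" using p(2) by simp
    moreover have "sin (3 / 2 * pi) = -1" using sin_3over2_pi by (simp add: mult.commute)
    ultimately have e: "sin (w * (3 * p / 2)) = -1" "sin (w * (p / 2)) = 1" unfolding ph(3) by (simp_all only: sin_pi_half)
    have "p / 2 \<le> 3 * p / 2" using p(1) by simp
    from cosI[OF this] have "((\<lambda>t. cos (w * t)) has_integral (-1 / w - 1 / w)) {p/2..3*p/2}"
      unfolding e .
    then have "((\<lambda>t. m * cos (w * t)) has_integral (m * (-1 / w - 1 / w))) {p/2..3*p/2}" by (rule has_integral_mult_right)
    then have "(LBINT t:{p/2..3*p/2}. m * cos (w * t)) = m * (-1 / w - 1 / w)"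
      using set_borel_integral_eq_integral(2)[OF si] integral_unique by metis
    then have "(LBINT t:{p/2..3*p/2}. m * cos (w * t)) = - (2 * m / w)" by simp
    moreover have "(LBINT t:{p/2..3*p/2}. m * cos (w * t)) \<le> (LBINT t. ?c t)"
      unfolding set_lebesgue_integral_def
    proof (rule integral_mono_AE)
      show "AE t in lborel. indicator {p/2..3*p/2} t *\<^sub>R (m * cos (w * t)) \<le> ?c t"
      proof (rule AE_mp[OF AE_lborel_singleton[of "p/2"]], rule AE_I2, rule impI)
        fix t :: real assume t: "t \<noteq> p / 2"
        show "indicator {p/2..3*p/2} t *\<^sub>R (m * cos (w * t)) \<le> ?c t"
        proof (cases "t \<in> {p/2<..3*p/2}")
          case True
          have "?\<beta> t \<le> m" unfolding m_def using True ph \<sigma> by (intro damped_antimono) auto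
          moreover have "w * (t - p / 2) \<le> w * p" using True w by (intro mult_left_mono) auto
          then have "sin (w * (t - p / 2)) \<ge> 0" using True w p(2) by (intro sin_ge_zero) auto
          then have "cos (w * t) \<le> 0" by (simp add: sq)
          ultimately have "m * cos (w * t) \<le> ?\<beta> t * cos (w * t)" by (rule mult_right_mono_neg)
          then show ?thesis using True by simp
        qed (use t in auto)
      qed
      show "integrable lborel (\<lambda>t. ?c t)" by (rule ii) auto
    qed (use si in \<open>auto simp: set_integrable_def\<close>)
    ultimately show ?thesis by linarith
  qed
  have Pm: "m / w \<le> P"
  proof -
    have si: "set_integrable lborel {0..p/2} (\<lambda>t. m * sin (w * t))"
      by (intro borel_integrable_atLeastAtMost') (auto intro!: continuous_intros)
    have "((\<lambda>t. sin (w * t)) has_integral (1 / w)) {0..p/2}"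
      using sinI[of 0 "p/2"] ph by simp
    then have "((\<lambda>t. m * sin (w * t)) has_integral (m * (1 / w))) {0..p/2}" by (rule has_integral_mult_right)
    then have "(LBINT t:{0..p/2}. m * sin (w * t)) = m / w"
      using set_borel_integral_eq_integral(2)[OF si] integral_unique by (metis mult.right_neutral times_divide_eq_right)
    moreover have "(LBINT t:{0..p/2}. m * sin (w * t)) \<le> P"
      unfolding set_lebesgue_integral_def P_def
    proof (rule integral_mono_AE)
      show "AE t in lborel. indicator {0..p/2} t *\<^sub>R (m * sin (w * t)) \<le> indicator {0<..p} t * (?\<beta> t * sin (w * t))"
      proof (rule AE_mp[OF AE_lborel_singleton[of 0]], rule AE_I2, rule impI)
        fix t :: real assume t: "t \<noteq> 0"
        show "indicator {0..p/2} t *\<^sub>R (m * sin (w * t)) \<le> indicator {0<..p} t * (?\<beta> t * sin (w * t))"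
        proof (cases "t \<in> {0<..p}")
          case True
          have "w * t \<le> w * p" using True w by (intro mult_left_mono) auto
          then have s0: "sin (w * t) \<ge> 0" using True w p(2) by (intro sin_ge_zero) auto
          show ?thesis
          proof (cases "t \<le> p / 2")
            case le: True
            have "m \<le> ?\<beta> t" unfolding m_def using True le \<sigma> by (intro damped_antimono) auto
            then show ?thesis using True le s0 by (simp add: mult_right_mono)
          qed (use True s0 in \<open>simp add: damped_nonneg\<close>)
        qed (use t ph in auto)
      qed
      show "integrable lborel (\<lambda>t. indicator {0<..p} t * (?\<beta> t * sin (w * t)))" by (rule ii) auto
    qed (use si in \<open>auto simp: set_integrable_def\<close>)
    ultimately show ?thesis by linarith
  qed
  have C: "(LBINT t. indicator {0<..1/w} t * ?\<beta> t) / 2 \<le> C"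
  proof -
    \<comment> \<open>Up to 1/w the phase is at most 1 < pi/3, so the cosine is at least 1/2 there;
      up to p/2 it is still nonnegative.\<close>
    have w1: "1 / w \<le> p / 2" using w pi_ge_two by (simp add: p_def field_simps)
    have "(LBINT t. indicator {0<..1/w} t * ?\<beta> t) / 2 = (LBINT t. indicator {0<..1/w} t * ?\<beta> t / 2)" by simp
    also have "\<dots> \<le> C" unfolding C_def
    proof (rule integral_mono)
      show "integrable lborel (\<lambda>t. indicator {0<..1/w} t * ?\<beta> t / 2)" using iA by simp
      show "integrable lborel (\<lambda>t. indicator {0<..p/2} t * (?\<beta> t * cos (w * t)))" by (rule ii) auto
      fix t :: real
      show "indicator {0<..1/w} t * ?\<beta> t / 2 \<le> indicator {0<..p/2} t * (?\<beta> t * cos (w * t))"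
      proof (cases "t \<in> {0<..p/2}")
        case True
        have "w * t \<le> w * (p/2)" using True w by (intro mult_left_mono) auto
        moreover have "0 \<le> w * t" using True w by simp
        ultimately have c0: "cos (w * t) \<ge> 0" unfolding ph(3) using pi_gt_zero by (intro cos_ge_zero) linarith+
        show ?thesis
        proof (cases "t \<le> 1 / w")
          case le: True
          then have "w * t \<le> 1" using w by (simp add: field_simps)
          then have "w * t \<le> pi / 3" using pi_gt3 by linarith
          then have "cos (pi / 3) \<le> cos (w * t)" using True w by (intro cos_monotone_0_pi_le) auto
          then have "?\<beta> t * (1/2) \<le> ?\<beta> t * cos (w * t)"
            by (intro mult_left_mono damped_nonneg) (simp add: cos_60)
          then show ?thesis using True le by simp
        qed (use True c0 in \<open>simp add: damped_nonneg\<close>)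
      next
        case False
        then show ?thesis using w1 by (auto simp: indicator_def)
      qed
    qed
    finally show ?thesis .
  qed
  \<comment> \<open>From R \<ge> C - 2 m / w and m / w \<le> 2 G follows C \<le> R + 4 G. With R and
    G each at most the norm, the factor is 2 (1 + 4) = 10.\<close>
  have "(LBINT t. indicator {0<..1/w} t * ?\<beta> t) \<le> 2 * (R + 4 * G)"
  proof -
    have "m / w \<le> 2 * G" using Pm GP by (rule order_trans)
    moreover have "C - 2 * (m / w) \<le> R" using R2 R3 R4 by simp
    ultimately have "C \<le> R + 4 * G" by linarith
    then show ?thesis using C by simp
  qed
  also have "\<dots> \<le> 2 * (5 * norm (fourier ?\<beta> w))"
  proof -
    have "R \<le> norm (fourier ?\<beta> w)" using abs_Re_le_cmod[of "fourier ?\<beta> w"] Re by linarith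
    moreover have "G \<le> norm (fourier ?\<beta> w)" using abs_Im_le_cmod[of "fourier ?\<beta> w"] Im by linarith
    ultimately show ?thesis by simp
  qed
  finally show ?thesis by simp
qed

end

section \<open>Nonvanishing, holomorphy and decay of the Laplace transform\<close>

context kernel
begin

lemma b_pos_near_0: obtains t0 where "t0 > 0" "\<And>t. 0 < t \<Longrightarrow> t \<le> t0 \<Longrightarrow> b t > 0"
proof -
  obtain t0 where t0: "t0 > 0" "b t0 \<noteq> 0" using b unfolding assumption1_def by auto
  then have "b t0 > 0" using b_nonneg[of t0] by simp
  then have "b t > 0" if "0 < t" "t \<le> t0" for t using b_antimono[OF that] by linarith
  then show thesis using that t0(1) by blast
qed

lemma damped_integral_pos:
  assumes \<sigma>: "\<sigma> > 0" and h: "h > 0"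
  shows "(LBINT t. indicator {0<..h} t * damped b \<sigma> t) > 0"
proof -
  obtain t0 where t0: "t0 > 0" "\<And>t. 0 < t \<Longrightarrow> t \<le> t0 \<Longrightarrow> b t > 0" using b_pos_near_0 by metis
  define u where "u = min h t0"
  have u: "u > 0" "u \<le> h" using h t0 by (auto simp: u_def)
  have du: "damped b \<sigma> u > 0" using u t0(2)[of u] by (simp add: damped_def u_def)
  have "0 < damped b \<sigma> u * u" using du u by simp
  also have "\<dots> = (LBINT t. indicator {0<..u} t * damped b \<sigma> u)"
    using u by (simp add: mult.commute)
  also have "\<dots> \<le> (LBINT t. indicator {0<..h} t * damped b \<sigma> t)"
  proof (rule integral_mono)
    show "integrable lborel (\<lambda>t. indicator {0<..u} t * damped b \<sigma> u)"
      using u by (simp add: integrable_real_indicator)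
    show "integrable lborel (\<lambda>t. indicator {0<..h} t * damped b \<sigma> t)"
      using integrable_mult_indicator[OF _ integrable_damped[OF \<sigma>], of "{0<..h}"] by simp
    fix t :: real
    show "indicator {0<..u} t * damped b \<sigma> u \<le> indicator {0<..h} t * damped b \<sigma> t"
      using u damped_antimono[of t u \<sigma>] \<sigma> damped_nonneg[of \<sigma> t] by (auto simp: indicator_def)
  qed
  finally show ?thesis .
qed

lemma laplace_cnj: "laplace b (cnj z) = cnj (laplace b z)"
  unfolding laplace_def set_lebesgue_integral_def
  by (subst Bochner_Integration.integral_cnj[symmetric]) (simp add: exp_cnj)

lemma laplace_real:
  assumes r: "r > 0"
  shows "laplace b (of_real r) = of_real (LBINT t. damped b r t)"
  using laplace_eq_fourier[of b r 0]
  by (simp add: fourier_def complex_of_real_def[symmetric] complex_eq_iff flip: complex_of_real_def)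

definition lap :: "real \<Rightarrow> real" where "lap r = (LBINT t. damped b r t)"

lemma lap_pos:
  assumes r: "r > 0" shows "lap r > 0"
proof -
  have "0 < (LBINT t. indicator {0<..1} t * damped b r t)" by (rule damped_integral_pos[OF r]) simp
  also have "\<dots> \<le> lap r" unfolding lap_def
    using integrable_mult_indicator[OF _ integrable_damped[OF r], of "{0<..1}"]
    by (intro integral_mono integrable_damped r) (auto simp: indicator_def damped_nonneg)
  finally show ?thesis .
qed

text \<open>Needed for the logarithm in \<open>lap_lower\<close>. The estimate on vertical lines
  settles the upper quadrant, conjugation the lower one, and positivity of the integrand the real
  axis.\<close>

lemma laplace_nonzero:
  assumes z: "Re z > 0"
  shows "laplace b z \<noteq> 0"
proof -
  have pos: "laplace b z \<noteq> 0" if "Re z > 0" "Im z > 0" for z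
  proof -
    have "0 < (LBINT t. indicator {0<..1 / Im z} t * damped b (Re z) t)"
      using that by (intro damped_integral_pos) auto
    also have "\<dots> \<le> 10 * norm (fourier (damped b (Re z)) (Im z))"
      using that by (intro damped_fourier_lower) auto
    finally show ?thesis using laplace_eq_fourier[of b "Re z" "Im z"] by auto
  qed
  consider "Im z > 0" | "Im z = 0" | "Im z < 0" by linarith
  then show ?thesis
  proof cases
    case 2
    then have "z = of_real (Re z)" by (simp add: complex_eq_iff)
    then show ?thesis using laplace_real[OF z] lap_pos[OF z] by (metis lap_def of_real_eq_0_iff less_irrefl)
  next
    case 3
    then have "laplace b (cnj z) \<noteq> 0" using z by (intro pos) auto
    then show ?thesis by (simp add: laplace_cnj)
  qed (use z pos in auto)
qed

lemma laplace_differentiable: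
  assumes z0: "Re z0 > 0"
  shows "laplace b field_differentiable (at z0)"
proof -
  \<comment> \<open>Increments of norm below \<delta> keep the real part above \<delta>.\<close>
  define \<delta> where "\<delta> = Re z0 / 2"
  have \<delta>: "\<delta> > 0" using z0 by (simp add: \<delta>_def)
  define F where "F z t = exp (- z * complex_of_real t) * complex_of_real (indicator {0<..} t * b t)" for z t
  note [measurable] = b_measurable
  have Fe: "F z t = complex_of_real (damped b (Re z) t) * cis (- (Im z * t))" for z t
    by (simp add: F_def damped_def exp_eq_polar)
  have L: "laplace b z = (LBINT t. F z t)" for z
    unfolding laplace_def set_lebesgue_integral_def F_def
    by (rule Bochner_Integration.integral_cong) (auto simp: indicator_def)
  have Fi: "integrable lborel (F z)" if "Re z > 0" for z
    unfolding Fe using integrable_mult_cis[OF integrable_damped[OF that], of "- Im z"] by simp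
  define D where "D = (LBINT t. - complex_of_real t * F z0 t)"
  have "((\<lambda>h. (laplace b (z0 + h) - laplace b z0) / h) \<longlongrightarrow> D) (at 0)"
    unfolding tendsto_at_iff_sequentially o_def
  proof safe
    fix X :: "nat \<Rightarrow> complex" assume X: "\<forall>i. X i \<in> UNIV - {0}" "X \<longlonglongrightarrow> 0"
    obtain N where N: "\<And>n. n \<ge> N \<Longrightarrow> norm (X n) < \<delta>" using LIMSEQ_D[OF X(2) \<delta>] by auto
    define Y where "Y n = X (n + N)" for n
    have Y: "Y n \<noteq> 0" "norm (Y n) < \<delta>" for n using X(1) N[of "n + N"] by (auto simp: Y_def)
    have Yl: "Y \<longlonglongrightarrow> 0" unfolding Y_def by (rule LIMSEQ_ignore_initial_segment[OF X(2)])
    have "(\<lambda>n. LBINT t. (F (z0 + Y n) t - F z0 t) / Y n) \<longlonglongrightarrow> D"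
      unfolding D_def
    \<comment> \<open>The difference quotient is at most exp(-2 \<delta> t) b(t) times exp(\<delta>
      t) t. Half of the remaining decay absorbs the factor t, because t exp(-\<delta> t / 2) \<le> 2
      / \<delta>.\<close>
    proof (rule integral_dominated_convergence[where w = "\<lambda>t. 2 / \<delta> * damped b (\<delta> / 2) t"])
      show "integrable lborel (\<lambda>t. 2 / \<delta> * damped b (\<delta> / 2) t)" using \<delta> by (intro integrable_mult_right integrable_damped) auto
      show "AE t in lborel. (\<lambda>n. (F (z0 + Y n) t - F z0 t) / Y n) \<longlonglongrightarrow> - complex_of_real t * F z0 t"
      proof (rule AE_I2)
        fix t
        have "((\<lambda>z. F z t) has_field_derivative (- complex_of_real t * F z0 t)) (at z0)"
          unfolding F_def by (auto intro!: derivative_eq_intros)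
        then have "((\<lambda>h. (F (z0 + h) t - F z0 t) / h) \<longlongrightarrow> - complex_of_real t * F z0 t) (at 0)"
          by (simp add: DERIV_def)
        then show "(\<lambda>n. (F (z0 + Y n) t - F z0 t) / Y n) \<longlonglongrightarrow> - complex_of_real t * F z0 t"
          using Y Yl unfolding tendsto_at_iff_sequentially o_def by auto
      qed
      show "AE t in lborel. norm ((F (z0 + Y n) t - F z0 t) / Y n) \<le> 2 / \<delta> * damped b (\<delta> / 2) t" for n
      proof (rule AE_I2)
        fix t :: real
        show "norm ((F (z0 + Y n) t - F z0 t) / Y n) \<le> 2 / \<delta> * damped b (\<delta> / 2) t"
        proof (cases "t > 0")
          case False
          then show ?thesis by (simp add: F_def damped_def)
        next
          case True
          have "norm (exp (- (Y n * of_real t)) - 1) \<le> exp \<bar>Re (- (Y n * of_real t))\<bar> * norm (- (Y n * of_real t))"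
            using Taylor_exp[of "- (Y n * of_real t)" 0] by simp
          also have "\<dots> \<le> exp (\<delta> * t) * (norm (Y n) * t)"
          proof (rule mult_mono)
            have "\<bar>Re (- (Y n * of_real t))\<bar> \<le> norm (- (Y n * of_real t))" by (rule abs_Re_le_cmod)
            also have "\<dots> \<le> \<delta> * t" using Y(2)[of n] True by (auto simp: norm_mult intro!: mult_right_mono)
            finally show "exp \<bar>Re (- (Y n * of_real t))\<bar> \<le> exp (\<delta> * t)" by simp
          qed (use True in \<open>auto simp: norm_mult\<close>)
          finally have e1: "norm (exp (- (Y n * of_real t)) - 1) \<le> exp (\<delta> * t) * (norm (Y n) * t)" .
          have e2: "F (z0 + Y n) t - F z0 t = F z0 t * (exp (- (Y n * of_real t)) - 1)"
            by (simp add: F_def algebra_simps exp_diff exp_add exp_minus field_simps)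
          have nF: "norm (F z0 t) = exp (- (2 * \<delta>) * t) * b t"
            using True b_nonneg[of t] unfolding Fe by (simp add: damped_def norm_mult \<delta>_def)
          have "norm ((F (z0 + Y n) t - F z0 t) / Y n) \<le> exp (- (2 * \<delta>) * t) * b t * (exp (\<delta> * t) * (norm (Y n) * t)) / norm (Y n)"
            unfolding e2 norm_divide norm_mult nF using e1 True b_nonneg[of t]
            by (intro divide_right_mono mult_left_mono) auto
          also have "\<dots> = (exp (- (2 * \<delta>) * t) * exp (\<delta> * t)) * b t * t" using Y(1)[of n] by (simp add: field_simps)
          also have "exp (- (2 * \<delta>) * t) * exp (\<delta> * t) = exp (- (\<delta> / 2) * t) * exp (- (\<delta> / 2 * t))"
            by (simp flip: exp_add)
          also have "exp (- (\<delta> / 2) * t) * exp (- (\<delta> / 2 * t)) * b t * t = exp (- (\<delta> / 2) * t) * b t * (t * exp (- (\<delta> / 2 * t)))"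
            by (simp add: mult_ac)
          also have "\<dots> \<le> exp (- (\<delta> / 2) * t) * b t * (2 / \<delta>)"
          proof (rule mult_left_mono)
            have "\<delta> / 2 * t \<le> exp (\<delta> / 2 * t)" using exp_ge_add_one_self[of "\<delta> / 2 * t"] by linarith
            then show "t * exp (- (\<delta> / 2 * t)) \<le> 2 / \<delta>" using \<delta> by (simp add: exp_minus field_simps)
          qed (use True b_nonneg[of t] in auto)
          also have "\<dots> = 2 / \<delta> * damped b (\<delta> / 2) t" using True by (simp add: damped_def)
          finally show ?thesis .
        qed
      qed
    qed (unfold F_def, measurable)
    moreover have "(LBINT t. (F (z0 + Y n) t - F z0 t) / Y n) = (laplace b (z0 + Y n) - laplace b z0) / Y n" for n
    proof -
      have "Re (z0 + Y n) > 0" using Y(2)[of n] abs_Re_le_cmod[of "Y n"] z0 by (simp add: \<delta>_def)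
      then show ?thesis unfolding L using Fi z0 by simp
    qed
    ultimately have "(\<lambda>n. (laplace b (z0 + Y n) - laplace b z0) / Y n) \<longlonglongrightarrow> D" by (simp only:)
    then have "(\<lambda>n. (laplace b (z0 + X (n + N)) - laplace b z0) / X (n + N)) \<longlonglongrightarrow> D" unfolding Y_def .
    then show "(\<lambda>n. (laplace b (z0 + X n) - laplace b z0) / X n) \<longlonglongrightarrow> D" by (rule LIMSEQ_offset)
  qed
  then have "(laplace b has_field_derivative D) (at z0)" by (simp add: DERIV_def)
  then show ?thesis using field_differentiable_def by blast
qed

text \<open>The power \<open>\<pi> / (2 \<theta>)\<close> of the Laplace transform maps the right half-plane to itself, and the
  Schwarz lemma for the half-plane bounds the decay of such a map along the positive axis.\<close>
lemma lap_lower: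
  assumes r: "r \<ge> 1"
  shows "lap r \<ge> lap 1 * r powr (1 - rho_index b)"
proof -
  define k where "k = pi / (2 * theta)"
  have th: "0 < theta" "theta < pi / 2" by (rule theta_bounds)+
  have k: "k > 0" "k * theta = pi / 2" using th by (simp_all add: k_def)
  let ?H = "{z. 0 < Re z}"
  have nonneg: "laplace b z \<notin> \<real>\<^sub>\<le>\<^sub>0" if "Re z > 0" for z
  proof -
    have "0 < cos theta * norm (laplace b z)" using laplace_nonzero[OF that] th by (intro mult_pos_pos cos_gt_zero) auto
    then have "Re (laplace b z) > 0" using laplace_sector(1)[OF that] by linarith
    then show ?thesis by (auto simp: complex_nonpos_Reals_iff)
  qed
  have holL: "laplace b holomorphic_on ?H"
    using laplace_differentiable by (auto simp: holomorphic_on_def intro: field_differentiable_at_within)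
  define G where "G z = exp (of_real k * Ln (laplace b z))" for z
  have holG: "G holomorphic_on ?H"
    unfolding G_def by (intro holomorphic_intros holL) (use nonneg in auto)
  have ReG: "Re (G z) \<ge> 0" if "Re z > 0" for z
  proof -
    have nz: "laplace b z \<noteq> 0" by (rule laplace_nonzero[OF that])
    have "\<bar>k * Im (Ln (laplace b z))\<bar> \<le> k * theta"
      using Arg_laplace[OF that] k(1) nz by (simp add: abs_mult Arg_eq_Im_Ln)
    then have "cos (k * Im (Ln (laplace b z))) \<ge> 0" unfolding k(2) by (intro cos_ge_zero) auto
    then show ?thesis by (simp add: G_def Re_exp)
  qed
  have Gr: "G (of_real x) = of_real (exp (k * ln (lap x)))" if "x > 0" for x
    using lap_pos[OF that] laplace_real[OF that]
    by (simp add: G_def Ln_of_real flip: lap_def of_real_mult exp_of_real)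
  define p where "p = exp (k * ln (lap 1))"
  have p: "p > 0" by (simp add: p_def)
  \<comment> \<open>The Cayley map from the disc to the right half-plane, with 0 going to 1. The map
    v \<mapsto> (v - p) / (v + p) used below leads back and sends p = G(1) to 0, so
    \<open>Hh\<close> fixes 0.\<close>
  define \<phi> where "\<phi> \<zeta> = (1 + \<zeta>) / (1 - \<zeta>)" for \<zeta> :: complex
  have \<phi>H: "Re (\<phi> \<zeta>) > 0" if "norm \<zeta> < 1" for \<zeta>
  proof -
    have "\<zeta> \<noteq> 1" using that by auto
    have "\<phi> \<zeta> = ((1 + \<zeta>) * cnj (1 - \<zeta>)) / of_real ((norm (1 - \<zeta>))\<^sup>2)"
      unfolding \<phi>_def by (subst complex_div_cnj) simp
    then have "Re (\<phi> \<zeta>) = Re ((1 + \<zeta>) * cnj (1 - \<zeta>)) / (norm (1 - \<zeta>))\<^sup>2"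
      by (simp only: Re_divide_of_real)
    also have "Re ((1 + \<zeta>) * cnj (1 - \<zeta>)) = 1 - (norm \<zeta>)\<^sup>2"
      unfolding cmod_power2 by (simp add: power2_eq_square algebra_simps)
    finally have "Re (\<phi> \<zeta>) = (1 - (norm \<zeta>)\<^sup>2) / (norm (1 - \<zeta>))\<^sup>2" .
    moreover have "(norm \<zeta>)\<^sup>2 < 1" using that by (simp add: power_less_one_iff abs_square_less_1)
    ultimately show ?thesis using \<open>\<zeta> \<noteq> 1\<close> by simp
  qed
  define Hh where "Hh \<zeta> = (G (\<phi> \<zeta>) - of_real p) / (G (\<phi> \<zeta>) + of_real p)" for \<zeta>
  have den: "G (\<phi> \<zeta>) + of_real p \<noteq> 0" if "norm \<zeta> < 1" for \<zeta>
  proof -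
    have "Re (G (\<phi> \<zeta>) + of_real p) > 0" using ReG[OF \<phi>H[OF that]] p by simp
    then show ?thesis by (metis less_irrefl zero_complex.sel(1))
  qed
  have hol\<phi>: "\<phi> holomorphic_on ball 0 1"
    unfolding \<phi>_def by (intro holomorphic_intros) auto
  have holH: "Hh holomorphic_on ball 0 1"
  proof -
    have "(G \<circ> \<phi>) holomorphic_on ball 0 1"
      by (rule holomorphic_on_compose_gen[OF hol\<phi> holG]) (use \<phi>H in auto)
    then show ?thesis unfolding Hh_def o_def by (intro holomorphic_intros) (use den in auto)
  qed
  have H1: "norm (Hh \<zeta>) \<le> 1" if "norm \<zeta> < 1" for \<zeta>
  proof -
    define v where "v = G (\<phi> \<zeta>)"
    have v: "Re v \<ge> 0" unfolding v_def by (rule ReG[OF \<phi>H[OF that]])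
    have "(norm (v - of_real p))\<^sup>2 \<le> (norm (v + of_real p))\<^sup>2"
      using v p mult_nonneg_nonneg[of "Re v" p] unfolding cmod_power2 by (simp add: power2_eq_square algebra_simps)
    then have "norm (v - of_real p) \<le> norm (v + of_real p)" by (rule power2_le_imp_le) simp
    then show ?thesis using den[OF that] by (simp add: Hh_def norm_divide v_def)
  qed
  have H0: "Hh 0 = 0" using Gr[of 1] by (simp add: Hh_def \<phi>_def p_def)
  define x where "x = (r - 1) / (r + 1)"
  have x: "0 \<le> x" "x < 1" using r by (auto simp: x_def)
  \<comment> \<open>\<open>Schwarz_Lemma\<close> wants a strict bound while \<open>Hh\<close> is
    only known to have norm at most 1, hence the factor 1 - \<epsilon> and the limit \<epsilon>
    \<longrightarrow> 0.\<close>
  have key: "norm (Hh (of_real x)) \<le> x"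
  proof (rule tendsto_upperbound)
    show "((\<lambda>\<epsilon>. (1 - \<epsilon>) * norm (Hh (of_real x))) \<longlongrightarrow> norm (Hh (of_real x))) (at_right 0)"
      by (auto intro!: tendsto_eq_intros)
    have "(1 - \<epsilon>) * norm (Hh (of_real x)) \<le> x" if \<epsilon>: "0 < \<epsilon>" "\<epsilon> < 1" for \<epsilon>
    proof -
      have nn: "norm (complex_of_real (1 - \<epsilon>)) = 1 - \<epsilon>" unfolding norm_of_real using \<epsilon> by simp
      have "norm (of_real (1 - \<epsilon>) * Hh (of_real x)) \<le> norm (complex_of_real x)"
      proof (rule Schwarz_Lemma(1)[of "\<lambda>\<zeta>. of_real (1 - \<epsilon>) * Hh \<zeta>"])
        show "(\<lambda>\<zeta>. of_real (1 - \<epsilon>) * Hh \<zeta>) holomorphic_on ball 0 1" by (intro holomorphic_intros holH)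
        show "norm (of_real (1 - \<epsilon>) * Hh \<zeta>) < 1" if "norm \<zeta> < 1" for \<zeta>
        proof -
          have "norm (of_real (1 - \<epsilon>) * Hh \<zeta>) = (1 - \<epsilon>) * norm (Hh \<zeta>)" by (simp only: norm_mult nn)
          also have "\<dots> \<le> (1 - \<epsilon>) * 1" using \<epsilon> H1[OF that] by (intro mult_left_mono) auto
          also have "\<dots> < 1" using \<epsilon> by simp
          finally show ?thesis .
        qed
      qed (use H0 x in auto)
      then show ?thesis unfolding norm_mult nn using x by simp
    qed
    then show "eventually (\<lambda>\<epsilon>. (1 - \<epsilon>) * norm (Hh (of_real x)) \<le> x) (at_right 0)"
      by (auto simp: eventually_at_right_field intro!: exI[of _ 1])
  qed simp
  define g where "g = exp (k * ln (lap r))"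
  have g: "g > 0" by (simp add: g_def)
  have "(1 + x) / (1 - x) = r" using r by (simp add: x_def field_simps)
  then have "\<phi> (of_real x) = of_real r" unfolding \<phi>_def by (metis of_real_1 of_real_add of_real_diff of_real_divide)
  then have "Hh (of_real x) = of_real ((g - p) / (g + p))" using Gr[of r] r by (simp add: Hh_def g_def)
  then have "\<bar>(g - p) / (g + p)\<bar> \<le> x" using key by (simp only: norm_of_real)
  moreover have "(p - g) / (g + p) = - ((g - p) / (g + p))" by (simp add: minus_divide_left)
  ultimately have "(p - g) / (g + p) \<le> x" by linarith
  \<comment> \<open>With x = (r - 1) / (r + 1) this simplifies to p \<le> g r, that is lap(1)^k
    \<le> r lap(r)^k. Logarithms divided by k give the claim, as 1 / k = \<rho> - 1.\<close>
  then have "p - g \<le> x * (g + p)" using g p by (simp add: divide_le_eq)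
  then have "(p - g) * (r + 1) \<le> (r - 1) * (g + p)" using r by (simp add: x_def field_simps)
  then have "p \<le> g * r" by (simp add: algebra_simps)
  then have "ln p \<le> ln (g * r)" using p g r by (subst ln_le_cancel_iff) auto
  then have "k * ln (lap 1) \<le> k * ln (lap r) + ln r" using g r by (simp add: p_def g_def ln_mult)
  then have "ln (lap 1) - ln r / k \<le> ln (lap r)" using k(1) by (simp add: field_simps)
  moreover have "1 / k = rho_index b - 1" unfolding rho_theta k_def by simp
  then have "ln r / k = (rho_index b - 1) * ln r" by (metis mult.commute times_divide_eq_right mult.right_neutral)
  ultimately have "exp (ln (lap 1) + (1 - rho_index b) * ln r) \<le> exp (ln (lap r))" by (simp add: algebra_simps)
  then show ?thesis using lap_pos[of 1] lap_pos[of r] r by (simp add: exp_add powr_def)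
qed

text \<open>Cut at h = 1/r. The first part is at most the mass up to h. The rest is at most b(h)
  times the integral of exp(-r t), which is b(h) h and again at most that mass by monotonicity;
  hence the 2.\<close>

lemma lap_le_b_mass:
  assumes r: "r > 0"
  shows "lap r \<le> 2 * b_mass (1 / r)"
proof -
  let ?h = "1 / r"
  have h: "?h > 0" using r by simp
  have e: "(LBINT t. indicator {0..} t *\<^sub>R exp (- (t * r))) = 1 / r"
  proof -
    have eq: "(\<lambda>t. if t \<in> {0..} then exp (- r * t) else 0) = (\<lambda>t. indicator {0..} t *\<^sub>R exp (- (t * r)))"
      by (auto simp: fun_eq_iff mult.commute)
    have 1: "((\<lambda>t. if t \<in> {0..} then exp (- r * t) else 0) has_integral (exp (- r * 0) / r)) UNIV"
      using has_integral_exp_minus_to_infinity[OF r, of 0] by (simp only: has_integral_restrict_UNIV)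
    have 2: "((\<lambda>t. indicator {0..} t *\<^sub>R exp (- (t * r))) has_integral (LBINT t. indicator {0..} t *\<^sub>R exp (- (t * r)))) UNIV"
      by (rule has_integral_integral_lborel[OF integrable_exp_halfline[OF r]])
    show ?thesis using has_integral_unique[OF 1[unfolded eq] 2] by simp
  qed
  have "lap r \<le> (LBINT t. indicator {0<..?h} t * b t + b ?h * (indicator {0..} t *\<^sub>R exp (- (t * r))))"
    unfolding lap_def
  proof (rule integral_mono)
    show "integrable lborel (\<lambda>t. indicator {0<..?h} t * b t + b ?h * (indicator {0..} t *\<^sub>R exp (- (t * r))))"
      by (intro Bochner_Integration.integrable_add b_integrable_upto integrable_mult_right integrable_exp_halfline r)
    fix t :: real
    consider "t \<le> 0" | "0 < t" "t \<le> ?h" | "?h < t" by linarith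
    then show "damped b r t \<le> indicator {0<..?h} t * b t + b ?h * (indicator {0..} t *\<^sub>R exp (- (t * r)))"
    proof cases
      case 1
      then show ?thesis using b_nonneg[OF h] by (simp add: damped_def)
    next
      case 2
      have "exp (- r * t) * b t \<le> 1 * b t" using 2 r b_nonneg by (intro mult_right_mono) auto
      then show ?thesis using 2 b_nonneg[OF h] by (simp add: damped_def add_increasing2)
    next
      case 3
      then have "t > 0" using h by linarith
      have "exp (- r * t) * b t \<le> exp (- r * t) * b ?h" using b_antimono[OF h, of t] 3 by (intro mult_left_mono) auto
      then show ?thesis using 3 \<open>t > 0\<close> by (simp add: damped_def mult.commute)
    qed
  qed (rule integrable_damped[OF r])
  also have "\<dots> = b_mass ?h + b ?h * ?h"
    unfolding b_mass_def using b_integrable_upto[of ?h] integrable_exp_halfline[OF r] e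
    by (subst Bochner_Integration.integral_add) auto
  also have "b ?h * ?h = (LBINT t. indicator {0<..?h} t * b ?h)" using h by (simp add: mult.commute)
  also have "\<dots> \<le> b_mass ?h" unfolding b_mass_def
  proof (rule integral_mono[OF _ b_integrable_upto])
    show "integrable lborel (\<lambda>t. indicator {0<..?h} t * b ?h)"
      using h by (simp add: integrable_real_indicator)
    show "indicator {0<..?h} t * b ?h \<le> indicator {0<..?h} t * b t" for t
      using b_antimono[of t ?h] by (cases "t \<in> {0<..?h}") auto
  qed
  finally show ?thesis by simp
qed

text \<open>With m = max 1 w the chain is: decay on the axis bounds lap(m) below, lap(m) is at most
  twice the mass of b up to 1/m, that mass is at most e times the damped mass up to 1/w, and
  convexity bounds the latter by 10 |B|. This explains 20 e.\<close>

lemma laplace_lower: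
  obtains c where "c > 0"
    "\<And>\<sigma> w. 0 < \<sigma> \<Longrightarrow> \<sigma> \<le> 1 \<Longrightarrow> w \<noteq> 0 \<Longrightarrow> norm (laplace b (Complex \<sigma> w)) \<ge> c * max 1 \<bar>w\<bar> powr (1 - rho_index b)"
proof
  define c where "c = lap 1 / (20 * exp 1)"
  show "c > 0" using lap_pos[of 1] by (simp add: c_def)
  have pos: "norm (laplace b (Complex \<sigma> w)) \<ge> c * max 1 w powr (1 - rho_index b)" if \<sigma>: "0 < \<sigma>" "\<sigma> \<le> 1" and w: "w > 0" for \<sigma> w
  proof -
    define m where "m = max 1 w"
    \<comment> \<open>m \<ge> 1 is the range of \<open>lap_lower\<close>; on t \<le> 1/m \<le> 1,
      with \<sigma> \<le> 1, the damping loses at most a factor e.\<close>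
    have m: "m \<ge> 1" "1 / m \<le> 1 / w" "1 / m \<le> 1" using w by (auto simp: m_def field_simps)
    have "lap 1 * m powr (1 - rho_index b) \<le> lap m" by (rule lap_lower[OF m(1)])
    also have "\<dots> \<le> 2 * b_mass (1 / m)" using m(1) by (intro lap_le_b_mass) auto
    also have "b_mass (1 / m) \<le> exp 1 * (LBINT t. indicator {0<..1/w} t * damped b \<sigma> t)"
    proof -
      have "b_mass (1 / m) \<le> (LBINT t. exp 1 * (indicator {0<..1/w} t * damped b \<sigma> t))"
        unfolding b_mass_def
      proof (rule integral_mono[OF b_integrable_upto])
        show "integrable lborel (\<lambda>t. exp 1 * (indicator {0<..1/w} t * damped b \<sigma> t))"
          using integrable_mult_indicator[OF _ integrable_damped[OF \<sigma>(1)], of "{0<..1/w}"] by simp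
        fix t :: real
        show "indicator {0<..1/m} t * b t \<le> exp 1 * (indicator {0<..1/w} t * damped b \<sigma> t)"
        proof (cases "t \<in> {0<..1/m}")
          case True
          have "t \<le> 1" using True m(3) by (meson greaterThanAtMost_iff order_trans)
          then have "\<sigma> * t \<le> 1 * 1" using \<sigma> True by (intro mult_mono) auto
          then have "1 * b t \<le> exp (1 - \<sigma> * t) * b t" using b_nonneg[of t] True by (intro mult_right_mono) auto
          moreover have "exp (1 - \<sigma> * t) = exp 1 * exp (- (\<sigma> * t))" by (simp add: exp_diff exp_minus field_simps)
          moreover have "t \<le> 1 / w" using True m(2) by (meson greaterThanAtMost_iff order_trans)
          ultimately show ?thesis using True by (simp add: damped_def)
        qed (simp add: damped_nonneg)
      qed
      then show ?thesis by simp
    qed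
    also have "(LBINT t. indicator {0<..1/w} t * damped b \<sigma> t) \<le> 10 * norm (laplace b (Complex \<sigma> w))"
      unfolding laplace_eq_fourier by (rule damped_fourier_lower[OF \<sigma>(1) w])
    finally have "lap 1 * m powr (1 - rho_index b) \<le> 20 * exp 1 * norm (laplace b (Complex \<sigma> w))" by simp
    then show ?thesis by (simp add: c_def m_def field_simps)
  qed
  show "norm (laplace b (Complex \<sigma> w)) \<ge> c * max 1 \<bar>w\<bar> powr (1 - rho_index b)" if "0 < \<sigma>" "\<sigma> \<le> 1" "w \<noteq> 0" for \<sigma> w
  proof (cases "w > 0")
    case True
    then show ?thesis using pos[OF that(1,2) True] by simp
  next
    case False
    have "Complex \<sigma> w = cnj (Complex \<sigma> (- w))" by (simp add: complex_eq_iff)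
    then have "norm (laplace b (Complex \<sigma> w)) = norm (laplace b (Complex \<sigma> (- w)))"
      by (metis laplace_cnj complex_mod_cnj)
    then show ?thesis using pos[OF that(1,2), of "- w"] that False by simp
  qed
qed

end

section \<open>The square integral of the resolvent\<close>

lemma nn_integral_inverse_square_tail:
  assumes a: "a > 0"
  shows "(\<integral>\<^sup>+w. ennreal (1 / w\<^sup>2) * indicator {w. \<bar>w\<bar> \<ge> a} w \<partial>lborel) \<le> ennreal (2 / a)"
proof -
  have p: "(\<integral>\<^sup>+w. ennreal (1 / w\<^sup>2) * indicator {a..} w \<partial>lborel) = ennreal (1 / a)"
  proof -
    have "(\<integral>\<^sup>+w. ennreal (1 / w\<^sup>2) * indicator {a..} w \<partial>lborel) = ennreal (0 - (- 1 / a))"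
    proof (rule nn_integral_FTC_atLeast)
      have "((\<lambda>x::real. - 1 * inverse x) \<longlongrightarrow> - 1 * 0) at_top"
        by (intro tendsto_intros tendsto_inverse_0_at_top filterlim_ident)
      then show "((\<lambda>x::real. - 1 / x) \<longlongrightarrow> 0) at_top" by (simp add: divide_inverse)
      show "DERIV (\<lambda>x. - 1 / x) x :> 1 / x\<^sup>2" if "a \<le> x" for x :: real
        using that a by (auto intro!: derivative_eq_intros simp: power2_eq_square)
    qed auto
    then show ?thesis by simp
  qed
  have n: "(\<integral>\<^sup>+w. ennreal (1 / w\<^sup>2) * indicator {..-a} w \<partial>lborel) = ennreal (1 / a)"
  proof -
    have "(\<integral>\<^sup>+w. ennreal (1 / w\<^sup>2) * indicator {..-a} w \<partial>lborel)
        = ennreal \<bar>-1\<bar> * (\<integral>\<^sup>+w. ennreal (1 / (0 + (-1) * w)\<^sup>2) * indicator {..-a} (0 + (-1) * w) \<partial>lborel)"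
      by (rule nn_integral_real_affine) auto
    also have "\<dots> = (\<integral>\<^sup>+w. ennreal (1 / w\<^sup>2) * indicator {a..} w \<partial>lborel)"
      by (simp add: indicator_def)
    finally show ?thesis using p by simp
  qed
  have "(\<integral>\<^sup>+w. ennreal (1 / w\<^sup>2) * indicator {w. \<bar>w\<bar> \<ge> a} w \<partial>lborel)
      = (\<integral>\<^sup>+w. ennreal (1 / w\<^sup>2) * indicator {a..} w + ennreal (1 / w\<^sup>2) * indicator {..-a} w \<partial>lborel)"
    by (intro nn_integral_cong) (use a in \<open>auto simp: indicator_def abs_real_def\<close>)
  also have "\<dots> = ennreal (1 / a) + ennreal (1 / a)"
    using p n by (subst nn_integral_add) auto
  also have "\<dots> = ennreal (2 / a)" using a by (simp flip: ennreal_plus)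
  finally show ?thesis by simp
qed

context kernel
begin

text \<open>The angle between z and B(z) is at most pi/2 + \<theta>, so the mixed term of the square
  is at least -2 sin \<theta> |z| \<lambda> |B|. The inequality 2xy \<le> x^2 + y^2 absorbs it,
  leaving the factor 1 - sin \<theta> > 0.\<close>

lemma sector_lower:
  assumes z: "Re z > 0" and lam: "lam > 0"
  shows "(1 - sin theta) * ((norm z)\<^sup>2 + (lam * norm (laplace b z))\<^sup>2) \<le> (norm (z + of_real lam * laplace b z))\<^sup>2"
proof -
  let ?L = "laplace b z"
  have "- (norm z * (sin theta * norm ?L)) \<le> Im z * Im ?L"
  proof -
    have "\<bar>Im z * Im ?L\<bar> \<le> norm z * (sin theta * norm ?L)"
      unfolding abs_mult by (intro mult_mono abs_Im_le_cmod laplace_sector z) auto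
    then show ?thesis by linarith
  qed
  moreover have "0 \<le> Re z * Re ?L"
  proof -
    have "0 \<le> cos theta * norm ?L" using theta_bounds by (intro mult_nonneg_nonneg cos_ge_zero) auto
    also have "\<dots> \<le> Re ?L" by (rule laplace_sector[OF z])
    finally show ?thesis using z by simp
  qed
  ultimately have "- (sin theta * (norm z * norm ?L)) \<le> Re z * Re ?L + Im z * Im ?L" by (simp add: mult_ac)
  then have "2 * lam * (- (sin theta * (norm z * norm ?L))) \<le> 2 * lam * (Re z * Re ?L + Im z * Im ?L)"
    using lam by (intro mult_left_mono) auto
  moreover have "sin theta * (2 * norm z * (lam * norm ?L)) \<le> sin theta * ((norm z)\<^sup>2 + (lam * norm ?L)\<^sup>2)"
    using theta_bounds by (intro mult_left_mono sum_squares_bound sin_ge_zero) auto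
  moreover have "(norm (z + of_real lam * ?L))\<^sup>2 = (norm z)\<^sup>2 + (lam * norm ?L)\<^sup>2 + 2 * lam * (Re z * Re ?L + Im z * Im ?L)"
    unfolding power_mult_distrib cmod_power2 by (simp add: power2_eq_square algebra_simps)
  ultimately show ?thesis by (simp add: algebra_simps)
qed

text \<open>One constant has to serve all eigenvalues and all times, so it may depend only on
  \<open>b\<close> and on a lower bound \<open>lam0\<close> for the spectrum.\<close>

lemma resolvent_L2:
  assumes lam0: "lam0 > 0"
  obtains C where "C > 0"
    "\<And>s lam T. resolvent b s lam \<Longrightarrow> lam \<ge> lam0 \<Longrightarrow> T \<ge> 0 \<Longrightarrow>
       (LBINT t. indicator {0<..T} t * (s t)\<^sup>2) \<le> C * lam powr (- 1 / rho_index b)"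
proof -
  let ?\<rho> = "rho_index b"
  have \<rho>: "1 < ?\<rho>" "?\<rho> < 2" using b by (auto simp: assumption1_def)
  obtain c where c: "c > 0" "\<And>\<sigma> w. 0 < \<sigma> \<Longrightarrow> \<sigma> \<le> 1 \<Longrightarrow> w \<noteq> 0 \<Longrightarrow>
      norm (laplace b (Complex \<sigma> w)) \<ge> c * max 1 \<bar>w\<bar> powr (1 - ?\<rho>)"
    using laplace_lower by metis
  define \<kappa> where "\<kappa> = 1 - sin theta"
  have "sin theta < sin (pi / 2)" using theta_bounds by (intro sin_monotone_2pi) auto
  then have \<kappa>: "\<kappa> > 0" by (simp add: \<kappa>_def)
  \<comment> \<open>Chosen so that \<Lambda> below is at most D \<lambda>^(1/\<rho>) for all
    \<lambda> \<ge> lam0, including those where the maximum in \<Lambda> is 1.\<close>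
  define D where "D = max 1 (lam0 powr (- 1 / ?\<rho>))"
  define K where "K = 2 * D powr (2 * ?\<rho> - 1) / (\<kappa> * c\<^sup>2) + 2 / \<kappa>"
  have D: "D \<ge> 1" by (simp add: D_def)
  have K: "K > 0" unfolding K_def using D c \<kappa> by (intro add_nonneg_pos) auto
  show thesis
  proof (rule that[of "K * exp 2"])
    show "K * exp 2 > 0" using K by simp
    fix s :: "real \<Rightarrow> real" and lam T :: real
    assume res: "resolvent b s lam" and lam: "lam \<ge> lam0" and T: "T \<ge> 0"
    interpret resolvent b s lam by (rule res)
    \<comment> \<open>The balance point of w and \<lambda> w^(1-\<rho>), raised to 1 so that
      \<open>max 1 |w|\<close> stays below \<Lambda> whenever |w| does.\<close>
    define \<Lambda> where "\<Lambda> = max 1 (lam powr (1 / ?\<rho>))"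
    have \<Lambda>: "\<Lambda> \<ge> 1" "lam powr (1 / ?\<rho>) \<le> \<Lambda>" by (auto simp: \<Lambda>_def)
    have \<Lambda>D: "\<Lambda> \<le> D * lam powr (1 / ?\<rho>)"
    proof -
      have "1 = lam0 powr (- 1 / ?\<rho>) * lam0 powr (1 / ?\<rho>)" using lam0 by (simp flip: powr_add)
      also have "\<dots> \<le> D * lam powr (1 / ?\<rho>)"
        using lam lam0 \<rho> by (intro mult_mono powr_mono2) (auto simp: D_def)
      finally have "1 \<le> D * lam powr (1 / ?\<rho>)" .
      moreover have "1 * lam powr (1 / ?\<rho>) \<le> D * lam powr (1 / ?\<rho>)" using D by (intro mult_right_mono) auto
      ultimately show ?thesis by (simp add: \<Lambda>_def)
    qed
    \<comment> \<open>\<sigma> \<le> 1 is the range of \<open>laplace_lower\<close>, and \<sigma> T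
      \<le> 1 bounds the cost of undoing the squared damping on (0, T] by exp 2.\<close>
    define \<sigma> where "\<sigma> = 1 / (1 + T)"
    have \<sigma>: "\<sigma> > 0" "\<sigma> \<le> 1" "\<sigma> * T \<le> 1" using T by (auto simp: \<sigma>_def field_simps)
    define F where "F w = fourier (damped s \<sigma>) w" for w
    \<comment> \<open>The low-frequency bound on |F|^2, from the \<lambda> |B| term alone; the |z|
      term alone serves the high frequencies.\<close>
    define A where "A = \<Lambda> powr (2 * ?\<rho> - 2) / (\<kappa> * c\<^sup>2 * lam\<^sup>2)"
    have [measurable]: "F \<in> borel_measurable borel"
      unfolding F_def by (rule fourier_measurable[OF integrable_damped_s[OF \<sigma>(1)]])
    have Fb: "(norm (F w))\<^sup>2 * (\<kappa> * (w\<^sup>2 + (lam * norm (laplace b (Complex \<sigma> w)))\<^sup>2)) \<le> 1" for w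
    proof -
      let ?z = "Complex \<sigma> w"
      have "w\<^sup>2 \<le> (norm ?z)\<^sup>2" by (simp add: cmod_power2)
      then have "\<kappa> * (w\<^sup>2 + (lam * norm (laplace b ?z))\<^sup>2) \<le> \<kappa> * ((norm ?z)\<^sup>2 + (lam * norm (laplace b ?z))\<^sup>2)"
        using \<kappa> by (intro mult_left_mono) auto
      also have "\<dots> \<le> (norm (?z + of_real lam * laplace b ?z))\<^sup>2"
        unfolding \<kappa>_def using \<sigma> lam_pos by (intro sector_lower) auto
      finally have "(norm (F w))\<^sup>2 * (\<kappa> * (w\<^sup>2 + (lam * norm (laplace b ?z))\<^sup>2)) \<le> (norm (F w))\<^sup>2 * (norm (?z + of_real lam * laplace b ?z))\<^sup>2"
        by (intro mult_left_mono) auto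
      also have "\<dots> = (norm (F w * (?z + of_real lam * laplace b ?z)))\<^sup>2" by (simp add: norm_mult power_mult_distrib)
      also have "\<dots> = 1" unfolding F_def laplace_resolvent[OF \<sigma>(1)] by simp
      finally show ?thesis .
    qed
    have F1: "(norm (F w))\<^sup>2 \<le> (1 / \<kappa>) * (1 / w\<^sup>2)" if "w \<noteq> 0" for w
    proof -
      have "(norm (F w))\<^sup>2 * (\<kappa> * w\<^sup>2) \<le> (norm (F w))\<^sup>2 * (\<kappa> * (w\<^sup>2 + (lam * norm (laplace b (Complex \<sigma> w)))\<^sup>2))"
        using \<kappa> by (intro mult_left_mono) auto
      then have "(norm (F w))\<^sup>2 * (\<kappa> * w\<^sup>2) \<le> 1" using Fb[of w] by linarith
      then show ?thesis using \<kappa> that by (simp add: field_simps)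
    qed
    have F2: "(norm (F w))\<^sup>2 \<le> A" if "w \<noteq> 0" "\<bar>w\<bar> \<le> \<Lambda>" for w
    proof -
      have "c * \<Lambda> powr (1 - ?\<rho>) \<le> c * max 1 \<bar>w\<bar> powr (1 - ?\<rho>)"
        using c \<rho> that \<Lambda> by (intro mult_left_mono powr_mono2') auto
      also have "\<dots> \<le> norm (laplace b (Complex \<sigma> w))" by (rule c(2)[OF \<sigma>(1,2) that(1)])
      finally have "(lam * (c * \<Lambda> powr (1 - ?\<rho>)))\<^sup>2 \<le> (lam * norm (laplace b (Complex \<sigma> w)))\<^sup>2"
        using lam_pos c by (intro power_mono mult_left_mono) auto
      then have "(norm (F w))\<^sup>2 * (\<kappa> * (lam * (c * \<Lambda> powr (1 - ?\<rho>)))\<^sup>2)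
         \<le> (norm (F w))\<^sup>2 * (\<kappa> * (w\<^sup>2 + (lam * norm (laplace b (Complex \<sigma> w)))\<^sup>2))"
        using \<kappa> by (intro mult_left_mono) (auto intro: add_increasing)
      also have "\<dots> \<le> 1" by (rule Fb)
      finally have le: "(norm (F w))\<^sup>2 * (\<kappa> * (lam * (c * \<Lambda> powr (1 - ?\<rho>)))\<^sup>2) \<le> 1" .
      have "A * (\<kappa> * (lam * (c * \<Lambda> powr (1 - ?\<rho>)))\<^sup>2) = \<Lambda> powr (2 * ?\<rho> - 2) * (\<Lambda> powr (1 - ?\<rho>))\<^sup>2"
        using \<kappa> c lam_pos by (simp add: A_def power_mult_distrib field_simps)
      also have "(\<Lambda> powr (1 - ?\<rho>))\<^sup>2 = \<Lambda> powr (2 - 2 * ?\<rho>)"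
        using \<Lambda> by (simp add: power2_eq_square flip: powr_add)
      also have "\<Lambda> powr (2 * ?\<rho> - 2) * \<Lambda> powr (2 - 2 * ?\<rho>) = 1" using \<Lambda> by (simp flip: powr_add)
      finally have "(norm (F w))\<^sup>2 * (\<kappa> * (lam * (c * \<Lambda> powr (1 - ?\<rho>)))\<^sup>2) \<le> A * (\<kappa> * (lam * (c * \<Lambda> powr (1 - ?\<rho>)))\<^sup>2)"
        using le by simp
      moreover have "\<kappa> * (lam * (c * \<Lambda> powr (1 - ?\<rho>)))\<^sup>2 > 0" using \<kappa> c lam_pos \<Lambda> by simp
      ultimately show ?thesis by (simp only: mult_le_cancel_right_pos)
    qed
    have A0: "A \<ge> 0" using \<kappa> by (simp add: A_def)
    have "(\<integral>\<^sup>+w. ennreal ((norm (F w))\<^sup>2) \<partial>lborel)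
       \<le> (\<integral>\<^sup>+w. ennreal A * indicator {-\<Lambda>..\<Lambda>} w + ennreal (1 / \<kappa>) * (ennreal (1 / w\<^sup>2) * indicator {w. \<bar>w\<bar> \<ge> \<Lambda>} w) \<partial>lborel)"
    proof (rule nn_integral_mono_AE, rule AE_mp[OF AE_lborel_singleton[of 0]], rule AE_I2, rule impI)
      fix w :: real assume w: "w \<noteq> 0"
      show "ennreal ((norm (F w))\<^sup>2) \<le> ennreal A * indicator {-\<Lambda>..\<Lambda>} w + ennreal (1 / \<kappa>) * (ennreal (1 / w\<^sup>2) * indicator {w. \<bar>w\<bar> \<ge> \<Lambda>} w)"
      proof (cases "\<bar>w\<bar> \<le> \<Lambda>")
        case True
        then have "w \<in> {-\<Lambda>..\<Lambda>}" by auto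
        then show ?thesis using F2[OF w True] by (auto intro: add_increasing2 ennreal_leI)
      next
        case False
        then have "ennreal ((norm (F w))\<^sup>2) \<le> ennreal ((1 / \<kappa>) * (1 / w\<^sup>2))" by (intro ennreal_leI F1 w)
        also have "\<dots> = ennreal (1 / \<kappa>) * ennreal (1 / w\<^sup>2)" using \<kappa> by (intro ennreal_mult) auto
        finally show ?thesis using False by (simp add: add_increasing)
      qed
    qed
    also have "\<dots> = ennreal A * emeasure lborel {-\<Lambda>..\<Lambda>} + ennreal (1 / \<kappa>) * (\<integral>\<^sup>+w. ennreal (1 / w\<^sup>2) * indicator {w. \<bar>w\<bar> \<ge> \<Lambda>} w \<partial>lborel)"
      by (subst nn_integral_add) (auto simp: nn_integral_cmult nn_integral_cmult_indicator)
    also have "\<dots> \<le> ennreal A * ennreal (2 * \<Lambda>) + ennreal (1 / \<kappa>) * ennreal (2 / \<Lambda>)"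
      using \<Lambda> by (intro add_mono mult_left_mono nn_integral_inverse_square_tail) auto
    also have "\<dots> = ennreal (A * (2 * \<Lambda>) + (1 / \<kappa>) * (2 / \<Lambda>))"
      using A0 \<Lambda> \<kappa> by (simp add: ennreal_mult' ennreal_plus flip: ennreal_mult)
    also have "\<dots> \<le> ennreal (K * lam powr (- 1 / ?\<rho>))"
    proof (rule ennreal_leI)
      \<comment> \<open>The low range contributes \<Lambda>^(2\<rho>-1) / \<lambda>^2, of order
        \<lambda>^((2\<rho>-1)/\<rho> - 2) = \<lambda>^(-1/\<rho>).\<close>
      have "\<Lambda> powr (2 * ?\<rho> - 1) \<le> (D * lam powr (1 / ?\<rho>)) powr (2 * ?\<rho> - 1)"
        using \<Lambda> \<Lambda>D \<rho> by (intro powr_mono2) auto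
      also have "\<dots> = D powr (2 * ?\<rho> - 1) * lam powr (1 / ?\<rho> * (2 * ?\<rho> - 1))"
        using D by (simp add: powr_mult powr_powr)
      also have "1 / ?\<rho> * (2 * ?\<rho> - 1) = 2 + (- 1 / ?\<rho>)" using \<rho> by (simp add: field_simps)
      also have "lam powr (2 + (- 1 / ?\<rho>)) = lam\<^sup>2 * lam powr (- 1 / ?\<rho>)"
        unfolding powr_add using lam_pos by (simp add: powr_numeral)
      finally have l1: "\<Lambda> powr (2 * ?\<rho> - 1) \<le> D powr (2 * ?\<rho> - 1) * (lam\<^sup>2 * lam powr (- 1 / ?\<rho>))" .
      have "\<Lambda> powr (2 * ?\<rho> - 2) * \<Lambda> = \<Lambda> powr (2 * ?\<rho> - 1)"
        using \<Lambda> powr_add[of \<Lambda> "2 * ?\<rho> - 2" 1] by simp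
      then have "A * (2 * \<Lambda>) = 2 * \<Lambda> powr (2 * ?\<rho> - 1) / (\<kappa> * c\<^sup>2 * lam\<^sup>2)"
        by (simp add: A_def)
      also have "\<dots> \<le> 2 * (D powr (2 * ?\<rho> - 1) * (lam\<^sup>2 * lam powr (- 1 / ?\<rho>))) / (\<kappa> * c\<^sup>2 * lam\<^sup>2)"
        using l1 \<kappa> by (intro divide_right_mono mult_left_mono) auto
      also have "\<dots> = 2 * D powr (2 * ?\<rho> - 1) / (\<kappa> * c\<^sup>2) * lam powr (- 1 / ?\<rho>)"
        using lam_pos by simp
      finally have a1: "A * (2 * \<Lambda>) \<le> 2 * D powr (2 * ?\<rho> - 1) / (\<kappa> * c\<^sup>2) * lam powr (- 1 / ?\<rho>)" .
      have "1 / \<Lambda> \<le> 1 / lam powr (1 / ?\<rho>)" using \<Lambda> lam_pos by (intro divide_left_mono) auto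
      also have "\<dots> = lam powr (- 1 / ?\<rho>)" by (simp add: powr_minus_divide flip: minus_divide_left)
      finally have "(2 / \<kappa>) * (1 / \<Lambda>) \<le> (2 / \<kappa>) * lam powr (- 1 / ?\<rho>)" using \<kappa> by (intro mult_left_mono) auto
      then show "A * (2 * \<Lambda>) + (1 / \<kappa>) * (2 / \<Lambda>) \<le> K * lam powr (- 1 / ?\<rho>)"
        using a1 unfolding K_def distrib_right by simp
    qed
    finally have N: "(\<integral>\<^sup>+w. ennreal ((norm (F w))\<^sup>2) \<partial>lborel) \<le> ennreal (K * lam powr (- 1 / ?\<rho>))" .
    let ?f = "damped s \<sigma>"
    have f1: "\<bar>?f t\<bar> \<le> 1" for t
    proof (cases "t > 0")
      case True
      then have "exp (- \<sigma> * t) * \<bar>s t\<bar> \<le> 1 * 1" using \<sigma> by (intro mult_mono resolvent_bound) auto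
      then show ?thesis using True by (simp add: damped_def abs_mult)
    qed (simp add: damped_def)
    have fc: "isCont ?f t" if "t \<noteq> 0" for t
    proof (cases "t > 0")
      case True
      then have "eventually (\<lambda>x. x \<in> {0<..}) (nhds t)" by (intro eventually_nhds_in_open) auto
      then have "eventually (\<lambda>x. ?f x = exp (- \<sigma> * x) * s x) (nhds t)"
        by eventually_elim (auto simp: damped_def)
      moreover have "isCont (\<lambda>x. exp (- \<sigma> * x) * s x) t" using s_isCont[OF True] by (intro continuous_intros) auto
      ultimately show ?thesis by (simp add: isCont_cong)
    next
      case False
      then have "eventually (\<lambda>x. x \<in> {..<0}) (nhds t)" using that by (intro eventually_nhds_in_open) auto
      then have "eventually (\<lambda>x. ?f x = 0) (nhds t)" by eventually_elim (auto simp: damped_def)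
      then show ?thesis by (simp add: isCont_cong)
    qed
    have "ennreal (LBINT t. (?f t)\<^sup>2) \<le> ennreal (1 / (2 * pi)) * (\<integral>\<^sup>+w. ennreal ((norm (F w))\<^sup>2) \<partial>lborel)"
      unfolding F_def by (rule plancherel_le[OF integrable_damped_s[OF \<sigma>(1)] f1, of "{0}"]) (use fc in auto)
    also have "\<dots> \<le> 1 * ennreal (K * lam powr (- 1 / ?\<rho>))"
      using pi_gt3 by (intro mult_mono N) auto
    finally have P: "(LBINT t. (?f t)\<^sup>2) \<le> K * lam powr (- 1 / ?\<rho>)"
      using K by (simp add: ennreal_le_iff)
    have f2: "(?f t)\<^sup>2 \<le> \<bar>?f t\<bar>" for t
      using mult_left_mono[OF f1[of t] abs_ge_zero[of "?f t"]] by (simp add: power2_eq_square)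
    have f2i: "integrable lborel (\<lambda>t. (?f t)\<^sup>2)"
      by (rule Bochner_Integration.integrable_bound[OF integrable_damped_s[OF \<sigma>(1)]])
        (use f2 in auto)
    have "(LBINT t. indicator {0<..T} t * (s t)\<^sup>2) \<le> (LBINT t. exp 2 * (?f t)\<^sup>2)"
    proof (rule integral_mono')
      show "integrable lborel (\<lambda>t. exp 2 * (?f t)\<^sup>2)" using f2i by simp
      fix t :: real
      show "indicator {0<..T} t * (s t)\<^sup>2 \<le> exp 2 * (?f t)\<^sup>2"
      proof (cases "t \<in> {0<..T}")
        case True
        have "\<sigma> * t \<le> \<sigma> * T" using True \<sigma> by (intro mult_left_mono) auto
        then have "\<sigma> * t \<le> 1" using \<sigma> by linarith
        then have "1 * (s t)\<^sup>2 \<le> exp (2 + - 2 * \<sigma> * t) * (s t)\<^sup>2" using \<sigma> by (intro mult_right_mono) auto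
        also have "exp (2 + - 2 * \<sigma> * t) = exp 2 * (exp (- \<sigma> * t))\<^sup>2"
          unfolding exp_add power2_eq_square by (simp flip: exp_add)
        finally show ?thesis using True by (simp add: damped_def power_mult_distrib mult.assoc)
      qed simp
    qed simp
    also have "\<dots> = exp 2 * (LBINT t. (?f t)\<^sup>2)" by simp
    also have "\<dots> \<le> exp 2 * (K * lam powr (- 1 / ?\<rho>))" by (intro mult_left_mono P) auto
    finally show "(LBINT t. indicator {0<..T} t * (s t)\<^sup>2) \<le> K * exp 2 * lam powr (- 1 / ?\<rho>)" by (simp add: mult_ac)
  qed
qed

end

section \<open>The Paley--Wiener integral\<close>

text \<open>Riemann-Stieltjes sums for a continuous weight against a merely integrable density. The
  lemma is used for the variances, with weight s^2 and constant density, and for a Brownian path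
  against the derivative of the resolvent, which may be unbounded near 0.\<close>

lemma weighted_riemann_sums:
  fixes w g :: "real \<Rightarrow> real"
  assumes T: "T > 0" and w: "continuous_on {0..T} w" and g: "integrable lborel g"
  defines "t \<equiv> \<lambda>n i. T * real i / real (Suc n)"
  shows "(\<lambda>n. \<Sum>i<Suc n. w (t n (Suc i)) * (LBINT x. indicator {t n i<..t n (Suc i)} x * g x))
    \<longlonglongrightarrow> (LBINT x. indicator {0<..T} x * (w x * g x))"
proof -
  have [measurable]: "g \<in> borel_measurable borel" using g by auto
  have "compact (w ` {0..T})" by (intro compact_continuous_image w) auto
  then obtain K where K: "\<And>x. x \<in> {0..T} \<Longrightarrow> \<bar>w x\<bar> \<le> K"
    using bounded_pos compact_imp_bounded by (metis imageI real_norm_def)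
  define wn where "wn n x = (\<Sum>i<Suc n. w (t n (Suc i)) * indicator {t n i<..t n (Suc i)} x)" for n x
  have t_mem: "t n i \<in> {0..T}" if "i \<le> Suc n" for n i
  proof -
    have "T * real i \<le> T * real (Suc n)" using that T by (intro mult_left_mono) auto
    then show ?thesis using T by (simp add: t_def divide_le_eq del: of_nat_Suc)
  qed
  have t_step: "t n (Suc i) = t n i + T / real (Suc n)" for n i
    unfolding t_def of_nat_Suc[of i] distrib_left add_divide_distrib by simp
  have single: "\<exists>i<Suc n. x \<in> {t n i<..t n (Suc i)} \<and> wn n x = w (t n (Suc i))" if x: "x \<in> {0<..T}" for n x
  proof -
    define y where "y = x * real (Suc n) / T"
    have "x * real (Suc n) \<le> T * real (Suc n)" using x by (intro mult_right_mono) auto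
    then have y: "0 < y" "y \<le> real (Suc n)" using x T by (simp_all add: y_def divide_le_eq mult.commute del: of_nat_Suc)
    \<comment> \<open>The cells are open on the left and closed on the right, so the cell of x has
      index ceiling minus one.\<close>
    define i where "i = nat (\<lceil>y\<rceil> - 1)"
    have c: "1 \<le> \<lceil>y\<rceil>" "\<lceil>y\<rceil> \<le> int (Suc n)" using y by (auto simp: ceiling_le_iff)
    have i: "real i < y" "y \<le> real (Suc i)" "i < Suc n"
      using c ceiling_correct[of y] by (auto simp: i_def)
    have mem: "x \<in> {t n j<..t n (Suc j)} \<longleftrightarrow> real j < y \<and> y \<le> real (Suc j)" for j
      using T unfolding y_def t_def by (auto simp: field_simps simp del: of_nat_Suc)
    have eq: "j = i" if "real j < y" "y \<le> real (Suc j)" for j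
    proof -
      have "real j < real (Suc i)" "real i < real (Suc j)" using that i by linarith+
      then show ?thesis by simp
    qed
    have "wn n x = (\<Sum>j<Suc n. if j = i then w (t n (Suc i)) else 0)"
      unfolding wn_def
    proof (rule sum.cong)
      fix j
      show "w (t n (Suc j)) * indicator {t n j<..t n (Suc j)} x = (if j = i then w (t n (Suc i)) else 0)"
        using mem[of j] eq[of j] i by (auto simp: indicator_def)
    qed simp
    also have "\<dots> = w (t n (Suc i))" using i(3) by (simp add: sum.delta)
    finally show ?thesis using mem[of i] i by blast
  qed
  have out: "wn n x = 0" if "x \<notin> {0<..T}" for n x
    unfolding wn_def
  proof (intro sum.neutral ballI)
    fix i assume "i \<in> {..<Suc n}"
    then have "0 \<le> t n i" "t n (Suc i) \<le> T" using t_mem[of i n] t_mem[of "Suc i" n] by auto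
    then show "w (t n (Suc i)) * indicator {t n i<..t n (Suc i)} x = 0" using that by (auto simp: indicator_def)
  qed
  have [measurable]: "wn n \<in> borel_measurable borel" for n unfolding wn_def by measurable
  have bnd: "\<bar>wn n x\<bar> \<le> max K 0" for n x
  proof (cases "x \<in> {0<..T}")
    case True
    then obtain i where "i < Suc n" "wn n x = w (t n (Suc i))" using single by blast
    then show ?thesis using K[OF t_mem[of "Suc i" n]] by auto
  qed (simp add: out)
  have i0: "integrable lborel (\<lambda>x. indicator {t n i<..t n (Suc i)} x * g x)" for n i
    using integrable_mult_indicator[OF _ g, of "{t n i<..t n (Suc i)}"] by simp
  have "(\<Sum>i<Suc n. w (t n (Suc i)) * (LBINT x. indicator {t n i<..t n (Suc i)} x * g x)) = (LBINT x. wn n x * g x)" for n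
  proof -
    have "(LBINT x. wn n x * g x) = (LBINT x. \<Sum>i<Suc n. w (t n (Suc i)) * (indicator {t n i<..t n (Suc i)} x * g x))"
      unfolding wn_def sum_distrib_right by (simp only: mult.assoc)
    also have "\<dots> = (\<Sum>i<Suc n. LBINT x. w (t n (Suc i)) * (indicator {t n i<..t n (Suc i)} x * g x))"
      by (intro Bochner_Integration.integral_sum integrable_mult_right i0)
    finally show ?thesis by (simp only: integral_mult_right_zero)
  qed
  moreover have "(\<lambda>n. LBINT x. wn n x * g x) \<longlonglongrightarrow> (LBINT x. indicator {0<..T} x * (w x * g x))"
  proof (rule integral_dominated_convergence[where w = "\<lambda>x. max K 0 * \<bar>g x\<bar>"])
    have "(\<lambda>x. indicator {0<..T} x *\<^sub>R w x) \<in> borel_measurable borel"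
      by (intro borel_measurable_continuous_on_indicator continuous_on_subset[OF w]) auto
    then have "(\<lambda>x. (indicator {0<..T} x *\<^sub>R w x) * g x) \<in> borel_measurable borel" by measurable
    then show "(\<lambda>x. indicator {0<..T} x * (w x * g x)) \<in> borel_measurable lborel" by (simp add: mult.assoc)
    show "AE x in lborel. norm (wn n x * g x) \<le> max K 0 * \<bar>g x\<bar>" for n
      using bnd by (auto simp: abs_mult intro!: mult_right_mono)
    show "AE x in lborel. (\<lambda>n. wn n x * g x) \<longlonglongrightarrow> indicator {0<..T} x * (w x * g x)"
    proof (rule AE_I2)
      fix x :: real
      show "(\<lambda>n. wn n x * g x) \<longlonglongrightarrow> indicator {0<..T} x * (w x * g x)"
      proof (cases "x \<in> {0<..T}")
        case True
        \<comment> \<open>The right endpoint of the cell containing x; it tends to x, and continuity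
          of \<open>w\<close> gives pointwise convergence.\<close>
        define r where "r n = t n (Suc (SOME i. i < Suc n \<and> x \<in> {t n i<..t n (Suc i)} \<and> wn n x = w (t n (Suc i))))" for n
        have r: "wn n x = w (r n)" "x \<le> r n" "r n \<le> x + T / real (Suc n)" "r n \<in> {0..T}" for n
        proof -
          let ?i = "SOME i. i < Suc n \<and> x \<in> {t n i<..t n (Suc i)} \<and> wn n x = w (t n (Suc i))"
          have i: "?i < Suc n \<and> x \<in> {t n ?i<..t n (Suc ?i)} \<and> wn n x = w (t n (Suc ?i))"
            by (rule someI_ex) (use single[OF True, of n] in blast)
          then show "wn n x = w (r n)" "x \<le> r n" unfolding r_def by auto
          show "r n \<le> x + T / real (Suc n)" using i unfolding r_def t_step by auto
          show "r n \<in> {0..T}" unfolding r_def by (rule t_mem) (use i in auto)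
        qed
        have "r \<longlonglongrightarrow> x"
        proof (rule tendsto_sandwich[where f = "\<lambda>_. x" and h = "\<lambda>n. x + T / real (Suc n)"])
          have "(\<lambda>n. x + T * (1 / real (Suc n))) \<longlonglongrightarrow> x + T * 0"
            by (intro tendsto_intros LIMSEQ_Suc[OF lim_1_over_n])
          then show "(\<lambda>n. x + T / real (Suc n)) \<longlonglongrightarrow> x" by simp
        qed (use r in auto)
        then have "(\<lambda>n. w (r n)) \<longlonglongrightarrow> w x"
          using w True r(4) by (intro continuous_on_tendsto_compose[OF w]) auto
        then have "(\<lambda>n. w (r n) * g x) \<longlonglongrightarrow> w x * g x" by (rule tendsto_mult_right)
        then show ?thesis using True r(1) by simp
      qed (simp add: out)
    qed
    show "integrable lborel (\<lambda>x. max K 0 * \<bar>g x\<bar>)" using g by simp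
  qed measurable
  ultimately show ?thesis by simp
qed

text \<open>Fatou applied to \<open>2 (1 - cos (\<theta> x)) / \<theta>\<^sup>2 \<longrightarrow> x\<^sup>2\<close> as \<open>\<theta> \<longrightarrow> 0\<close>.\<close>
lemma (in prob_space) second_moment_le_of_char:
  assumes [measurable]: "X \<in> borel_measurable M"
    and char: "\<And>\<theta>. (LINT \<omega>|M. cis (\<theta> * X \<omega>)) = complex_of_real (exp (- (\<theta>\<^sup>2 * v) / 2))"
  shows "(\<integral>\<^sup>+\<omega>. ennreal ((X \<omega>)\<^sup>2) \<partial>M) \<le> ennreal v"
proof -
  define f where "f n x = 2 * (1 - cos (x / real (Suc n))) * (real (Suc n))\<^sup>2" for n and x :: real
  have f0: "f n x \<ge> 0" for n x by (simp add: f_def)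
  have lim: "(\<lambda>n. f n x) \<longlonglongrightarrow> x\<^sup>2" for x
  proof -
    define u where "u n = x / real (Suc n) / 2" for n
    have u0: "u \<longlonglongrightarrow> 0"
    proof -
      have "(\<lambda>n. x / 2 * (1 / real (Suc n))) \<longlonglongrightarrow> x / 2 * 0"
        by (intro tendsto_intros LIMSEQ_Suc[OF lim_1_over_n])
      moreover have "u = (\<lambda>n. x / 2 * (1 / real (Suc n)))" by (simp add: u_def fun_eq_iff mult.commute)
      ultimately show ?thesis by simp
    qed
    \<comment> \<open>The half-angle formula writes \<open>f n x\<close> as x^2 (sin u / u)^2 with u
      \<longrightarrow> 0.\<close>
    have e: "f n x = x\<^sup>2 * (if u n = 0 then 1 else sin (u n) / u n)\<^sup>2" for n
    proof (cases "x = 0")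
      case False
      have "1 - cos (x / real (Suc n)) = 2 * (sin (u n))\<^sup>2"
      proof -
        have "2 * u n = x / real (Suc n)" by (simp add: u_def del: of_nat_Suc)
        then show ?thesis using cos_double_sin[of "u n"] by (simp only:)
      qed
      then have "f n x = 2 * (2 * (sin (u n))\<^sup>2) * (real (Suc n))\<^sup>2" by (simp only: f_def)
      moreover have u: "u n \<noteq> 0" using False by (simp add: u_def del: of_nat_Suc)
      then have "2 * (2 * (sin (u n))\<^sup>2) * (real (Suc n))\<^sup>2 = (2 * u n * real (Suc n))\<^sup>2 * (sin (u n) / u n)\<^sup>2"
        by (simp add: power_mult_distrib power_divide del: of_nat_Suc)
      moreover have "2 * u n * real (Suc n) = x" by (simp add: u_def del: of_nat_Suc)
      ultimately show ?thesis using u by simp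
    qed (simp add: f_def)
    have "((\<lambda>y::real. if y = 0 then 1 else sin y / y) \<longlongrightarrow> 1) (nhds 0)"
    proof -
      have "((\<lambda>y::real. sin y / y) \<longlongrightarrow> 1) (at 0)"
        using DERIV_sin[of "0::real"] by (simp add: DERIV_def)
      then have "((\<lambda>y::real. if y = 0 then 1 else sin y / y) \<longlongrightarrow> 1) (at 0)"
        by (rule Lim_transform_eventually) (auto simp: eventually_at_filter)
      then show ?thesis by (simp add: tendsto_nhds_iff)
    qed
    then have "(\<lambda>n. if u n = 0 then 1 else sin (u n) / u n) \<longlonglongrightarrow> 1"
      by (rule filterlim_compose) (rule u0)
    then have "(\<lambda>n. x\<^sup>2 * (if u n = 0 then 1 else sin (u n) / u n)\<^sup>2) \<longlonglongrightarrow> x\<^sup>2 * 1\<^sup>2"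
      by (intro tendsto_intros)
    then show ?thesis by (simp add: e)
  qed
  have E: "(\<integral>\<^sup>+\<omega>. ennreal (f n (X \<omega>)) \<partial>M) \<le> ennreal v" for n
  proof -
    define \<theta> where "\<theta> = 1 / real (Suc n)"
    have ic: "integrable M (\<lambda>\<omega>. cis (\<theta> * X \<omega>))"
      by (rule integrable_const_bound[where B = 1]) (auto simp: cis_conv_exp)
    have ir: "integrable M (\<lambda>\<omega>. cos (\<theta> * X \<omega>))"
      using integrable_Re[OF ic] by simp
    have er: "(LINT \<omega>|M. cos (\<theta> * X \<omega>)) = exp (- (\<theta>\<^sup>2 * v) / 2)"
      using integral_Re[OF ic] char[of \<theta>] by simp
    have fe: "f n (X \<omega>) = 2 / \<theta>\<^sup>2 * (1 - cos (\<theta> * X \<omega>))" for \<omega>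
      by (simp add: f_def \<theta>_def power_divide)
    have "(\<integral>\<^sup>+\<omega>. ennreal (f n (X \<omega>)) \<partial>M) = ennreal (LINT \<omega>|M. f n (X \<omega>))"
      using ir f0 by (intro nn_integral_eq_integral) (auto simp: fe)
    also have "(LINT \<omega>|M. f n (X \<omega>)) = 2 / \<theta>\<^sup>2 * (1 - exp (- (\<theta>\<^sup>2 * v) / 2))"
      unfolding fe using ir er prob_space by simp
    \<comment> \<open>From 1 - exp(-y) \<le> y; this bounds every approximant by \<open>v\<close>
      before any limit is taken.\<close>
    also have "\<dots> \<le> 2 / \<theta>\<^sup>2 * (\<theta>\<^sup>2 * v / 2)"
      using exp_ge_add_one_self[of "- (\<theta>\<^sup>2 * v) / 2"] by (intro mult_left_mono) auto
    also have "\<dots> = v" by (simp add: \<theta>_def)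
    finally show ?thesis by (simp add: ennreal_leI)
  qed
  have "(\<integral>\<^sup>+\<omega>. ennreal ((X \<omega>)\<^sup>2) \<partial>M) = (\<integral>\<^sup>+\<omega>. liminf (\<lambda>n. ennreal (f n (X \<omega>))) \<partial>M)"
    by (intro nn_integral_cong lim_imp_Liminf[symmetric] tendsto_ennrealI lim) auto
  also have "\<dots> \<le> liminf (\<lambda>n. \<integral>\<^sup>+\<omega>. ennreal (f n (X \<omega>)) \<partial>M)"
    unfolding f_def by (intro nn_integral_liminf) measurable
  also have "\<dots> \<le> liminf (\<lambda>n. ennreal v)"
    by (intro Liminf_mono always_eventually allI E)
  also have "\<dots> = ennreal v" by (simp add: Liminf_const)
  finally show ?thesis .
qed

text \<open>A discrete form of the independence of Brownian increments. The minimum counts the k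
  with k \<le> i and k \<le> j, so the form is a sum of squares over k, and each square telescopes
  to \<open>a k\<close> because \<open>a n = 0\<close>.\<close>

lemma quadratic_form_min:
  fixes a :: "nat \<Rightarrow> real"
  assumes "a n = 0"
  shows "(\<Sum>i<n. \<Sum>j<n. (a i - a (Suc i)) * (a j - a (Suc j)) * real (min (Suc i) (Suc j))) = (\<Sum>k<n. (a k)\<^sup>2)"
proof -
  let ?c = "\<lambda>i k. (a i - a (Suc i)) * (if k \<le> i then 1 else 0)"
  have m: "real (min (Suc i) (Suc j)) = (\<Sum>k<n. (if k \<le> i then 1 else 0) * (if k \<le> j then 1 else 0))" if "i < n" "j < n" for i j
  proof -
    have "(\<Sum>k<n. (if k \<le> i then 1 else 0) * (if k \<le> j then 1 else 0)) = (\<Sum>k<n. if k \<in> {..min i j} then 1 else (0::real))"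
      by (intro sum.cong) auto
    also have "\<dots> = (\<Sum>k\<in>{..<n} \<inter> {..min i j}. 1)" by (rule sum.inter_restrict[symmetric]) simp
    also have "{..<n} \<inter> {..min i j} = {..min i j}" using that by auto
    finally show ?thesis by simp
  qed
  have tail: "(\<Sum>i<n. ?c i k) = a k" if "k < n" for k
  proof -
    have "(\<Sum>i<n. ?c i k) = (\<Sum>i=k..<n. a i - a (Suc i))"
      by (rule sum.mono_neutral_cong_right) auto
    also have "\<dots> = a k - a n" using sum_Suc_diff'[of k n a] that by (simp add: sum_subtractf)
    finally show ?thesis by (simp add: assms)
  qed
  have "(\<Sum>i<n. \<Sum>j<n. (a i - a (Suc i)) * (a j - a (Suc j)) * real (min (Suc i) (Suc j)))
    = (\<Sum>i<n. \<Sum>j<n. \<Sum>k<n. ?c i k * ?c j k)"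
  proof (intro sum.cong refl)
    fix i j assume "i \<in> {..<n}" "j \<in> {..<n}"
    then have ij: "i < n" "j < n" by auto
    show "(a i - a (Suc i)) * (a j - a (Suc j)) * real (min (Suc i) (Suc j))
      = (\<Sum>k<n. ?c i k * ?c j k)"
      unfolding m[OF ij] sum_distrib_left by (intro sum.cong) (auto simp: mult_ac)
  qed
  also have "\<dots> = (\<Sum>i<n. \<Sum>k<n. \<Sum>j<n. ?c i k * ?c j k)"
    by (intro sum.cong refl sum.swap)
  also have "\<dots> = (\<Sum>k<n. \<Sum>i<n. \<Sum>j<n. ?c i k * ?c j k)"
    by (rule sum.swap)
  also have "\<dots> = (\<Sum>k<n. (\<Sum>i<n. ?c i k) * (\<Sum>j<n. ?c j k))"
    by (simp only: sum_product)
  also have "\<dots> = (\<Sum>k<n. (a k)\<^sup>2)" by (intro sum.cong refl) (simp add: tail power2_eq_square)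
  finally show ?thesis .
qed

text \<open>The discretisations are \<open>X n = \<Sum>i. s (T - t i) (W (t (i+1)) - W (t i))\<close>, rewritten by
  summation by parts so that no value at time 0 occurs.\<close>
lemma paley_wiener_second_moment:
  assumes M: "prob_space M" and W: "cyl_Q_wiener M Q W" and T: "T \<ge> 0"
    and Qh: "Q h \<bullet> h \<ge> 0"
    and s0: "s 0 = 1" and sc: "continuous_on {0..T} s"
    and sd: "\<And>u. 0 < u \<Longrightarrow> u < T \<Longrightarrow> (s has_real_derivative d u) (at u)"
    and di: "integrable lborel (\<lambda>u. indicator {0<..<T} u * d u)"
  obtains Y where "Y \<in> borel_measurable M"
    "AE \<omega> in M. ennreal ((W T h \<omega> + (LBINT \<tau>=0..T. W \<tau> h \<omega> * deriv s (T - \<tau>)))\<^sup>2) \<le> Y \<omega>"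
    "(\<integral>\<^sup>+\<omega>. Y \<omega> \<partial>M) \<le> ennreal ((Q h \<bullet> h) * (LBINT u. indicator {0<..T} u * (s u)\<^sup>2))"
proof -
  interpret prob_space M by (rule M)
  let ?Z = "\<lambda>\<omega>. W T h \<omega> + (LBINT \<tau>=0..T. W \<tau> h \<omega> * deriv s (T - \<tau>))"
  let ?V = "(Q h \<bullet> h) * (LBINT u. indicator {0<..T} u * (s u)\<^sup>2)"
  have Wm[measurable]: "W t h \<in> borel_measurable M" for t using W by (auto simp: cyl_Q_wiener_def)
  have Wchar: "(LINT \<omega>|M. cis (\<Sum>i<n. c i * W (ts i) h \<omega>)) =
      complex_of_real (exp (- (\<Sum>i<n. \<Sum>j<n. c i * c j * min (ts i) (ts j) * (Q h \<bullet> h)) / 2))"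
    if "\<And>i. i < n \<Longrightarrow> 0 \<le> ts i" for n :: nat and c ts
    using W that unfolding cyl_Q_wiener_def by (elim conjE allE[of _ n] allE[of _ c] allE[of _ ts] allE[of _ "\<lambda>_. h"]) auto
  have Wc: "AE \<omega> in M. continuous_on {0..} (\<lambda>t. W t h \<omega>)" using W by (auto simp: cyl_Q_wiener_def)
  show thesis
  proof (cases "T = 0")
    case True
    show thesis
    \<comment> \<open>At time 0 the path integral is empty, and the characteristic function forces
      W(0) to have second moment 0.\<close>
    proof (rule that[of "\<lambda>\<omega>. ennreal ((W 0 h \<omega>)\<^sup>2)"])
      have "(\<integral>\<^sup>+\<omega>. ennreal ((W 0 h \<omega>)\<^sup>2) \<partial>M) \<le> ennreal 0"
      proof (rule second_moment_le_of_char)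
        show "(LINT \<omega>|M. cis (\<theta> * W 0 h \<omega>)) = complex_of_real (exp (- (\<theta>\<^sup>2 * 0) / 2))" for \<theta>
          using Wchar[of 1 "\<lambda>_. 0" "\<lambda>_. \<theta>"] by simp
      qed measurable
      then show "(\<integral>\<^sup>+\<omega>. ennreal ((W 0 h \<omega>)\<^sup>2) \<partial>M) \<le> ennreal ?V"
        by (simp add: True)
    qed (simp_all add: True zero_ereal_def)
  next
    case False
    then have Tp: "T > 0" using T by simp
    define t where "t n i = T * real i / real (Suc n)" for n i :: nat
    \<comment> \<open>The value 0 after the last node, in place of \<open>s 0\<close>, is the end
      condition of \<open>quadratic_form_min\<close>; it also produces the boundary term at
      \<open>T\<close> below.\<close>
    define a where "a n i = (if i < Suc n then s (T - t n i) else 0)" for n i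
    define X where "X n \<omega> = (\<Sum>i<Suc n. (a n i - a n (Suc i)) * W (t n (Suc i)) h \<omega>)" for n \<omega>
    \<comment> \<open>The variance of \<open>X n\<close>, a Riemann sum for the integral of
      s^2.\<close>
    define v where "v n = (Q h \<bullet> h) * (T / real (Suc n) * (\<Sum>k<Suc n. (a n k)\<^sup>2))" for n
    have [measurable]: "X n \<in> borel_measurable M" for n unfolding X_def by measurable
    have tT: "t n (Suc n) = T" for n by (simp add: t_def)
    have t0: "0 \<le> t n i" for n i using T by (simp add: t_def)
    have tle: "t n i \<le> T" if "i \<le> Suc n" for n i
    proof -
      have "T * real i \<le> T * real (Suc n)" using that T by (intro mult_left_mono) auto
      then show ?thesis by (simp add: t_def divide_le_eq del: of_nat_Suc)
    qed
    have X2: "(\<integral>\<^sup>+\<omega>. ennreal ((X n \<omega>)\<^sup>2) \<partial>M) \<le> ennreal (v n)" for n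
    proof (rule second_moment_le_of_char)
      fix \<theta> :: real
      define c where "c i = \<theta> * (a n i - a n (Suc i))" for i
      have "(\<Sum>i<Suc n. \<Sum>j<Suc n. c i * c j * min (t n (Suc i)) (t n (Suc j)) * (Q h \<bullet> h))
         = (\<Sum>i<Suc n. \<Sum>j<Suc n. \<theta>\<^sup>2 * (Q h \<bullet> h) * (T / real (Suc n)) * ((a n i - a n (Suc i)) * (a n j - a n (Suc j)) * real (min (Suc i) (Suc j))))"
      proof (intro sum.cong refl)
        fix i j
        have "min (t n (Suc i)) (t n (Suc j)) = T / real (Suc n) * real (min (Suc i) (Suc j))"
        proof -
          define c0 where "c0 = T / real (Suc n)"
          have "t n k = c0 * real k" for k by (simp add: t_def c0_def)
          moreover have "c0 > 0" using Tp by (simp add: c0_def)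
          ultimately show ?thesis unfolding c0_def[symmetric] by (simp add: min_def)
        qed
        then show "c i * c j * min (t n (Suc i)) (t n (Suc j)) * (Q h \<bullet> h)
          = \<theta>\<^sup>2 * (Q h \<bullet> h) * (T / real (Suc n)) * ((a n i - a n (Suc i)) * (a n j - a n (Suc j)) * real (min (Suc i) (Suc j)))"
          by (simp only: c_def power2_eq_square mult_ac)
      qed
      also have "\<dots> = \<theta>\<^sup>2 * (Q h \<bullet> h) * (T / real (Suc n)) * (\<Sum>k<Suc n. (a n k)\<^sup>2)"
        unfolding sum_distrib_left[symmetric] by (subst quadratic_form_min) (simp_all add: a_def)
      also have "\<dots> = \<theta>\<^sup>2 * v n" by (simp only: v_def mult_ac)
      finally have e: "(\<Sum>i<Suc n. \<Sum>j<Suc n. c i * c j * min (t n (Suc i)) (t n (Suc j)) * (Q h \<bullet> h)) = \<theta>\<^sup>2 * v n" .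
      have "\<theta> * X n \<omega> = (\<Sum>i<Suc n. c i * W (t n (Suc i)) h \<omega>)" for \<omega>
        unfolding X_def c_def sum_distrib_left by (simp only: mult.assoc)
      then show "(LINT \<omega>|M. cis (\<theta> * X n \<omega>)) = complex_of_real (exp (- (\<theta>\<^sup>2 * v n) / 2))"
        using Wchar[of "Suc n" "\<lambda>i. t n (Suc i)" c] t0 e by (simp only:)
    qed measurable
    have vlim: "v \<longlonglongrightarrow> (Q h \<bullet> h) * (LBINT u. indicator {0<..T} u * (s u)\<^sup>2)"
    proof -
      have ii: "integrable lborel (indicat_real {0<..T})" by (rule integrable_real_indicator) (use T in auto)
      have "(\<lambda>n. \<Sum>i<Suc n. (s (t n (Suc i)))\<^sup>2 * (LBINT x. indicator {t n i<..t n (Suc i)} x * indicat_real {0<..T} x))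
        \<longlonglongrightarrow> (LBINT x. indicator {0<..T} x * ((s x)\<^sup>2 * indicat_real {0<..T} x))"
        unfolding t_def by (rule weighted_riemann_sums[OF Tp _ ii]) (intro continuous_intros sc)
      also have "(LBINT x. indicator {0<..T} x * ((s x)\<^sup>2 * indicat_real {0<..T} x)) = (LBINT u. indicator {0<..T} u * (s u)\<^sup>2)"
        by (rule Bochner_Integration.integral_cong) (auto simp: indicator_def)
      also have "(\<lambda>n. \<Sum>i<Suc n. (s (t n (Suc i)))\<^sup>2 * (LBINT x. indicator {t n i<..t n (Suc i)} x * indicat_real {0<..T} x))
         = (\<lambda>n. T / real (Suc n) * (\<Sum>k<Suc n. (a n k)\<^sup>2))"
      proof
        fix n
        have "(LBINT x. indicator {t n i<..t n (Suc i)} x * indicat_real {0<..T} x) = T / real (Suc n)" if "i < Suc n" for i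
        proof -
          have "(LBINT x. indicator {t n i<..t n (Suc i)} x * indicat_real {0<..T} x) = (LBINT x. indicator {t n i<..t n (Suc i)} x)"
            by (rule Bochner_Integration.integral_cong) (use t0[of n i] tle[of "Suc i" n] that in \<open>auto simp: indicator_def\<close>)
          also have "\<dots> = t n (Suc i) - t n i" using T by (simp add: t_def divide_right_mono mult_left_mono)
          also have "\<dots> = T / real (Suc n)"
            unfolding t_def of_nat_Suc[of i] distrib_left add_divide_distrib by simp
          finally show ?thesis .
        qed
        then have "(\<Sum>i<Suc n. (s (t n (Suc i)))\<^sup>2 * (LBINT x. indicator {t n i<..t n (Suc i)} x * indicat_real {0<..T} x))
          = (\<Sum>i<Suc n. (s (t n (Suc i)))\<^sup>2 * (T / real (Suc n)))" by (intro sum.cong) auto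
        also have "\<dots> = T / real (Suc n) * (\<Sum>i<Suc n. (s (t n (Suc i)))\<^sup>2)" by (simp only: sum_distrib_left mult.commute)
        \<comment> \<open>Time reversal matches the right endpoints of the cells with the nodes T -
          t k at which \<open>a\<close> samples \<open>s\<close>.\<close>
        also have "(\<Sum>i<Suc n. (s (t n (Suc i)))\<^sup>2) = (\<Sum>k<Suc n. (s (t n (Suc (n - k))))\<^sup>2)"
          using sum.nat_diff_reindex[of "\<lambda>i. (s (t n (Suc i)))\<^sup>2" "Suc n"] by simp
        also have "\<dots> = (\<Sum>k<Suc n. (a n k)\<^sup>2)"
        proof (intro sum.cong refl)
          fix k assume "k \<in> {..<Suc n}"
          then have "real (Suc (n - k)) = real (Suc n) - real k" by (simp add: of_nat_diff)
          then have "t n (Suc (n - k)) = T - t n k" unfolding t_def by (simp add: field_simps)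
          then show "(s (t n (Suc (n - k))))\<^sup>2 = (a n k)\<^sup>2" using \<open>k \<in> {..<Suc n}\<close> by (simp add: a_def)
        qed
        finally show "(\<Sum>i<Suc n. (s (t n (Suc i)))\<^sup>2 * (LBINT x. indicator {t n i<..t n (Suc i)} x * indicat_real {0<..T} x))
          = T / real (Suc n) * (\<Sum>k<Suc n. (a n k)\<^sup>2)" .
      qed
      finally show ?thesis unfolding v_def by (intro tendsto_mult_left)
    qed
    \<comment> \<open>The derivative of -s(T - \<tau>), cut to the open interval where
      \<open>s\<close> is known to be differentiable; over one cell it integrates to the increment
      of -s(T - \<tau>).\<close>
    define g where "g \<tau> = indicator {0<..<T} (T - \<tau>) * d (T - \<tau>)" for \<tau>
    let ?I = "\<lambda>n i. LBINT x. indicator {t n i<..t n (Suc i)} x * g x"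
    have gi: "integrable lborel g"
      unfolding g_def using lborel_integrable_real_affine[OF di, of "-1" T] by simp
    have inc: "?I n i = s (T - t n i) - s (T - t n (Suc i))" if "i < Suc n" for n i
    proof -
      have le: "t n i \<le> t n (Suc i)" using T by (simp add: t_def divide_right_mono mult_left_mono)
      have b: "0 \<le> t n i" "t n (Suc i) \<le> T" using t0[of n i] tle[of "Suc i" n] that by auto
      have "((\<lambda>\<tau>. g \<tau>) has_integral (- s (T - t n (Suc i)) - (- s (T - t n i)))) {t n i..t n (Suc i)}"
      proof (rule fundamental_theorem_of_calculus_interior[OF le])
        show "continuous_on {t n i..t n (Suc i)} (\<lambda>\<tau>. - s (T - \<tau>))"
          by (intro continuous_intros continuous_on_compose2[OF sc]) (use b in auto)
        fix x assume x: "x \<in> {t n i<..<t n (Suc i)}"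
        have "((\<lambda>\<tau>. - s (T - \<tau>)) has_real_derivative d (T - x)) (at x)"
        proof -
          have "(s has_real_derivative d (T - x)) (at (T - x))" using x b by (intro sd) auto
          moreover have "((\<lambda>\<tau>. T - \<tau>) has_real_derivative - 1) (at x)" by (auto intro!: derivative_eq_intros)
          ultimately have "((\<lambda>\<tau>. s (T - \<tau>)) has_real_derivative d (T - x) * - 1) (at x)"
            by (rule DERIV_chain2)
          then show ?thesis using DERIV_minus by fastforce
        qed
        moreover have "g x = d (T - x)" using x b by (simp add: g_def)
        ultimately show "((\<lambda>\<tau>. - s (T - \<tau>)) has_vector_derivative g x) (at x)"
          by (simp add: has_real_derivative_iff_has_vector_derivative)
      qed
      then have I1: "(g has_integral (s (T - t n i) - s (T - t n (Suc i)))) {t n i..t n (Suc i)}" by simp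
      have "integrable lborel (\<lambda>x. indicator {t n i<..t n (Suc i)} x * g x)"
        using integrable_mult_indicator[OF _ gi, of "{t n i<..t n (Suc i)}"] by simp
      then have "((\<lambda>x. indicator {t n i<..t n (Suc i)} x * g x) has_integral ?I n i) UNIV"
        by (rule has_integral_integral_lborel)
      moreover have "((\<lambda>x. if x \<in> {t n i..t n (Suc i)} then g x else 0) has_integral (s (T - t n i) - s (T - t n (Suc i)))) UNIV"
        using I1 by (simp only: has_integral_restrict_UNIV)
      then have "((\<lambda>x. indicator {t n i<..t n (Suc i)} x * g x) has_integral (s (T - t n i) - s (T - t n (Suc i)))) UNIV"
        by (rule has_integral_spike_finite[where S = "{t n i}", rotated 2]) auto
      ultimately show ?thesis by (rule has_integral_unique)
    qed
    have Xlim: "(\<lambda>n. X n \<omega>) \<longlonglongrightarrow> ?Z \<omega>"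
      if cont: "continuous_on {0..} (\<lambda>t. W t h \<omega>)" for \<omega>
    proof -
      have "(\<lambda>n. \<Sum>i<Suc n. W (t n (Suc i)) h \<omega> * ?I n i)
        \<longlonglongrightarrow> (LBINT x. indicator {0<..T} x * (W x h \<omega> * g x))"
        unfolding t_def by (rule weighted_riemann_sums[OF Tp _ gi]) (rule continuous_on_subset[OF cont], auto)
      moreover have "X n \<omega> = W T h \<omega> + (\<Sum>i<Suc n. W (t n (Suc i)) h \<omega> * ?I n i)" for n
      proof -
        \<comment> \<open>In the last summand \<open>a\<close> drops to 0 instead of
          \<open>s 0 = 1\<close>, and the surplus 1 yields \<open>W T h\<close>.\<close>
        have "X n \<omega> = (\<Sum>i<Suc n. (if i = n then W T h \<omega> else 0) + W (t n (Suc i)) h \<omega> * ?I n i)"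
          unfolding X_def
        proof (intro sum.cong refl)
          fix i assume i: "i \<in> {..<Suc n}"
          then have "i < Suc n" by simp
          show "(a n i - a n (Suc i)) * W (t n (Suc i)) h \<omega>
             = (if i = n then W T h \<omega> else 0) + W (t n (Suc i)) h \<omega> * ?I n i"
            unfolding inc[OF \<open>i < Suc n\<close>] using i by (auto simp: a_def tT s0 algebra_simps)
        qed
        also have "\<dots> = W T h \<omega> + (\<Sum>i<Suc n. W (t n (Suc i)) h \<omega> * ?I n i)"
          by (simp only: sum.distrib sum.delta finite_lessThan) simp
        finally show ?thesis .
      qed
      moreover have "(LBINT x. indicator {0<..T} x * (W x h \<omega> * g x)) = (LBINT \<tau>=0..T. W \<tau> h \<omega> * deriv s (T - \<tau>))"
      proof -
        have "(LBINT x. indicator {0<..T} x * (W x h \<omega> * g x)) = (LBINT x. indicator {0<..<T} x *\<^sub>R (W x h \<omega> * deriv s (T - x)))"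
        proof (rule Bochner_Integration.integral_cong)
          fix x :: real
          have "deriv s (T - x) = d (T - x)" if "0 < x" "x < T"
            by (rule DERIV_imp_deriv, rule sd) (use that in auto)
          then show "indicator {0<..T} x * (W x h \<omega> * g x) = indicator {0<..<T} x *\<^sub>R (W x h \<omega> * deriv s (T - x))"
            by (auto simp: indicator_def g_def)
        qed simp
        then show ?thesis using Tp by (simp add: interval_lebesgue_integral_def set_lebesgue_integral_def zero_ereal_def)
      qed
      ultimately show ?thesis using tendsto_add[OF tendsto_const] by (simp only:)
    qed
    show thesis
    \<comment> \<open>The pathwise integral is only an almost sure limit of the \<open>X n\<close>.
      The lower limit supplies a measurable majorant of its square, to which Fatou applies.\<close>
    proof (rule that[of "\<lambda>\<omega>. liminf (\<lambda>n. ennreal ((X n \<omega>)\<^sup>2))"])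
      show "AE \<omega> in M. ennreal ((?Z \<omega>)\<^sup>2) \<le> liminf (\<lambda>n. ennreal ((X n \<omega>)\<^sup>2))"
        using Wc
      proof eventually_elim
        case (elim \<omega>)
        have "(\<lambda>n. ennreal ((X n \<omega>)\<^sup>2)) \<longlonglongrightarrow> ennreal ((?Z \<omega>)\<^sup>2)"
          by (intro tendsto_ennrealI tendsto_power Xlim elim)
        then show ?case by (subst lim_imp_Liminf) auto
      qed
      have "(\<integral>\<^sup>+\<omega>. liminf (\<lambda>n. ennreal ((X n \<omega>)\<^sup>2)) \<partial>M) \<le> liminf (\<lambda>n. \<integral>\<^sup>+\<omega>. ennreal ((X n \<omega>)\<^sup>2) \<partial>M)"
        by (intro nn_integral_liminf) measurable
      also have "\<dots> \<le> liminf (\<lambda>n. ennreal (v n))" by (intro Liminf_mono always_eventually allI X2)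
      also have "\<dots> = ennreal ?V"
        by (intro lim_imp_Liminf tendsto_ennrealI vlim) simp
      finally show "(\<integral>\<^sup>+\<omega>. liminf (\<lambda>n. ennreal ((X n \<omega>)\<^sup>2)) \<partial>M) \<le> ennreal ?V" .
    qed measurable
  qed
qed

section \<open>The mild solution\<close>

lemma (in resolvent) stoch_conv_second_moment:
  assumes M: "prob_space M" and W: "cyl_Q_wiener M Q W" and T: "T \<ge> 0" and Qh: "Q h \<bullet> h \<ge> 0"
  obtains Y where "Y \<in> borel_measurable M"
    "AE \<omega> in M. ennreal ((W T h \<omega> + (LBINT \<tau>=0..T. W \<tau> h \<omega> * deriv s (T - \<tau>)))\<^sup>2) \<le> Y \<omega>"
    "(\<integral>\<^sup>+\<omega>. Y \<omega> \<partial>M) \<le> ennreal ((Q h \<bullet> h) * (LBINT u. indicator {0<..T} u * (s u)\<^sup>2))"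
proof (rule paley_wiener_second_moment[where s = s and d = "\<lambda>u. - lam * bs u", OF M W T Qh s_0])
  show "continuous_on {0..T} s" by (rule continuous_on_subset[OF s_cont]) auto
  show "(s has_real_derivative - lam * bs u) (at u)" if "0 < u" "u < T" for u
    using s_deriv[of u] that at_within_interior[of u "{0..}"] by (simp add: bs_def)
  \<comment> \<open>The derivative of \<open>s\<close> is integrable near 0 since it is a multiple
    of exp(u) H(u), where H is a convolution of integrable functions. Any \<sigma> > 0 would do;
    here \<sigma> = 1, and undoing the damping costs at most \<open>exp T\<close>.\<close>
  define H where "H t = (LBINT \<tau>. damped b 1 (t - \<tau>) * damped s 1 \<tau>)" for t
  have Hi: "integrable lborel H"
    unfolding H_def by (intro integrable_convolution integrable_damped integrable_damped_s) auto
  have [measurable]: "H \<in> borel_measurable borel" using Hi by auto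
  have e: "(\<lambda>u. indicator {0<..<T} u * (- lam * bs u)) = (\<lambda>u. - lam * (indicator {0<..<T} u * (exp u * H u)))"
  proof
    fix u :: real
    show "indicator {0<..<T} u * (- lam * bs u) = - lam * (indicator {0<..<T} u * (exp u * H u))"
    proof (cases "u \<in> {0<..<T}")
      case True
      then have "H u = exp (- 1 * u) * bs u" unfolding H_def by (intro convolution_damped) auto
      then have "exp u * H u = bs u" by (simp flip: mult.assoc exp_add)
      then show ?thesis by simp
    qed simp
  qed
  show "integrable lborel (\<lambda>u. indicator {0<..<T} u * (- lam * bs u))"
    unfolding e
  proof (rule integrable_mult_right, rule Bochner_Integration.integrable_bound[where f = "\<lambda>u. exp T * H u"])
    show "integrable lborel (\<lambda>u. exp T * H u)" using Hi by simp
    show "AE u in lborel. norm (indicator {0<..<T} u * (exp u * H u)) \<le> norm (exp T * H u)"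
      by (auto simp: indicator_def abs_mult intro!: mult_right_mono)
  qed measurable
qed (rule that)

section \<open>Summation over the eigenmodes\<close>

lemma ennreal_suminf_swap: "(\<Sum>j. \<Sum>k. f j k) = (\<Sum>k. \<Sum>j. f j k :: ennreal)"
proof -
  have "(\<Sum>j. \<Sum>k. f j k) = (\<integral>\<^sup>+j. (\<Sum>k. f j k) \<partial>count_space UNIV)"
    by (simp add: nn_integral_count_space_nat)
  also have "\<dots> = (\<Sum>k. \<integral>\<^sup>+j. f j k \<partial>count_space UNIV)" by (rule nn_integral_suminf) simp
  finally show ?thesis by (simp add: nn_integral_count_space_nat)
qed

text \<open>Here \<open>r\<close> stands for 1/\<rho>. The two alternatives of the theorem meet in
  this one sum: in the first its terms are dominated by a multiple of \<lambda>^(-\<alpha>), in the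
  second it is at most the squared Hilbert-Schmidt norm.\<close>

lemma weighted_trace_finite:
  fixes e :: "nat \<Rightarrow> 'h::{real_inner,complete_space}"
  assumes es: "eigen_system e lam" and Q: "bounded_sa_nonneg Q"
    and cond: "(\<exists>\<alpha> \<kappa>. 0 < \<alpha> \<and> trace_Apow_finite lam \<alpha> \<and> Apow_comp_bounded e lam \<kappa> Q \<and>
              \<alpha> - r < \<kappa> \<and> \<kappa> \<le> \<alpha> \<and> \<nu> = r - \<alpha> + \<kappa>)
         \<or> (0 \<le> \<nu> \<and> HS_norm_sq_Apow e lam ((\<nu> - r) / 2) (op_sqrt Q) < \<infinity>)"
  shows "(\<Sum>k. ennreal (lam k powr (\<nu> - r) * (Q (e k) \<bullet> e k))) < \<infinity>"
proof -
  have on: "\<And>i j. e i \<bullet> e j = (if i = j then 1 else 0)" and cl: "closure (span (range e)) = UNIV"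
    and lam0: "0 < lam 0" and mono: "mono lam"
    using es by (auto simp: eigen_system_def)
  have lam: "lam k > 0" for k using lam0 monoD[OF mono, of 0 k] by simp
  have ne: "norm (e k) = 1" for k by (simp add: norm_eq_sqrt_inner on)
  from cond show ?thesis
  proof
    assume "\<exists>\<alpha> \<kappa>. 0 < \<alpha> \<and> trace_Apow_finite lam \<alpha> \<and> Apow_comp_bounded e lam \<kappa> Q \<and>
              \<alpha> - r < \<kappa> \<and> \<kappa> \<le> \<alpha> \<and> \<nu> = r - \<alpha> + \<kappa>"
    then obtain \<alpha> \<kappa> where tr: "summable (\<lambda>k. lam k powr (- \<alpha>))" and ab: "Apow_comp_bounded e lam \<kappa> Q"
      and \<nu>: "\<nu> = r - \<alpha> + \<kappa>" by (auto simp: trace_Apow_finite_def)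
    obtain C where C: "\<And>v. summable (\<lambda>k. (lam k powr \<kappa> * (Q v \<bullet> e k))\<^sup>2)"
      "\<And>v. (\<Sum>k. (lam k powr \<kappa> * (Q v \<bullet> e k))\<^sup>2) \<le> C\<^sup>2 * (norm v)\<^sup>2"
      using ab unfolding Apow_comp_bounded_def by blast
    have le: "lam k powr (\<nu> - r) * (Q (e k) \<bullet> e k) \<le> \<bar>C\<bar> * lam k powr (- \<alpha>)" for k
    proof -
      have "(lam k powr \<kappa> * (Q (e k) \<bullet> e k))\<^sup>2 = (\<Sum>i\<in>{k}. (lam i powr \<kappa> * (Q (e k) \<bullet> e i))\<^sup>2)" by simp
      also have "\<dots> \<le> (\<Sum>i. (lam i powr \<kappa> * (Q (e k) \<bullet> e i))\<^sup>2)"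
        by (intro sum_le_suminf C) auto
      also have "\<dots> \<le> C\<^sup>2" using C(2)[of "e k"] by (simp add: ne)
      finally have "\<bar>lam k powr \<kappa> * (Q (e k) \<bullet> e k)\<bar> \<le> \<bar>C\<bar>" unfolding abs_le_square_iff .
      then have "lam k powr \<kappa> * (Q (e k) \<bullet> e k) \<le> \<bar>C\<bar>" by linarith
      then have "lam k powr (- \<alpha>) * (lam k powr \<kappa> * (Q (e k) \<bullet> e k)) \<le> lam k powr (- \<alpha>) * \<bar>C\<bar>"
        by (intro mult_left_mono) auto
      \<comment> \<open>The relation between the parameters says exactly \<nu> - r = \<kappa> -
        \<alpha>.\<close>
      moreover have "lam k powr (\<nu> - r) = lam k powr (- \<alpha>) * lam k powr \<kappa>"
        by (simp add: \<nu> flip: powr_add)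
      ultimately show ?thesis by (simp add: mult_ac)
    qed
    have "(\<Sum>k. ennreal (lam k powr (\<nu> - r) * (Q (e k) \<bullet> e k))) \<le> (\<Sum>k. ennreal (\<bar>C\<bar> * lam k powr (- \<alpha>)))"
      by (intro suminf_le ennreal_leI le) auto
    also have "\<dots> < \<infinity>"
      unfolding infinity_ennreal_def less_top[symmetric] by (intro ennreal_suminf_neq_top summable_mult tr) auto
    finally show ?thesis .
  next
    assume HS: "0 \<le> \<nu> \<and> HS_norm_sq_Apow e lam ((\<nu> - r) / 2) (op_sqrt Q) < \<infinity>"
    define R where "R = op_sqrt Q"
    have R: "\<And>x y. R x \<bullet> y = x \<bullet> R y" "\<And>x. R (R x) = Q x"
      using op_sqrt[OF Q] by (auto simp: R_def bounded_sa_nonneg_def)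
    have "ennreal (lam k powr (\<nu> - r) * (Q (e k) \<bullet> e k)) \<le> (\<Sum>j. ennreal ((lam k powr ((\<nu> - r) / 2) * (R (e j) \<bullet> e k))\<^sup>2))" for k
    proof -
      \<comment> \<open>Expanding |R e_k|^2 in the basis and moving \<open>R\<close> across the
        inner product gives row sums of the Hilbert-Schmidt double series; the order of summation is
        exchanged afterwards.\<close>
      have "Q (e k) \<bullet> e k = (norm (R (e k)))\<^sup>2" by (simp add: power2_norm_eq_inner R(2)[symmetric] R(1))
      then have "ennreal (lam k powr (\<nu> - r) * (Q (e k) \<bullet> e k)) = ennreal (lam k powr (\<nu> - r)) * ennreal ((norm (R (e k)))\<^sup>2)"
        by (simp add: ennreal_mult)
      also have "\<dots> \<le> ennreal (lam k powr (\<nu> - r)) * (\<Sum>j. ennreal ((e j \<bullet> R (e k))\<^sup>2))"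
        by (intro mult_left_mono parseval_le on cl) auto
      also have "\<dots> = (\<Sum>j. ennreal (lam k powr (\<nu> - r)) * ennreal ((e j \<bullet> R (e k))\<^sup>2))" by simp
      also have "\<dots> = (\<Sum>j. ennreal ((lam k powr ((\<nu> - r) / 2) * (R (e j) \<bullet> e k))\<^sup>2))"
      proof (intro suminf_cong)
        fix j
        have "(lam k powr ((\<nu> - r) / 2))\<^sup>2 = lam k powr (\<nu> - r)" by (simp add: power2_eq_square flip: powr_add)
        then show "ennreal (lam k powr (\<nu> - r)) * ennreal ((e j \<bullet> R (e k))\<^sup>2) = ennreal ((lam k powr ((\<nu> - r) / 2) * (R (e j) \<bullet> e k))\<^sup>2)"
          by (simp add: power_mult_distrib R(1) ennreal_mult)
      qed
      finally show ?thesis .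
    qed
    then have "(\<Sum>k. ennreal (lam k powr (\<nu> - r) * (Q (e k) \<bullet> e k))) \<le> (\<Sum>k. \<Sum>j. ennreal ((lam k powr ((\<nu> - r) / 2) * (R (e j) \<bullet> e k))\<^sup>2))"
      by (intro suminf_le) auto
    also have "\<dots> = HS_norm_sq_Apow e lam ((\<nu> - r) / 2) R"
      unfolding HS_norm_sq_Apow_def by (rule ennreal_suminf_swap)
    also have "\<dots> < \<infinity>" using HS by (simp add: R_def)
    finally show ?thesis .
  qed
qed

theorem theorem3p6:
  fixes M :: "'a measure"
    and e :: "nat \<Rightarrow> 'h::{real_inner,complete_space}"
    and lam :: "nat \<Rightarrow> real"
    and b :: "real \<Rightarrow> real"
    and s :: "nat \<Rightarrow> real \<Rightarrow> real"
    and Q :: "'h \<Rightarrow> 'h"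
    and W :: "real \<Rightarrow> 'h \<Rightarrow> 'a \<Rightarrow> real"
    and u0 :: "'a \<Rightarrow> 'h"
    and \<nu> :: real
  assumes "prob_space M"
    and "eigen_system e lam"
    and "assumption1 b"
    and "resolvent_family b lam s"
    and "bounded_sa_nonneg Q"
    and "cyl_Q_wiener M Q W"
    and "u0 \<in> borel_measurable M"
    and "indep_of_process M u0 W"
    and "(\<exists>\<alpha> \<kappa>. 0 < \<alpha> \<and> trace_Apow_finite lam \<alpha> \<and> Apow_comp_bounded e lam \<kappa> Q \<and>
              \<alpha> - 1 / rho_index b < \<kappa> \<and> \<kappa> \<le> \<alpha> \<and> \<nu> = 1 / rho_index b - \<alpha> + \<kappa>)
         \<or> (0 \<le> \<nu> \<and> HS_norm_sq_Apow e lam ((\<nu> - 1 / rho_index b) / 2) (op_sqrt Q) < \<infinity>)"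
    and "(\<integral>\<^sup>+\<omega>. nu_norm_sq lam \<nu> (\<lambda>k. u0 \<omega> \<bullet> e k) \<partial>M) < \<infinity>"
  shows "\<exists>C>0. \<forall>t\<ge>0. (\<integral>\<^sup>+\<omega>. nu_norm_sq lam \<nu> (sol_coef s u0 W e t \<omega>) \<partial>M) \<le> ennreal C"
proof -
  let ?r = "1 / rho_index b"
  let ?q = "\<lambda>k. ennreal (lam k powr (\<nu> - ?r) * (Q (e k) \<bullet> e k))"
  let ?U = "\<lambda>k. \<integral>\<^sup>+\<omega>. ennreal (lam k powr \<nu> * (u0 \<omega> \<bullet> e k)\<^sup>2) \<partial>M"
  interpret kernel b by (rule kernel.intro) (rule assms)
  have lam0: "0 < lam 0" and mono: "mono lam" using assms(2) by (auto simp: eigen_system_def)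
  have lamge: "lam k \<ge> lam 0" for k using monoD[OF mono, of 0 k] by simp
  have lam: "lam k > 0" for k using lam0 lamge[of k] by linarith
  have res: "resolvent b (s k) (lam k)" for k
    using assms(4) lam[of k] unfolding resolvent_family_def
    by (intro resolvent.intro kernel_axioms resolvent_axioms.intro) auto
  have q: "Q (e k) \<bullet> e k \<ge> 0" for k using assms(5) unfolding bounded_sa_nonneg_def by blast
  obtain C where C: "C > 0" "\<And>k T. T \<ge> 0 \<Longrightarrow> (LBINT t. indicator {0<..T} t * (s k t)\<^sup>2) \<le> C * lam k powr (- 1 / rho_index b)"
  proof (rule resolvent_L2[OF lam0])
    fix C :: real
    assume "C > 0" and "\<And>s lam' T. resolvent b s lam' \<Longrightarrow> lam' \<ge> lam 0 \<Longrightarrow> T \<ge> 0 \<Longrightarrow>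
       (LBINT t. indicator {0<..T} t * (s t)\<^sup>2) \<le> C * lam' powr (- 1 / rho_index b)"
    then show thesis using that res lamge by blast
  qed
  define A where "A = (\<integral>\<^sup>+\<omega>. nu_norm_sq lam \<nu> (\<lambda>k. u0 \<omega> \<bullet> e k) \<partial>M)"
  define S where "S = (\<Sum>k. ?q k)"
  have S: "S < \<infinity>" unfolding S_def by (rule weighted_trace_finite[OF assms(2,5,9)])
  have um[measurable]: "(\<lambda>\<omega>. u0 \<omega> \<bullet> e k) \<in> borel_measurable M" for k
    by (rule measurable_compose[OF assms(7)]) (intro borel_measurable_continuous_onI continuous_intros)
  have main: "(\<integral>\<^sup>+\<omega>. nu_norm_sq lam \<nu> (sol_coef s u0 W e t \<omega>) \<partial>M) \<le> 2 * A + ennreal (2 * C) * S" if t: "t \<ge> 0" for t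
  proof -
    have "\<forall>k. \<exists>Y. Y \<in> borel_measurable M \<and> (AE \<omega> in M. ennreal ((stoch_conv_coef s W e k t \<omega>)\<^sup>2) \<le> Y \<omega>) \<and>
      (\<integral>\<^sup>+\<omega>. Y \<omega> \<partial>M) \<le> ennreal ((Q (e k) \<bullet> e k) * (LBINT u. indicator {0<..t} u * (s k u)\<^sup>2))"
    proof
      fix k
      show "\<exists>Y. Y \<in> borel_measurable M \<and> (AE \<omega> in M. ennreal ((stoch_conv_coef s W e k t \<omega>)\<^sup>2) \<le> Y \<omega>) \<and>
        (\<integral>\<^sup>+\<omega>. Y \<omega> \<partial>M) \<le> ennreal ((Q (e k) \<bullet> e k) * (LBINT u. indicator {0<..t} u * (s k u)\<^sup>2))"
        unfolding stoch_conv_coef_def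
        by (rule resolvent.stoch_conv_second_moment[OF res assms(1,6) t q[of k]]) blast
    qed
    from choice[OF this] obtain Y where Ym[measurable]: "\<And>k. Y k \<in> borel_measurable M"
      and Yle: "\<And>k. AE \<omega> in M. ennreal ((stoch_conv_coef s W e k t \<omega>)\<^sup>2) \<le> Y k \<omega>"
      and Yint: "\<And>k. (\<integral>\<^sup>+\<omega>. Y k \<omega> \<partial>M) \<le> ennreal ((Q (e k) \<bullet> e k) * (LBINT u. indicator {0<..t} u * (s k u)\<^sup>2))"
      by blast
    \<comment> \<open>A measurable majorant of the k-th mode, from (x + y)^2 \<le> 2 x^2 + 2 y^2 and
      |s_k| \<le> 1; integral and sum over k may then be exchanged.\<close>
    define g where "g k \<omega> = 2 * ennreal (lam k powr \<nu> * (u0 \<omega> \<bullet> e k)\<^sup>2) + ennreal (2 * lam k powr \<nu>) * Y k \<omega>" for k \<omega>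
    have "AE \<omega> in M. \<forall>k. ennreal ((stoch_conv_coef s W e k t \<omega>)\<^sup>2) \<le> Y k \<omega>"
      by (simp add: AE_all_countable Yle)
    then have "(\<integral>\<^sup>+\<omega>. nu_norm_sq lam \<nu> (sol_coef s u0 W e t \<omega>) \<partial>M) \<le> (\<integral>\<^sup>+\<omega>. (\<Sum>k. g k \<omega>) \<partial>M)"
      unfolding nu_norm_sq_def
    proof (intro nn_integral_mono_AE, eventually_elim)
      case (elim \<omega>)
      show ?case
      proof (intro suminf_le allI)
        fix k
        interpret resolvent b "s k" "lam k" by (rule res)
        let ?x = "s k t * (u0 \<omega> \<bullet> e k)" and ?y = "stoch_conv_coef s W e k t \<omega>"
        have x: "?x\<^sup>2 \<le> (u0 \<omega> \<bullet> e k)\<^sup>2"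
        proof -
          have "(s k t)\<^sup>2 \<le> 1" using resolvent_bound[OF t] by (simp add: abs_square_le_1)
          then show ?thesis by (simp add: power_mult_distrib mult_left_le_one_le)
        qed
        have "(?x + ?y)\<^sup>2 \<le> 2 * ?x\<^sup>2 + 2 * ?y\<^sup>2"
          using sum_squares_bound[of ?x ?y] by (simp add: power2_sum)
        also have "\<dots> \<le> 2 * (u0 \<omega> \<bullet> e k)\<^sup>2 + 2 * ?y\<^sup>2" using x by simp
        finally have "lam k powr \<nu> * (?x + ?y)\<^sup>2 \<le> lam k powr \<nu> * (2 * (u0 \<omega> \<bullet> e k)\<^sup>2 + 2 * ?y\<^sup>2)"
          by (intro mult_left_mono) auto
        then have "ennreal (lam k powr \<nu> * (sol_coef s u0 W e t \<omega> k)\<^sup>2) \<le> ennreal (2 * (lam k powr \<nu> * (u0 \<omega> \<bullet> e k)\<^sup>2) + 2 * lam k powr \<nu> * ?y\<^sup>2)"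
          unfolding sol_coef_def by (intro ennreal_leI) (simp add: algebra_simps)
        also have "\<dots> = 2 * ennreal (lam k powr \<nu> * (u0 \<omega> \<bullet> e k)\<^sup>2) + ennreal (2 * lam k powr \<nu>) * ennreal (?y\<^sup>2)"
          by (simp add: ennreal_plus ennreal_mult')
        also have "\<dots> \<le> g k \<omega>" unfolding g_def using elim by (intro add_left_mono mult_left_mono) auto
        finally show "ennreal (lam k powr \<nu> * (sol_coef s u0 W e t \<omega> k)\<^sup>2) \<le> g k \<omega>" .
      qed auto
    qed
    also have "\<dots> = (\<Sum>k. \<integral>\<^sup>+\<omega>. g k \<omega> \<partial>M)"
      by (rule nn_integral_suminf) (simp add: g_def)
    also have "\<dots> \<le> (\<Sum>k. 2 * ?U k + ennreal (2 * C) * ?q k)"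
    proof (intro suminf_le allI)
      fix k
      have "(\<integral>\<^sup>+\<omega>. g k \<omega> \<partial>M) = 2 * ?U k + ennreal (2 * lam k powr \<nu>) * (\<integral>\<^sup>+\<omega>. Y k \<omega> \<partial>M)"
        unfolding g_def by (subst nn_integral_add) (auto simp: nn_integral_cmult)
      moreover have "ennreal (2 * lam k powr \<nu>) * (\<integral>\<^sup>+\<omega>. Y k \<omega> \<partial>M) \<le> ennreal (2 * C) * ?q k"
      proof -
        have "(\<integral>\<^sup>+\<omega>. Y k \<omega> \<partial>M) \<le> ennreal ((Q (e k) \<bullet> e k) * (C * lam k powr (- 1 / rho_index b)))"
          using C(2)[OF t, of k] q[of k] by (intro order_trans[OF Yint] ennreal_leI mult_left_mono)
        then have "ennreal (2 * lam k powr \<nu>) * (\<integral>\<^sup>+\<omega>. Y k \<omega> \<partial>M) \<le> ennreal (2 * lam k powr \<nu>) * ennreal ((Q (e k) \<bullet> e k) * (C * lam k powr (- 1 / rho_index b)))"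
          by (rule mult_left_mono) auto
        also have "\<dots> = ennreal (2 * lam k powr \<nu> * ((Q (e k) \<bullet> e k) * (C * lam k powr (- 1 / rho_index b))))"
          using q[of k] C(1) by (intro ennreal_mult[symmetric]) auto
        \<comment> \<open>The decay \<lambda>^(-1/\<rho>) of the square integral turns the weight
          \<lambda>^\<nu> into the exponent \<nu> - r of
          \<open>weighted_trace_finite\<close>.\<close>
        also have "2 * lam k powr \<nu> * ((Q (e k) \<bullet> e k) * (C * lam k powr (- 1 / rho_index b))) = 2 * C * (lam k powr (\<nu> - ?r) * (Q (e k) \<bullet> e k))"
          by (simp add: powr_diff powr_minus_divide flip: minus_divide_left)
        also have "ennreal (2 * C * (lam k powr (\<nu> - ?r) * (Q (e k) \<bullet> e k))) = ennreal (2 * C) * ?q k"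
          using q[of k] C(1) by (intro ennreal_mult) auto
        finally show ?thesis .
      qed
      ultimately show "(\<integral>\<^sup>+\<omega>. g k \<omega> \<partial>M) \<le> 2 * ?U k + ennreal (2 * C) * ?q k"
        by (simp add: add_left_mono)
    qed auto
    also have "\<dots> = 2 * (\<Sum>k. \<integral>\<^sup>+\<omega>. ennreal (lam k powr \<nu> * (u0 \<omega> \<bullet> e k)\<^sup>2) \<partial>M) + ennreal (2 * C) * S"
      by (simp add: S_def flip: suminf_add)
    also have "(\<Sum>k. \<integral>\<^sup>+\<omega>. ennreal (lam k powr \<nu> * (u0 \<omega> \<bullet> e k)\<^sup>2) \<partial>M) = A"
      unfolding A_def nu_norm_sq_def by (rule nn_integral_suminf[symmetric]) measurable
    finally show ?thesis .
  qed
  let ?S = "enn2real (2 * A + ennreal (2 * C) * S)"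
  have "2 * A + ennreal (2 * C) * S < \<infinity>"
    using S assms(10) by (simp add: A_def ennreal_mult_less_top flip: A_def)
  then have fin: "2 * A + ennreal (2 * C) * S = ennreal (?S)"
    by (simp add: less_top)
  show ?thesis
  \<comment> \<open>Adding 1 keeps the constant positive when the bound itself is 0.\<close>
  proof (intro exI[of _ "?S + 1"] conjI allI impI)
    show "0 < ?S + 1" by (simp add: add_nonneg_pos)
    fix t :: real assume "t \<ge> 0"
    then have "(\<integral>\<^sup>+\<omega>. nu_norm_sq lam \<nu> (sol_coef s u0 W e t \<omega>) \<partial>M) \<le> ennreal (?S)"
      using main fin by simp
    also have "\<dots> \<le> ennreal (?S + 1)" by (intro ennreal_leI) simp
    finally show "(\<integral>\<^sup>+\<omega>. nu_norm_sq lam \<nu> (sol_coef s u0 W e t \<omega>) \<partial>M) \<le> ennreal (?S + 1)" .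
  qed
qed

end
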